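(* Let $p$ be a prime, let $(G_i)_{i\in I}$ be a (not necessarily finite) family of pro-$p$ groups and let $G=\coprod_{i\in I}G_i$ be its free pro-$p$ product. Then $G$ has the $p$-Kijima--Nishi property if and only if all the $G_i$ have the $p$-Kijima--Nishi property.
   Context: For a profinite group $G$, $\mathrm{H}^n(G,\mathbb{F}_p)$ is continuous cohomology with trivial coefficients and $$\mathcal{R}_p(G)=\{\alpha\in \mathrm{H}^1(G,\mathbb{F}_p) : \alpha\smile\beta=0 \text{ for all }\beta\in \mathrm{H}^1(G,\mathbb{F}_p)\}.$$ For an open subgroup $U\le G$, corestriction maps $\mathcal{R}_p(U)$ into $\mathcal{R}_p(G)$, inducing $c_{U,G}:\mathcal{R}_p(U)\to\mathcal{R}_p(G)$. $G$ has the $p$-Kijima--Nishi property if $c_{U,G}$ is surjective for every open normal subgroup $U$ of index $p$. The free pro-$p$ product of a family $(G_i)_{i\in I}$ of pro-$p$ groups (in the sense of Neukirch--Schmidt--Wingberg, Ch. IV, \S 1) is $\varprojlim_N (\ast_{i\in I}G_i)/N$, where $\ast_{i\in I}G_i$ is the abstract free product and $N$ runs over the normal subgroups of $p$-power index such that $N\cap G_i$ is open in $G_i$ for all $i$ and $G_i\subseteq N$ for all but finitely many $i$. *)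

theory Defs
  imports
    "HOL-Analysis.Analysis"
    "HOL-Algebra.Product_Groups"
    "HOL-Number_Theory.Residues"
begin

section \<open>Profinite and pro-\<open>p\<close> groups\<close>

definition topological_group :: "('a, 'b) monoid_scheme \<Rightarrow> 'a topology \<Rightarrow> bool" where
  "topological_group G T \<longleftrightarrow>
     group G \<and> topspace T = carrier G \<and>
     continuous_map (prod_topology T T) T (\<lambda>(x, y). x \<otimes>\<^bsub>G\<^esub> y) \<and>
     continuous_map T T (\<lambda>x. inv\<^bsub>G\<^esub> x)"

definition totally_disconnected_space :: "'a topology \<Rightarrow> bool" where
  "totally_disconnected_space T \<longleftrightarrow> (\<forall>x \<in> topspace T. connected_component_of_set T x = {x})"

definition profinite_group :: "('a, 'b) monoid_scheme \<Rightarrow> 'a topology \<Rightarrow> bool" where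
  "profinite_group G T \<longleftrightarrow>
     topological_group G T \<and> compact_space T \<and> Hausdorff_space T \<and> totally_disconnected_space T"

definition pro_p_group :: "nat \<Rightarrow> ('a, 'b) monoid_scheme \<Rightarrow> 'a topology \<Rightarrow> bool" where
  "pro_p_group p G T \<longleftrightarrow>
     profinite_group G T \<and>
     (\<forall>N. N \<lhd> G \<and> openin T N \<longrightarrow> (\<exists>k. card (rcosets\<^bsub>G\<^esub> N) = p ^ k))"

section \<open>Continuous cohomology with trivial discrete coefficients\<close>

text \<open>
  Cohomology is computed by the standard homogeneous complex. An \<open>n\<close>-cochain of \<open>G\<close> with values
  in the trivial discrete module underlying a ring \<open>R\<close> is a continuous function \<open>x\<close> of
  \<open>(s 0, \<dots>, s n)\<close> that satisfies \<open>x (g s 0, \<dots>, g s n) = x (s 0, \<dots>, s n)\<close>.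
\<close>

definition tuples :: "('a, 'b) monoid_scheme \<Rightarrow> nat \<Rightarrow> (nat \<Rightarrow> 'a) set" where
  "tuples G n = (\<Pi>\<^sub>E i\<in>{..n}. carrier G)"

definition cochains ::
  "('r, 's) ring_scheme \<Rightarrow> ('a, 'b) monoid_scheme \<Rightarrow> 'a topology \<Rightarrow> nat \<Rightarrow> ((nat \<Rightarrow> 'a) \<Rightarrow> 'r) set" where
  "cochains R G T n =
     {x \<in> extensional (tuples G n).
        continuous_map (product_topology (\<lambda>_. T) {..n}) (discrete_topology (carrier R)) x \<and>
        (\<forall>g \<in> carrier G. \<forall>s \<in> tuples G n. x (\<lambda>i\<in>{..n}. g \<otimes>\<^bsub>G\<^esub> s i) = x s)}"

definition cochain_group ::
  "('r, 's) ring_scheme \<Rightarrow> ('a, 'b) monoid_scheme \<Rightarrow> 'a topology \<Rightarrow> nat \<Rightarrow> ((nat \<Rightarrow> 'a) \<Rightarrow> 'r) monoid" where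
  "cochain_group R G T n =
     \<lparr>carrier = cochains R G T n,
      monoid.mult = (\<lambda>x y. \<lambda>s\<in>tuples G n. x s \<oplus>\<^bsub>R\<^esub> y s),
      one = (\<lambda>s\<in>tuples G n. \<zero>\<^bsub>R\<^esub>)\<rparr>"

text \<open>\<open>face n i s\<close> is \<open>(s 0, \<dots>, s (n + 1))\<close> with the entry \<open>s i\<close> left out.\<close>

definition face :: "nat \<Rightarrow> nat \<Rightarrow> (nat \<Rightarrow> 'a) \<Rightarrow> nat \<Rightarrow> 'a" where
  "face n i s = (\<lambda>j\<in>{..n}. if j < i then s j else s (Suc j))"

definition coboundary_map ::
  "('r, 's) ring_scheme \<Rightarrow> ('a, 'b) monoid_scheme \<Rightarrow> nat \<Rightarrow> ((nat \<Rightarrow> 'a) \<Rightarrow> 'r) \<Rightarrow> (nat \<Rightarrow> 'a) \<Rightarrow> 'r" where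
  "coboundary_map R G n x =
     (\<lambda>s\<in>tuples G (Suc n).
        \<Oplus>\<^bsub>R\<^esub>i\<in>{..Suc n}. (\<ominus>\<^bsub>R\<^esub> \<one>\<^bsub>R\<^esub>) [^]\<^bsub>R\<^esub> i \<otimes>\<^bsub>R\<^esub> x (face n i s))"

definition cocycles ::
  "('r, 's) ring_scheme \<Rightarrow> ('a, 'b) monoid_scheme \<Rightarrow> 'a topology \<Rightarrow> nat \<Rightarrow> ((nat \<Rightarrow> 'a) \<Rightarrow> 'r) set" where
  "cocycles R G T n = kernel (cochain_group R G T n) (cochain_group R G T (Suc n)) (coboundary_map R G n)"

definition coboundaries ::
  "('r, 's) ring_scheme \<Rightarrow> ('a, 'b) monoid_scheme \<Rightarrow> 'a topology \<Rightarrow> nat \<Rightarrow> ((nat \<Rightarrow> 'a) \<Rightarrow> 'r) set" where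
  "coboundaries R G T n =
     (case n of 0 \<Rightarrow> {\<one>\<^bsub>cochain_group R G T 0\<^esub>}
      | Suc m \<Rightarrow> coboundary_map R G m ` cochains R G T m)"

definition cohomology ::
  "('r, 's) ring_scheme \<Rightarrow> ('a, 'b) monoid_scheme \<Rightarrow> 'a topology \<Rightarrow> nat \<Rightarrow> ((nat \<Rightarrow> 'a) \<Rightarrow> 'r) set monoid" where
  "cohomology R G T n =
     (cochain_group R G T n)\<lparr>carrier := cocycles R G T n\<rparr> Mod coboundaries R G T n"

definition cochain_class ::
  "('r, 's) ring_scheme \<Rightarrow> ('a, 'b) monoid_scheme \<Rightarrow> 'a topology \<Rightarrow> nat \<Rightarrow>
   ((nat \<Rightarrow> 'a) \<Rightarrow> 'r) \<Rightarrow> ((nat \<Rightarrow> 'a) \<Rightarrow> 'r) set" where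
  "cochain_class R G T n x = coboundaries R G T n #>\<^bsub>cochain_group R G T n\<^esub> x"

definition cup_cochain ::
  "('r, 's) ring_scheme \<Rightarrow> ('a, 'b) monoid_scheme \<Rightarrow> nat \<Rightarrow> nat \<Rightarrow>
   ((nat \<Rightarrow> 'a) \<Rightarrow> 'r) \<Rightarrow> ((nat \<Rightarrow> 'a) \<Rightarrow> 'r) \<Rightarrow> (nat \<Rightarrow> 'a) \<Rightarrow> 'r" where
  "cup_cochain R G m n x y =
     (\<lambda>s\<in>tuples G (m + n). x (\<lambda>i\<in>{..m}. s i) \<otimes>\<^bsub>R\<^esub> y (\<lambda>i\<in>{..n}. s (m + i)))"

text \<open>
  Maps on cohomology are induced by maps on cochains: the union over all representatives
  is a single class because the class does not depend on the representatives.
\<close>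

definition cup ::
  "('r, 's) ring_scheme \<Rightarrow> ('a, 'b) monoid_scheme \<Rightarrow> 'a topology \<Rightarrow> nat \<Rightarrow> nat \<Rightarrow>
   ((nat \<Rightarrow> 'a) \<Rightarrow> 'r) set \<Rightarrow> ((nat \<Rightarrow> 'a) \<Rightarrow> 'r) set \<Rightarrow> ((nat \<Rightarrow> 'a) \<Rightarrow> 'r) set" where
  "cup R G T m n \<alpha> \<beta> =
     (\<Union>x\<in>\<alpha>. \<Union>y\<in>\<beta>. cochain_class R G T (m + n) (cup_cochain R G m n x y))"

section \<open>Open subgroups and corestriction\<close>

text \<open>
  Corestriction from a subgroup \<open>U\<close> of finite index is given on homogeneous cochains by
  \<open>(cor x) (s 0, \<dots>, s n) = (\<Sum>c \<in> U\G. x (c' (s 0) (c (s 0))'\<^sup>-\<^sup>1, \<dots>, c' (s n) (c (s n))'\<^sup>-\<^sup>1))\<close>,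
  where \<open>c'\<close> is a representative of the right coset \<open>c\<close>; another choice of representatives gives
  the same map on cohomology.
\<close>

definition coset_rep :: "'a set \<Rightarrow> 'a" where
  "coset_rep c = (SOME t. t \<in> c)"

definition cor_cochain ::
  "('r, 's) ring_scheme \<Rightarrow> ('a, 'b) monoid_scheme \<Rightarrow> 'a set \<Rightarrow> nat \<Rightarrow>
   ((nat \<Rightarrow> 'a) \<Rightarrow> 'r) \<Rightarrow> (nat \<Rightarrow> 'a) \<Rightarrow> 'r" where
  "cor_cochain R G U n x =
     (\<lambda>s\<in>tuples G n.
        \<Oplus>\<^bsub>R\<^esub>c\<in>rcosets\<^bsub>G\<^esub> U.
          x (\<lambda>i\<in>{..n}. coset_rep c \<otimes>\<^bsub>G\<^esub> s i \<otimes>\<^bsub>G\<^esub> inv\<^bsub>G\<^esub> (coset_rep (c #>\<^bsub>G\<^esub> s i))))"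

definition corestriction ::
  "('r, 's) ring_scheme \<Rightarrow> ('a, 'b) monoid_scheme \<Rightarrow> 'a topology \<Rightarrow> 'a set \<Rightarrow> nat \<Rightarrow>
   ((nat \<Rightarrow> 'a) \<Rightarrow> 'r) set \<Rightarrow> ((nat \<Rightarrow> 'a) \<Rightarrow> 'r) set" where
  "corestriction R G T U n \<alpha> = (\<Union>x\<in>\<alpha>. cochain_class R G T n (cor_cochain R G U n x))"

section \<open>The Kijima--Nishi property\<close>

definition cup_radical ::
  "nat \<Rightarrow> ('a, 'b) monoid_scheme \<Rightarrow> 'a topology \<Rightarrow> ((nat \<Rightarrow> 'a) \<Rightarrow> int) set set" where
  "cup_radical p G T =
     (let F = residue_ring (int p) in
      {\<alpha> \<in> carrier (cohomology F G T 1).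
         \<forall>\<beta> \<in> carrier (cohomology F G T 1). cup F G T 1 1 \<alpha> \<beta> = \<one>\<^bsub>cohomology F G T (1 + 1)\<^esub>})"

text \<open>
  Corestriction maps the radical of \<open>U\<close> into that of \<open>G\<close> (projection formula), so surjectivity
  of the induced map is the inclusion below.
\<close>

definition kijima_nishi :: "nat \<Rightarrow> ('a, 'b) monoid_scheme \<Rightarrow> 'a topology \<Rightarrow> bool" where
  "kijima_nishi p G T \<longleftrightarrow>
     (\<forall>U. U \<lhd> G \<and> openin T U \<and> card (rcosets\<^bsub>G\<^esub> U) = p \<longrightarrow>
        cup_radical p G T \<subseteq>
          corestriction (residue_ring (int p)) G T U 1 `
            cup_radical p (G\<lparr>carrier := U\<rparr>) (subtopology T U))"

section \<open>Free products and free pro-\<open>p\<close> products\<close>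

definition free_words :: "'i set \<Rightarrow> ('i \<Rightarrow> ('a, 'b) monoid_scheme) \<Rightarrow> ('i \<times> 'a) list set" where
  "free_words I G = lists (SIGMA i:I. carrier (G i))"

inductive free_word_eq ::
  "'i set \<Rightarrow> ('i \<Rightarrow> ('a, 'b) monoid_scheme) \<Rightarrow> ('i \<times> 'a) list \<Rightarrow> ('i \<times> 'a) list \<Rightarrow> bool"
  for I G where
  refl: "w \<in> free_words I G \<Longrightarrow> free_word_eq I G w w"
| sym: "free_word_eq I G v w \<Longrightarrow> free_word_eq I G w v"
| trans: "free_word_eq I G u v \<Longrightarrow> free_word_eq I G v w \<Longrightarrow> free_word_eq I G u w"
| one: "i \<in> I \<Longrightarrow> u \<in> free_words I G \<Longrightarrow> v \<in> free_words I G \<Longrightarrow>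
    free_word_eq I G (u @ [(i, \<one>\<^bsub>G i\<^esub>)] @ v) (u @ v)"
| mult: "i \<in> I \<Longrightarrow> g \<in> carrier (G i) \<Longrightarrow> h \<in> carrier (G i) \<Longrightarrow>
    u \<in> free_words I G \<Longrightarrow> v \<in> free_words I G \<Longrightarrow>
    free_word_eq I G (u @ [(i, g), (i, h)] @ v) (u @ [(i, g \<otimes>\<^bsub>G i\<^esub> h)] @ v)"

definition free_word_class ::
  "'i set \<Rightarrow> ('i \<Rightarrow> ('a, 'b) monoid_scheme) \<Rightarrow> ('i \<times> 'a) list \<Rightarrow> ('i \<times> 'a) list set" where
  "free_word_class I G w = {v. free_word_eq I G w v}"

definition free_product ::
  "'i set \<Rightarrow> ('i \<Rightarrow> ('a, 'b) monoid_scheme) \<Rightarrow> ('i \<times> 'a) list set monoid" where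
  "free_product I G =
     \<lparr>carrier = free_word_class I G ` free_words I G,
      monoid.mult = (\<lambda>A B. \<Union>u\<in>A. \<Union>v\<in>B. free_word_class I G (u @ v)),
      one = free_word_class I G []\<rparr>"

definition free_product_incl ::
  "'i set \<Rightarrow> ('i \<Rightarrow> ('a, 'b) monoid_scheme) \<Rightarrow> 'i \<Rightarrow> 'a \<Rightarrow> ('i \<times> 'a) list set" where
  "free_product_incl I G i g = free_word_class I G [(i, g)]"

definition free_pro_p_subgroups ::
  "nat \<Rightarrow> 'i set \<Rightarrow> ('i \<Rightarrow> ('a, 'b) monoid_scheme) \<Rightarrow> ('i \<Rightarrow> 'a topology) \<Rightarrow>
   ('i \<times> 'a) list set set set" where
  "free_pro_p_subgroups p I G T =
     {N. N \<lhd> free_product I G \<and>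
         (\<exists>k. card (rcosets\<^bsub>free_product I G\<^esub> N) = p ^ k) \<and>
         (\<forall>i\<in>I. openin (T i) {g \<in> carrier (G i). free_product_incl I G i g \<in> N}) \<and>
         finite {i \<in> I. \<not> free_product_incl I G i ` carrier (G i) \<subseteq> N}}"

text \<open>
  The inverse limit is the group of compatible families in the product of the quotients by the
  subgroups \<open>N\<close>; for \<open>N \<subseteq> M\<close> the transition map sends a coset \<open>c\<close> of \<open>N\<close> to the coset \<open>M c\<close>.
\<close>

definition free_pro_p_product ::
  "nat \<Rightarrow> 'i set \<Rightarrow> ('i \<Rightarrow> ('a, 'b) monoid_scheme) \<Rightarrow> ('i \<Rightarrow> 'a topology) \<Rightarrow>
   (('i \<times> 'a) list set set \<Rightarrow> ('i \<times> 'a) list set set) monoid" where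
  "free_pro_p_product p I G T =
     (let F = free_product I G; \<N> = free_pro_p_subgroups p I G T; P = product_group \<N> (\<lambda>N. F Mod N) in
      P\<lparr>carrier := {x \<in> carrier P. \<forall>N\<in>\<N>. \<forall>M\<in>\<N>. N \<subseteq> M \<longrightarrow> M <#>\<^bsub>F\<^esub> x N = x M}\<rparr>)"

definition free_pro_p_topology ::
  "nat \<Rightarrow> 'i set \<Rightarrow> ('i \<Rightarrow> ('a, 'b) monoid_scheme) \<Rightarrow> ('i \<Rightarrow> 'a topology) \<Rightarrow>
   (('i \<times> 'a) list set set \<Rightarrow> ('i \<times> 'a) list set set) topology" where
  "free_pro_p_topology p I G T =
     subtopology
       (product_topology (\<lambda>N. discrete_topology (carrier (free_product I G Mod N)))
          (free_pro_p_subgroups p I G T))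
       (carrier (free_pro_p_product p I G T))"

end

theory Submission
  imports Defs
begin

text \<open>
  A class \<open>\<alpha>\<close> lies in the radical iff for every \<open>\<beta>\<close> the homomorphism \<open>(\<alpha>, \<beta>)\<close> to \<open>C\<^sub>p \<times> C\<^sub>p\<close> lifts to the
  Heisenberg group over \<open>\<int>/p\<close>. A homomorphism from the kernel of \<open>\<kappa> : G \<rightarrow> C\<^sub>p\<close> to \<open>P\<close> is the same, up to
  conjugation, as a homomorphism over \<open>\<kappa>\<close> from \<open>G\<close> to the wreath product of \<open>P\<close> with \<open>C\<^sub>p\<close>
  (nonabelian Shapiro lemma), and for \<open>P = C\<^sub>p\<close> corestriction becomes summation of the coordinates.
  So the Kijima--Nishi property speaks only about homomorphisms to finite \<open>p\<close>-groups and their lifts,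
  and by the universal property of the free pro-\<open>p\<close> product these can be found on each factor
  separately. In particular the Kurosh subgroup theorem is not needed.
\<close>

text \<open>By Kurosh the kernel of \<open>\<kappa>\<close> on a free product is built from
  conjugates of subgroups of the factors and a free group, so a class on it cannot be assembled
  directly from the kernels in the factors. Shapiro's lemma removes the kernel: a class on it, and a
  Heisenberg lift on it, become homomorphisms of the whole group, which are determined by their
  restrictions to the factors. Two points shape the local statement. The restriction of
  \<open>\<kappa>\<close> to a factor need not be surjective; then it is zero, as p is prime, it
  gives no subgroup of index p, and the property of that factor does not apply. Moreover, a family
  of homomorphisms on infinitely many factors extends to the product only if almost all of them are
  trivial, so local solutions have to be trivial wherever their data are. The Heisenberg group
  enters because a * b' is both its factor set and the cochain of a cup product of degree-one
  classes: a lift is the same as a cochain whose coboundary is that product.\<close>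

section \<open>Homomorphisms to discrete groups\<close>

text \<open>Open fibres express continuity for the discrete topology on \<open>P\<close>, so targets
  carry no topology. Values outside \<open>carrier G\<close> are left free; hence homomorphisms are
  compared only on the carrier.\<close>

definition discrete_hom ::
  "('a, 'b) monoid_scheme \<Rightarrow> 'a topology \<Rightarrow> ('c, 'd) monoid_scheme \<Rightarrow> ('a \<Rightarrow> 'c) set" where
  "discrete_hom G T P = {f \<in> hom G P. \<forall>x. openin T {g \<in> carrier G. f g = x}}"

lemma discrete_homD:
  assumes "f \<in> discrete_hom G T P"
  shows "f \<in> hom G P"
    and "g \<in> carrier G \<Longrightarrow> f g \<in> carrier P"
    and "g \<in> carrier G \<Longrightarrow> h \<in> carrier G \<Longrightarrow> f (g \<otimes>\<^bsub>G\<^esub> h) = f g \<otimes>\<^bsub>P\<^esub> f h"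
    and "openin T {g \<in> carrier G. f g = x}"
  using assms by (auto simp: discrete_hom_def hom_def)

lemma discrete_homI:
  assumes "\<And>g. g \<in> carrier G \<Longrightarrow> f g \<in> carrier P"
    and "\<And>g h. g \<in> carrier G \<Longrightarrow> h \<in> carrier G \<Longrightarrow> f (g \<otimes>\<^bsub>G\<^esub> h) = f g \<otimes>\<^bsub>P\<^esub> f h"
    and "\<And>x. openin T {g \<in> carrier G. f g = x}"
  shows "f \<in> discrete_hom G T P"
  using assms by (auto simp: discrete_hom_def hom_def)

lemma openin_fibre_comp:
  assumes "\<And>x. openin T {g \<in> A. f g = x}"
  shows "openin T {g \<in> A. h (f g) = y}"
proof -
  have "{g \<in> A. h (f g) = y} = (\<Union>x\<in>{x. h x = y}. {g \<in> A. f g = x})" by auto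
  then show ?thesis using assms by (auto intro: openin_Union)
qed

lemma openin_fibre_Pair:
  assumes "\<And>x. openin T {g \<in> A. f g = x}" and "\<And>x. openin T {g \<in> A. h g = x}"
  shows "openin T {g \<in> A. (f g, h g) = z}"
proof -
  have "{g \<in> A. (f g, h g) = z} = {g \<in> A. f g = fst z} \<inter> {g \<in> A. h g = snd z}" by (cases z) auto
  then show ?thesis using assms by (simp add: openin_Int)
qed

lemma openin_fibre_comp2:
  assumes "\<And>x. openin T {g \<in> A. f g = x}" and "\<And>x. openin T {g \<in> A. h g = x}"
  shows "openin T {g \<in> A. k (f g) (h g) = z}"
  using openin_fibre_comp[of T A "\<lambda>g. (f g, h g)" "\<lambda>(x, y). k x y"] openin_fibre_Pair[OF assms]
  by simp

text \<open>For finite \<open>J\<close> the fibre is a finite intersection of open sets; over a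
  value that is not extensional on \<open>J\<close> it is empty.\<close>

lemma openin_fibre_restrict:
  assumes fin: "finite J" and A: "openin T A" and "\<And>j x. j \<in> J \<Longrightarrow> openin T {g \<in> A. f g j = x}"
  shows "openin T {g \<in> A. (\<lambda>j\<in>J. f g j) = v}"
proof (cases "v \<in> extensional J")
  case True
  then have "{g \<in> A. (\<lambda>j\<in>J. f g j) = v} = A \<inter> (\<Inter>j\<in>J. {g \<in> A. f g j = v j})"
    by (auto simp: fun_eq_iff extensional_def)
  moreover have "openin T (A \<inter> (\<Inter>j\<in>J. {g \<in> A. f g j = v j}))"
    using fin assms(3)
    by (induction J rule: finite_induct) (auto simp: A Int_left_commute[of A] intro: openin_Int)
  ultimately show ?thesis by simp
next
  case False
  then have "{g \<in> A. (\<lambda>j\<in>J. f g j) = v} = {}" by auto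
  then show ?thesis by (metis openin_empty)
qed

lemma discrete_hom_compose:
  assumes f: "f \<in> discrete_hom G T P" and k: "k \<in> hom P Q"
  shows "(\<lambda>g. k (f g)) \<in> discrete_hom G T Q"
proof (rule discrete_homI)
  show "openin T {g \<in> carrier G. k (f g) = x}" for x
    by (rule openin_fibre_comp) (rule discrete_homD(4)[OF f])
qed (use discrete_homD(2,3)[OF f] k in \<open>auto simp: hom_def Pi_def\<close>)

lemma discrete_hom_continuous_compose:
  assumes f: "f \<in> discrete_hom H S P" and k: "k \<in> hom G H" and c: "continuous_map T S k"
    and "topspace T = carrier G"
  shows "(\<lambda>g. f (k g)) \<in> discrete_hom G T P"
proof (rule discrete_homI)
  fix x
  have "{g \<in> carrier G. f (k g) = x} = {g \<in> topspace T. k g \<in> {h \<in> carrier H. f h = x}}"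
    using k assms(4) by (auto simp: hom_def)
  then show "openin T {g \<in> carrier G. f (k g) = x}"
    using c discrete_homD(4)[OF f] by (simp only: openin_continuous_map_preimage)
qed (use discrete_homD(2,3)[OF f] k in \<open>auto simp: hom_def Pi_def\<close>)

lemma discrete_hom_one:
  assumes "group G" "group P" "f \<in> discrete_hom G T P"
  shows "f \<one>\<^bsub>G\<^esub> = \<one>\<^bsub>P\<^esub>"
  using assms discrete_homD(1) hom_one by blast

section \<open>Finite \<open>p\<close>-groups\<close>

definition finite_p_group :: "nat \<Rightarrow> ('a, 'b) monoid_scheme \<Rightarrow> bool" where
  "finite_p_group p P \<longleftrightarrow> group P \<and> (\<exists>k. card (carrier P) = p ^ k)"

text \<open>Unitriangular 3 x 3 matrices mod \<open>p\<close>, with \<open>a\<close> and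
  \<open>b\<close> above the diagonal and \<open>c\<close> in the corner. The term
  \<open>a * b'\<close> is the factor set of this central extension of C_p x C_p by C_p.\<close>

definition heisenberg :: "nat \<Rightarrow> (int \<times> int \<times> int) monoid" where
  "heisenberg p =
     \<lparr>carrier = {0..<int p} \<times> {0..<int p} \<times> {0..<int p},
      monoid.mult = (\<lambda>(a, b, c) (a', b', c').
        ((a + a') mod int p, (b + b') mod int p, (c + c' + a * b') mod int p)),
      one = (0, 0, 0)\<rparr>"

lemma heisenberg_simps [simp]:
  "carrier (heisenberg p) = {0..<int p} \<times> {0..<int p} \<times> {0..<int p}"
  "(a, b, c) \<otimes>\<^bsub>heisenberg p\<^esub> (a', b', c') =
     ((a + a') mod int p, (b + b') mod int p, (c + c' + a * b') mod int p)"
  "\<one>\<^bsub>heisenberg p\<^esub> = (0, 0, 0)"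
  by (auto simp: heisenberg_def)

lemma mult_heisenberg:
  "x \<otimes>\<^bsub>heisenberg p\<^esub> y =
     ((fst x + fst y) mod int p, (fst (snd x) + fst (snd y)) mod int p,
      (snd (snd x) + snd (snd y) + fst x * fst (snd y)) mod int p)"
  by (cases x; cases y) simp

lemma group_heisenberg:
  assumes "0 < p"
  shows "group (heisenberg p)"
proof (rule groupI)
  fix x y z
  assume "x \<in> carrier (heisenberg p)" "y \<in> carrier (heisenberg p)" "z \<in> carrier (heisenberg p)"
  show "x \<otimes>\<^bsub>heisenberg p\<^esub> y \<otimes>\<^bsub>heisenberg p\<^esub> z = x \<otimes>\<^bsub>heisenberg p\<^esub> (y \<otimes>\<^bsub>heisenberg p\<^esub> z)"
  proof -
    have l: "(a mod int p + b + (c mod int p) * d) mod int p = (a + b + c * d) mod int p" for a b c d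
      by (intro mod_add_cong mod_mult_cong) simp_all
    have r: "(a + b mod int p + c * (d mod int p)) mod int p = (a + b + c * d) mod int p" for a b c d
      by (intro mod_add_cong mod_mult_cong) simp_all
    show ?thesis
      by (simp add: mult_heisenberg l r mod_simps) (simp add: ring_distribs add_ac)
  qed
next
  fix x
  assume x: "x \<in> carrier (heisenberg p)"
  obtain a b c where abc: "x = (a, b, c)" by (cases x)
  \<comment> \<open>The inverse matrix: the corner of the product is (a * b - c) + c + (- a) * b =
    0.\<close>
  have "((- a) mod int p, (- b) mod int p, (a * b - c) mod int p) \<otimes>\<^bsub>heisenberg p\<^esub> x = \<one>\<^bsub>heisenberg p\<^esub>"
    using x mod_add_cong[of "(a * b - c) mod int p + c" "int p" "a * b" "(- a mod int p) * b" "- a * b"]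
      mod_mult_left_eq[of "- a" "int p" b]
    by (simp add: abc mod_simps)
  then show "\<exists>y\<in>carrier (heisenberg p). y \<otimes>\<^bsub>heisenberg p\<^esub> x = \<one>\<^bsub>heisenberg p\<^esub>"
    by (rule bexI) (use assms in simp)
qed (use assms in \<open>auto simp: mult_heisenberg\<close>)

lemma finite_p_group_heisenberg:
  assumes "0 < p"
  shows "finite_p_group p (heisenberg p)"
proof -
  have "card (carrier (heisenberg p)) = p ^ 3"
    by (simp add: card_cartesian_product power3_eq_cube)
  then show ?thesis
    using group_heisenberg[OF assms] unfolding finite_p_group_def by blast
qed

lemma finite_p_group_integer_mod:
  assumes "0 < p"
  shows "finite_p_group p (integer_mod_group p)"
proof -
  have "card (carrier (integer_mod_group p)) = p ^ 1"
    using assms by (simp add: carrier_integer_mod_group)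
  then show ?thesis
    using group_integer_mod_group unfolding finite_p_group_def by blast
qed

section \<open>Wreath products with the cyclic group of order p\<close>

text \<open>An element \<open>a\<close> of the cyclic part acts on the base group by reading
  coordinate \<open>j + a\<close>. This is how right translation permutes the right cosets of the
  kernel of a map onto C_p when they are numbered by its values. Functions in the base group are
  extensional, so the carrier is finite if that of \<open>P\<close> is.\<close>

definition wreath :: "nat \<Rightarrow> ('c, 'd) monoid_scheme \<Rightarrow> (int \<times> (int \<Rightarrow> 'c)) monoid" where
  "wreath p P =
     \<lparr>carrier = {0..<int p} \<times> (\<Pi>\<^sub>E j\<in>{0..<int p}. carrier P),
      monoid.mult = (\<lambda>(a, v) (b, w).
        ((a + b) mod int p, \<lambda>j\<in>{0..<int p}. v j \<otimes>\<^bsub>P\<^esub> w ((j + a) mod int p))),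
      one = (0, \<lambda>j\<in>{0..<int p}. \<one>\<^bsub>P\<^esub>)\<rparr>"

lemma wreath_simps [simp]:
  "carrier (wreath p P) = {0..<int p} \<times> (\<Pi>\<^sub>E j\<in>{0..<int p}. carrier P)"
  "x \<otimes>\<^bsub>wreath p P\<^esub> y =
     ((fst x + fst y) mod int p,
      \<lambda>j\<in>{0..<int p}. snd x j \<otimes>\<^bsub>P\<^esub> snd y ((j + fst x) mod int p))"
  "\<one>\<^bsub>wreath p P\<^esub> = (0, \<lambda>j\<in>{0..<int p}. \<one>\<^bsub>P\<^esub>)"
  by (auto simp: wreath_def split: prod.split)

lemma group_wreath:
  assumes p: "0 < p" and P: "group P"
  shows "group (wreath p P)"
proof -
  interpret group P by fact
  have cl: "snd x (j mod int p) \<in> carrier P" if "x \<in> carrier (wreath p P)" for x :: "int \<times> (int \<Rightarrow> 'a)" and j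
    using that p by (auto simp: PiE_iff)
  have cl': "snd x j \<in> carrier P"
    if "x \<in> carrier (wreath p P)" "0 \<le> j" "j < int p" for x :: "int \<times> (int \<Rightarrow> 'a)" and j
    using that by (auto simp: PiE_iff)
  have ext: "snd x j = undefined"
    if "x \<in> carrier (wreath p P)" "\<not> (0 \<le> j \<and> j < int p)" for x :: "int \<times> (int \<Rightarrow> 'a)" and j
    using that by (auto simp: PiE_iff extensional_def)
  show ?thesis
  proof (rule groupI)
    fix x y z
    assume xyz: "x \<in> carrier (wreath p P)" "y \<in> carrier (wreath p P)" "z \<in> carrier (wreath p P)"
    have "snd x j \<otimes>\<^bsub>P\<^esub> snd y ((j + fst x) mod int p) \<otimes>\<^bsub>P\<^esub> snd z ((j + (fst x + fst y) mod int p) mod int p) =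
        snd x j \<otimes>\<^bsub>P\<^esub> (snd y ((j + fst x) mod int p) \<otimes>\<^bsub>P\<^esub> snd z (((j + fst x) mod int p + fst y) mod int p))"
      if "0 \<le> j" "j < int p" for j
      using m_assoc[OF cl'[OF xyz(1) that] cl[OF xyz(2)] cl[OF xyz(3)]]
      by (simp add: mod_simps add.assoc)
    then show "x \<otimes>\<^bsub>wreath p P\<^esub> y \<otimes>\<^bsub>wreath p P\<^esub> z = x \<otimes>\<^bsub>wreath p P\<^esub> (y \<otimes>\<^bsub>wreath p P\<^esub> z)"
      using p by (simp add: fun_eq_iff mod_add_left_eq mod_add_right_eq add.assoc)
  next
    fix x y
    assume xy: "x \<in> carrier (wreath p P)" "y \<in> carrier (wreath p P)"
    show "x \<otimes>\<^bsub>wreath p P\<^esub> y \<in> carrier (wreath p P)"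
      using p cl'[OF xy(1)] cl[OF xy(2)] by simp
  next
    show "\<one>\<^bsub>wreath p P\<^esub> \<in> carrier (wreath p P)" using p by simp
  next
    fix x
    assume x: "x \<in> carrier (wreath p P)"
    then have f: "fst x mod int p = fst x" by auto
    have "\<one>\<^bsub>P\<^esub> \<otimes>\<^bsub>P\<^esub> snd x j = snd x j" if "0 \<le> j" "j < int p" for j
      using cl'[OF x that] by simp
    then show "\<one>\<^bsub>wreath p P\<^esub> \<otimes>\<^bsub>wreath p P\<^esub> x = x"
      using ext[OF x] by (intro prod_eqI) (auto simp: fun_eq_iff f)
  next
    fix x
    assume x: "x \<in> carrier (wreath p P)"
    \<comment> \<open>In \<open>?y\<close> times \<open>x\<close> the coordinate \<open>j\<close> of
      \<open>?y\<close> meets the coordinate \<open>j - fst x\<close> of \<open>x\<close>, which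
      dictates the shifted inverse.\<close>
    let ?y = "((- fst x) mod int p, \<lambda>j\<in>{0..<int p}. inv\<^bsub>P\<^esub> snd x ((j - fst x) mod int p))"
    have "inv\<^bsub>P\<^esub> snd x ((j - fst x) mod int p) \<otimes>\<^bsub>P\<^esub> snd x ((j + (- fst x) mod int p) mod int p) = \<one>\<^bsub>P\<^esub>" for j
      using l_inv[OF cl[OF x]] by (simp add: mod_simps)
    then have "?y \<otimes>\<^bsub>wreath p P\<^esub> x = \<one>\<^bsub>wreath p P\<^esub>"
      by (simp add: fun_eq_iff mod_add_left_eq)
    moreover have "?y \<in> carrier (wreath p P)"
      using p cl[OF x] by simp
    ultimately show "\<exists>y\<in>carrier (wreath p P). y \<otimes>\<^bsub>wreath p P\<^esub> x = \<one>\<^bsub>wreath p P\<^esub>" by blast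
  qed
qed

lemma finite_p_group_wreath:
  assumes "0 < p" "finite_p_group p P"
  shows "finite_p_group p (wreath p P)"
proof -
  obtain k where k: "card (carrier P) = p ^ k"
    using assms(2) by (auto simp: finite_p_group_def)
  have "card (carrier (wreath p P)) = p * (p ^ k) ^ p"
    by (simp add: card_cartesian_product card_PiE k)
  then have "card (carrier (wreath p P)) = p ^ (1 + k * p)"
    by (simp add: power_mult)
  then show ?thesis
    using group_wreath assms unfolding finite_p_group_def by blast
qed

lemma wreath_map_hom:
  assumes "f \<in> hom P Q"
  shows "(\<lambda>x. (fst x, \<lambda>j\<in>{0..<int p}. f (snd x j))) \<in> hom (wreath p P) (wreath p Q)"
  using assms by (auto simp: hom_def PiE_def Pi_def intro!: restrict_ext)

lemma wreath_fst_hom: "fst \<in> hom (wreath p P) (integer_mod_group p)"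
  by (auto simp: hom_def carrier_integer_mod_group)

lemma bij_betw_add_mod:
  assumes "0 < p"
  shows "bij_betw (\<lambda>j. (j + a) mod int p) {0..<int p} {0..<int p}"
  by (rule bij_betw_byWitness[where f' = "\<lambda>j. (j - a) mod int p"]) (use assms in \<open>auto simp: mod_simps\<close>)

lemma sum_add_mod:
  assumes "0 < p"
  shows "(\<Sum>j\<in>{0..<int p}. f ((j + a) mod int p)) = (\<Sum>j\<in>{0..<int p}. f j)"
  using sum.reindex_bij_betw[OF bij_betw_add_mod[OF assms], of f] .

text \<open>The translation by \<open>fst x\<close> permutes the coordinates of the second factor
  and so disappears in the sum. On the side of the induced module this map is the trace.\<close>

lemma wreath_sum_hom:
  assumes p: "0 < p"
  shows "(\<lambda>x. (\<Sum>j\<in>{0..<int p}. snd x j) mod int p) \<in> hom (wreath p (integer_mod_group p)) (integer_mod_group p)"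
proof (rule homI)
  fix x y :: "int \<times> (int \<Rightarrow> int)"
  have "(\<Sum>j\<in>{0..<int p}. (snd x j + snd y ((j + fst x) mod int p)) mod int p) mod int p =
      (\<Sum>j\<in>{0..<int p}. snd x j + snd y ((j + fst x) mod int p)) mod int p"
    by (rule mod_sum_eq)
  then show "(\<Sum>j\<in>{0..<int p}. snd (x \<otimes>\<^bsub>wreath p (integer_mod_group p)\<^esub> y) j) mod int p =
      ((\<Sum>j\<in>{0..<int p}. snd x j) mod int p) \<otimes>\<^bsub>integer_mod_group p\<^esub> ((\<Sum>j\<in>{0..<int p}. snd y j) mod int p)"
    by (simp add: sum.distrib sum_add_mod[OF p] mod_simps)
qed (use p in \<open>simp add: carrier_integer_mod_group\<close>)

text \<open>The multiplication rule for \<open>F\<close> is that of a 1-cocycle with values in the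
  base group, on which \<open>G\<close> acts through \<open>\<kappa>\<close>. Such a cocycle is the
  second component of a homomorphism over \<open>\<kappa>\<close>.\<close>

lemma discrete_hom_wreathI:
  assumes p: "0 < p" and T: "openin T (carrier G)"
    and \<kappa>: "\<kappa> \<in> discrete_hom G T (integer_mod_group p)"
    and cl: "\<And>g j. g \<in> carrier G \<Longrightarrow> j \<in> {0..<int p} \<Longrightarrow> F g j \<in> carrier P"
    and mu: "\<And>g h j. g \<in> carrier G \<Longrightarrow> h \<in> carrier G \<Longrightarrow> j \<in> {0..<int p} \<Longrightarrow>
      F (g \<otimes>\<^bsub>G\<^esub> h) j = F g j \<otimes>\<^bsub>P\<^esub> F h ((j + \<kappa> g) mod int p)"
    and op: "\<And>j x. j \<in> {0..<int p} \<Longrightarrow> openin T {g \<in> carrier G. F g j = x}"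
  shows "(\<lambda>g. (\<kappa> g, \<lambda>j\<in>{0..<int p}. F g j)) \<in> discrete_hom G T (wreath p P)"
proof (rule discrete_homI)
  fix g h assume "g \<in> carrier G" "h \<in> carrier G"
  then show "(\<kappa> (g \<otimes>\<^bsub>G\<^esub> h), \<lambda>j\<in>{0..<int p}. F (g \<otimes>\<^bsub>G\<^esub> h) j) =
    (\<kappa> g, \<lambda>j\<in>{0..<int p}. F g j) \<otimes>\<^bsub>wreath p P\<^esub> (\<kappa> h, \<lambda>j\<in>{0..<int p}. F h j)"
    using p by (auto simp: mu discrete_homD(3)[OF \<kappa>] intro!: restrict_ext)
next
  fix x
  show "openin T {g \<in> carrier G. (\<kappa> g, \<lambda>j\<in>{0..<int p}. F g j) = x}"
    by (intro openin_fibre_Pair openin_fibre_restrict discrete_homD(4)[OF \<kappa>] op T) auto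
qed (use cl p discrete_homD(2)[OF \<kappa>] in \<open>auto simp: carrier_integer_mod_group\<close>)

section \<open>Sections and induction from a kernel\<close>

lemma topological_group_translation:
  assumes "topological_group G T" "a \<in> carrier G" "b \<in> carrier G"
  shows "continuous_map T T (\<lambda>g. a \<otimes>\<^bsub>G\<^esub> g \<otimes>\<^bsub>G\<^esub> b)"
proof -
  have ts: "topspace T = carrier G" and
    m: "continuous_map (prod_topology T T) T (\<lambda>(x, y). x \<otimes>\<^bsub>G\<^esub> y)"
    using assms by (auto simp: topological_group_def)
  have 1: "continuous_map T T (\<lambda>g. a \<otimes>\<^bsub>G\<^esub> g)"
    using continuous_map_compose[OF _ m, of T "\<lambda>g. (a, g)"] assms ts
    by (simp add: o_def continuous_map_paired)
  show ?thesis
    using continuous_map_compose[OF _ m, of T "\<lambda>g. (a \<otimes>\<^bsub>G\<^esub> g, b)"] assms ts 1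
    by (simp add: o_def continuous_map_paired)
qed

definition zero_fibre :: "('a, 'b) monoid_scheme \<Rightarrow> ('a \<Rightarrow> int) \<Rightarrow> 'a set" where
  "zero_fibre G \<kappa> = {g \<in> carrier G. \<kappa> g = 0}"

text \<open>Its existence stands for surjectivity of \<open>\<kappa>\<close>. No normalisation is
  imposed: \<open>s 0\<close> is some element of the kernel, not necessarily the identity.\<close>

definition section_of :: "nat \<Rightarrow> ('a, 'b) monoid_scheme \<Rightarrow> ('a \<Rightarrow> int) \<Rightarrow> (int \<Rightarrow> 'a) \<Rightarrow> bool" where
  "section_of p G \<kappa> s \<longleftrightarrow> (\<forall>j\<in>{0..<int p}. s j \<in> carrier G \<and> \<kappa> (s j) = j)"

text \<open>The values of \<open>\<kappa>\<close> add up to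
  \<open>j + \<kappa> g - (j + \<kappa> g)\<close>. With \<open>s = s'\<close> these are the
  Schreier elements of the kernel, which satisfy the cocycle rule of the wreath product.\<close>

lemma section_shift_in_zero_fibre:
  assumes p: "0 < p" and G: "group G" and \<kappa>: "\<kappa> \<in> hom G (integer_mod_group p)"
    and s: "section_of p G \<kappa> s" and s': "section_of p G \<kappa> s'"
    and g: "g \<in> carrier G" and j: "j \<in> {0..<int p}"
  shows "s j \<otimes>\<^bsub>G\<^esub> g \<otimes>\<^bsub>G\<^esub> inv\<^bsub>G\<^esub> s' ((j + \<kappa> g) mod int p) \<in> zero_fibre G \<kappa>"
proof -
  interpret \<kappa>: group_hom G "integer_mod_group p" \<kappa>
    using G \<kappa> group_integer_mod_group by (simp add: group_hom_def group_hom_axioms_def)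
  have k: "(j + \<kappa> g) mod int p \<in> {0..<int p}" using p by simp
  have mem: "s j \<in> carrier G" "s' ((j + \<kappa> g) mod int p) \<in> carrier G"
    and val: "\<kappa> (s j) = j" "\<kappa> (s' ((j + \<kappa> g) mod int p)) = (j + \<kappa> g) mod int p"
    using s s' j k unfolding section_of_def by blast+
  show ?thesis
    using mem g p by (simp add: zero_fibre_def val mod_simps carrier_integer_mod_group)
qed

text \<open>The first form inserts \<open>inv b \<otimes> b\<close> and yields the cocycle rule of
  the Schreier elements; the second inserts \<open>b \<otimes> inv b\<close> and lets the
  conjugating coordinates cancel.\<close>

lemma (in group) telescope:
  assumes "a \<in> carrier G" "b \<in> carrier G" "c \<in> carrier G" "x \<in> carrier G" "y \<in> carrier G"
  shows "a \<otimes> (x \<otimes> y) \<otimes> inv c = (a \<otimes> x \<otimes> inv b) \<otimes> (b \<otimes> y \<otimes> inv c)"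
    and "inv a \<otimes> (x \<otimes> y) \<otimes> c = (inv a \<otimes> x \<otimes> b) \<otimes> (inv b \<otimes> y \<otimes> c)"
proof -
  have c: "inv b \<otimes> (b \<otimes> z) = z" "b \<otimes> (inv b \<otimes> z) = z" if "z \<in> carrier G" for z
    using assms that by (simp_all flip: m_assoc)
  show "a \<otimes> (x \<otimes> y) \<otimes> inv c = (a \<otimes> x \<otimes> inv b) \<otimes> (b \<otimes> y \<otimes> inv c)"
    and "inv a \<otimes> (x \<otimes> y) \<otimes> c = (inv a \<otimes> x \<otimes> b) \<otimes> (inv b \<otimes> y \<otimes> c)"
    using assms by (simp_all add: m_assoc c)
qed

text \<open>Induction along \<open>\<kappa>\<close>, conjugated by the element of the base group with coordinates \<open>y j\<close>.\<close>

lemma twisted_induction: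
  fixes G (structure)
  assumes p: "0 < p" and G: "topological_group G T" and P: "group P"
    and \<kappa>: "\<kappa> \<in> discrete_hom G T (integer_mod_group p)" and s: "section_of p G \<kappa> s"
    and l: "l \<in> discrete_hom (G\<lparr>carrier := zero_fibre G \<kappa>\<rparr>) (subtopology T (zero_fibre G \<kappa>)) P"
    and y: "\<And>j. j \<in> {0..<int p} \<Longrightarrow> y j \<in> carrier P"
  shows "(\<lambda>g. (\<kappa> g, \<lambda>j\<in>{0..<int p}. inv\<^bsub>P\<^esub> (y j) \<otimes>\<^bsub>P\<^esub>
      l (s j \<otimes> g \<otimes> inv (s ((j + \<kappa> g) mod int p))) \<otimes>\<^bsub>P\<^esub> y ((j + \<kappa> g) mod int p)))
    \<in> discrete_hom G T (wreath p P)"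
    (is "(\<lambda>g. (\<kappa> g, \<lambda>j\<in>_. ?F g j)) \<in> _")
proof (rule discrete_hom_wreathI[OF p _ \<kappa>])
  interpret G: group G using G by (simp add: topological_group_def)
  interpret P: group P by fact
  have ts: "topspace T = carrier G" using G by (simp add: topological_group_def)
  show "openin T (carrier G)" using ts openin_topspace by metis
  let ?U = "zero_fibre G \<kappa>"
  have Usub: "?U \<subseteq> carrier G" by (auto simp: zero_fibre_def)
  have sU: "s j \<otimes> g \<otimes> inv (s ((j + \<kappa> g) mod int p)) \<in> ?U" if "g \<in> carrier G" "j \<in> {0..<int p}" for g j
    using section_shift_in_zero_fibre[OF p G.is_group discrete_homD(1)[OF \<kappa>] s s that] .
  have sc: "s j \<in> carrier G" if "j \<in> {0..<int p}" for j
    using s that by (auto simp: section_of_def)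
  have lP: "l u \<in> carrier P" if "u \<in> ?U" for u
    using discrete_homD(2)[OF l] that by simp
  have lm: "l (u \<otimes> v) = l u \<otimes>\<^bsub>P\<^esub> l v" if "u \<in> ?U" "v \<in> ?U" for u v
    using discrete_homD(3)[OF l] that by simp
  have mp: "x mod int p \<in> {0..<int p}" for x using p by simp
  show "?F g j \<in> carrier P" if "g \<in> carrier G" "j \<in> {0..<int p}" for g j
    using lP[OF sU[OF that]] y[OF that(2)] y[OF mp] by simp
  show "?F (g \<otimes> h) j = ?F g j \<otimes>\<^bsub>P\<^esub> ?F h ((j + \<kappa> g) mod int p)"
    if g: "g \<in> carrier G" and h: "h \<in> carrier G" and j: "j \<in> {0..<int p}" for g h j
  proof -
    let ?k = "(j + \<kappa> g) mod int p" let ?m = "(?k + \<kappa> h) mod int p"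
    have m: "(j + \<kappa> (g \<otimes> h)) mod int p = ?m"
      using discrete_homD(3)[OF \<kappa> g h] by (simp add: mod_simps add.assoc)
    \<comment> \<open>The representative \<open>s ?k\<close> of the intermediate coset splits the
      Schreier element of the product into two elements of the kernel, where \<open>l\<close> is
      multiplicative.\<close>
    have "s j \<otimes> (g \<otimes> h) \<otimes> inv (s ?m) = (s j \<otimes> g \<otimes> inv (s ?k)) \<otimes> (s ?k \<otimes> h \<otimes> inv (s ?m))"
      by (intro G.telescope(1) sc j mp g h)
    then have "l (s j \<otimes> (g \<otimes> h) \<otimes> inv (s ?m)) =
        l (s j \<otimes> g \<otimes> inv (s ?k)) \<otimes>\<^bsub>P\<^esub> l (s ?k \<otimes> h \<otimes> inv (s ?m))"
      using lm[OF sU[OF g j] sU[OF h mp]] by simp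
    then show ?thesis
      unfolding m by (simp only:) (intro P.telescope(2) y lP sU j mp g h)
  qed
  show "openin T {g \<in> carrier G. ?F g j = x}" if j: "j \<in> {0..<int p}" for j x
  proof -
    have opU: "openin T ?U" using discrete_homD(4)[OF \<kappa>] by (simp add: zero_fibre_def)
    \<comment> \<open>The translating element \<open>s ((j + \<kappa> g) mod int p)\<close> varies
      with \<open>g\<close>, but only through \<open>\<kappa> g\<close>. On each open fibre of
      \<open>\<kappa>\<close> it is constant, and there \<open>?F\<close> is \<open>l\<close> after
      a fixed translation.\<close>
    have "openin T {g \<in> carrier G. ?F g j = x \<and> \<kappa> g = a}" for a
    proof (cases "a \<in> {0..<int p}")
      case True
      let ?k = "(j + a) mod int p"
      let ?q = "\<lambda>u. inv\<^bsub>P\<^esub> (y j) \<otimes>\<^bsub>P\<^esub> l u \<otimes>\<^bsub>P\<^esub> y ?k"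
      have c: "continuous_map T T (\<lambda>g. s j \<otimes> g \<otimes> inv (s ?k))"
        using topological_group_translation[OF G] sc[OF j] sc[OF mp] by simp
      have "openin (subtopology T ?U) {u \<in> ?U. ?q u = x}"
        using openin_fibre_comp[of "subtopology T ?U" ?U l "\<lambda>z. inv\<^bsub>P\<^esub> (y j) \<otimes>\<^bsub>P\<^esub> z \<otimes>\<^bsub>P\<^esub> y ?k"]
          discrete_homD(4)[OF l] by simp
      then have "openin T {u \<in> ?U. ?q u = x}"
        using openin_trans_full[OF _ opU] by simp
      then have "openin T ({g \<in> topspace T. s j \<otimes> g \<otimes> inv (s ?k) \<in> {u \<in> ?U. ?q u = x}} \<inter>
          {g \<in> carrier G. \<kappa> g = a})"
        by (intro openin_Int openin_continuous_map_preimage[OF c] discrete_homD(4)[OF \<kappa>])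
      moreover have "{g \<in> topspace T. s j \<otimes> g \<otimes> inv (s ?k) \<in> {u \<in> ?U. ?q u = x}} \<inter>
          {g \<in> carrier G. \<kappa> g = a} = {g \<in> carrier G. ?F g j = x \<and> \<kappa> g = a}"
        using sU[OF _ j] ts by auto
      ultimately show ?thesis by simp
    next
      case False
      then have "{g \<in> carrier G. ?F g j = x \<and> \<kappa> g = a} = {}"
        using discrete_homD(2)[OF \<kappa>] p unfolding carrier_integer_mod_group by auto
      then show ?thesis by (metis (lifting) openin_empty)
    qed
    then have "openin T (\<Union>a. {g \<in> carrier G. ?F g j = x \<and> \<kappa> g = a})"
      by (intro openin_Union) auto
    moreover have "(\<Union>a. {g \<in> carrier G. ?F g j = x \<and> \<kappa> g = a}) = {g \<in> carrier G. ?F g j = x}" by auto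
    ultimately show ?thesis by simp
  qed
qed

section \<open>Free products\<close>

lemma free_word_eq_words:
  assumes G: "\<And>i. i \<in> I \<Longrightarrow> group (G i)" and "free_word_eq I G v w"
  shows "v \<in> free_words I G" "w \<in> free_words I G"
  using assms(2)
proof (induction rule: free_word_eq.induct)
  case (one i u v)
  { case 1 with one G show ?case by (auto simp: free_words_def group.is_monoid)
  next case 2 with one show ?case by (auto simp: free_words_def) }
next
  case (mult i g h u v)
  { case 1 with mult show ?case by (auto simp: free_words_def)
  next case 2 with mult G show ?case by (auto simp: free_words_def intro: monoid.m_closed group.is_monoid) }
qed auto

lemma free_word_eq_append_left:
  assumes "free_word_eq I G v w" "u \<in> free_words I G"
  shows "free_word_eq I G (u @ v) (u @ w)"
  using assms
proof (induction rule: free_word_eq.induct)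
  case (refl w)
  then show ?case by (intro free_word_eq.refl) (auto simp: free_words_def)
next
  case (one i u' v)
  then show ?case
    using free_word_eq.one[of i I "u @ u'" G v] by (auto simp: free_words_def)
next
  case (mult i g h u' v)
  then show ?case
    using free_word_eq.mult[of i I g G h "u @ u'" v] by (auto simp: free_words_def)
qed (blast intro: free_word_eq.sym free_word_eq.trans)+

lemma free_word_eq_append_right:
  assumes "free_word_eq I G v w" "u \<in> free_words I G"
  shows "free_word_eq I G (v @ u) (w @ u)"
  using assms
proof (induction rule: free_word_eq.induct)
  case (refl w)
  then show ?case by (intro free_word_eq.refl) (auto simp: free_words_def)
next
  case (one i u' v)
  then show ?case
    using free_word_eq.one[of i I u' G "v @ u"] by (auto simp: free_words_def)
next
  case (mult i g h u' v)
  then show ?case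
    using free_word_eq.mult[of i I g G h u' "v @ u"] by (auto simp: free_words_def)
qed (blast intro: free_word_eq.sym free_word_eq.trans)+

lemma free_word_class_eq_iff:
  assumes "v \<in> free_words I G"
  shows "free_word_class I G v = free_word_class I G w \<longleftrightarrow> free_word_eq I G v w"
proof
  assume "free_word_class I G v = free_word_class I G w"
  then have "v \<in> free_word_class I G w"
    using assms free_word_eq.refl by (auto simp: free_word_class_def)
  then show "free_word_eq I G v w" by (auto simp: free_word_class_def intro: free_word_eq.sym)
next
  assume "free_word_eq I G v w"
  then show "free_word_class I G v = free_word_class I G w"
    unfolding free_word_class_def by (blast intro: free_word_eq.sym free_word_eq.trans)
qed

text \<open>Word equivalence is a congruence for concatenation on both sides, so all products of
  representatives lie in one class and the union in the definition collapses to it.\<close>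

lemma free_product_mult:
  assumes G: "\<And>i. i \<in> I \<Longrightarrow> group (G i)" and v: "v \<in> free_words I G" and w: "w \<in> free_words I G"
  shows "free_word_class I G v \<otimes>\<^bsub>free_product I G\<^esub> free_word_class I G w = free_word_class I G (v @ w)"
proof -
  have "free_word_class I G (v' @ w') = free_word_class I G (v @ w)"
    if v': "v' \<in> free_word_class I G v" and w': "w' \<in> free_word_class I G w" for v' w'
  proof -
    have e: "free_word_eq I G v v'" "free_word_eq I G w w'"
      using v' w' by (auto simp: free_word_class_def)
    have "free_word_eq I G (v @ w) (v @ w')"
      using e(2) v by (rule free_word_eq_append_left)
    moreover have "free_word_eq I G (v @ w') (v' @ w')"
      using e(1) free_word_eq_words(2)[OF G e(2)] by (rule free_word_eq_append_right)
    ultimately have "free_word_eq I G (v @ w) (v' @ w')" by (rule free_word_eq.trans)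
    then show ?thesis
      unfolding free_word_class_def by (blast intro: free_word_eq.sym free_word_eq.trans)
  qed
  moreover have mem: "v \<in> free_word_class I G v" "w \<in> free_word_class I G w"
    using v w by (auto simp: free_word_class_def intro: free_word_eq.refl)
  ultimately have "(\<Union>v'\<in>free_word_class I G v. \<Union>w'\<in>free_word_class I G w. free_word_class I G (v' @ w')) =
      (\<Union>v'\<in>free_word_class I G v. \<Union>w'\<in>free_word_class I G w. free_word_class I G (v @ w))"
    by (intro SUP_cong HOL.refl)
  also have "\<dots> = free_word_class I G (v @ w)" using mem by auto
  finally show ?thesis unfolding free_product_def by simp
qed

lemma carrier_free_product: "carrier (free_product I G) = free_word_class I G ` free_words I G"
  by (simp add: free_product_def)

lemma one_free_product: "\<one>\<^bsub>free_product I G\<^esub> = free_word_class I G []"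
  by (simp add: free_product_def)

lemma Nil_free_words: "[] \<in> free_words I G"
  by (simp add: free_words_def)

lemma free_product_incl_closed:
  assumes "i \<in> I" "g \<in> carrier (G i)"
  shows "free_product_incl I G i g \<in> carrier (free_product I G)"
  using assms by (auto simp: free_product_incl_def carrier_free_product free_words_def)

lemma free_product_Cons:
  assumes G: "\<And>i. i \<in> I \<Longrightarrow> group (G i)" and "i \<in> I" "g \<in> carrier (G i)" "w \<in> free_words I G"
  shows "free_word_class I G ((i, g) # w) =
    free_product_incl I G i g \<otimes>\<^bsub>free_product I G\<^esub> free_word_class I G w"
proof -
  have "[(i, g)] \<in> free_words I G" using assms by (simp add: free_words_def)
  then show ?thesis
    using free_product_mult[OF G _ assms(4)] by (simp add: free_product_incl_def)
qed

lemma free_product_incl_one: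
  assumes "i \<in> I"
  shows "free_product_incl I G i \<one>\<^bsub>G i\<^esub> = \<one>\<^bsub>free_product I G\<^esub>"
proof -
  have "free_word_eq I G [(i, \<one>\<^bsub>G i\<^esub>)] []"
    using free_word_eq.one[OF assms Nil_free_words Nil_free_words] by simp
  then show ?thesis
    unfolding free_product_incl_def one_free_product
    by (metis free_word_class_eq_iff Nil_free_words free_word_eq.sym)
qed

lemma free_product_incl_hom:
  assumes G: "\<And>i. i \<in> I \<Longrightarrow> group (G i)" and i: "i \<in> I"
  shows "free_product_incl I G i \<in> hom (G i) (free_product I G)"
proof (rule homI)
  fix g h assume gh: "g \<in> carrier (G i)" "h \<in> carrier (G i)"
  have w: "[(i, g)] \<in> free_words I G" "[(i, h)] \<in> free_words I G" "[(i, g), (i, h)] \<in> free_words I G"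
    using gh i by (auto simp: free_words_def)
  have "free_word_eq I G [(i, g), (i, h)] [(i, g \<otimes>\<^bsub>G i\<^esub> h)]"
    using free_word_eq.mult[of i I g G h "[]" "[]"] i gh by (simp add: Nil_free_words)
  then show "free_product_incl I G i (g \<otimes>\<^bsub>G i\<^esub> h) =
      free_product_incl I G i g \<otimes>\<^bsub>free_product I G\<^esub> free_product_incl I G i h"
    using free_product_mult[OF G w(1,2)] free_word_class_eq_iff[OF w(3), THEN iffD2]
    by (simp add: free_product_incl_def)
qed (rule free_product_incl_closed[OF i])

lemma group_free_product:
  assumes G: "\<And>i. i \<in> I \<Longrightarrow> group (G i)"
  shows "group (free_product I G)"
proof (rule groupI)
  let ?F = "free_product I G"
  show one: "\<one>\<^bsub>?F\<^esub> \<in> carrier ?F"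
    by (simp add: one_free_product carrier_free_product Nil_free_words)
  show mult: "A \<otimes>\<^bsub>?F\<^esub> B \<in> carrier ?F" if AB: "A \<in> carrier ?F" "B \<in> carrier ?F" for A B
  proof -
    obtain v w where "v \<in> free_words I G" "w \<in> free_words I G"
      "A = free_word_class I G v" "B = free_word_class I G w"
      using AB unfolding carrier_free_product by blast
    then show ?thesis
      by (auto simp: free_product_mult[OF G] carrier_free_product free_words_def)
  qed
  show assoc: "A \<otimes>\<^bsub>?F\<^esub> B \<otimes>\<^bsub>?F\<^esub> C = A \<otimes>\<^bsub>?F\<^esub> (B \<otimes>\<^bsub>?F\<^esub> C)"
    if ABC: "A \<in> carrier ?F" "B \<in> carrier ?F" "C \<in> carrier ?F" for A B C
  proof -
    obtain u v w where uvw: "u \<in> free_words I G" "v \<in> free_words I G" "w \<in> free_words I G"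
      "A = free_word_class I G u" "B = free_word_class I G v" "C = free_word_class I G w"
      using ABC unfolding carrier_free_product by blast
    then have "u @ v \<in> free_words I G" "v @ w \<in> free_words I G" by (auto simp: free_words_def)
    with uvw show ?thesis by (simp add: free_product_mult[OF G])
  qed
  show one_left: "\<one>\<^bsub>?F\<^esub> \<otimes>\<^bsub>?F\<^esub> A = A" if "A \<in> carrier ?F" for A
    using that by (auto simp: carrier_free_product one_free_product free_product_mult[OF G] Nil_free_words)
  have "\<exists>B\<in>carrier ?F. B \<otimes>\<^bsub>?F\<^esub> free_word_class I G w = \<one>\<^bsub>?F\<^esub>" if "w \<in> free_words I G" for w
    using that
  proof (induction w)
    case Nil
    then show ?case using one one_left by (auto simp: one_free_product)
  next
    case (Cons x w)
    obtain i g where x: "x = (i, g)" by (cases x)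
    have ig: "i \<in> I" "g \<in> carrier (G i)" "w \<in> free_words I G"
      using Cons.prems x by (auto simp: free_words_def)
    interpret Gi: group "G i" using G ig by blast
    obtain B where B: "B \<in> carrier ?F" "B \<otimes>\<^bsub>?F\<^esub> free_word_class I G w = \<one>\<^bsub>?F\<^esub>"
      using Cons.IH ig by blast
    let ?a = "free_product_incl I G i"
    have c: "?a g \<in> carrier ?F" "?a (inv\<^bsub>G i\<^esub> g) \<in> carrier ?F" "free_word_class I G w \<in> carrier ?F"
      using ig free_product_incl_closed[OF ig(1), of _ G] by (auto simp: carrier_free_product)
    have "?a (inv\<^bsub>G i\<^esub> g) \<otimes>\<^bsub>?F\<^esub> ?a g = ?a (inv\<^bsub>G i\<^esub> g \<otimes>\<^bsub>G i\<^esub> g)"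
      by (subst hom_mult[OF free_product_incl_hom[of I G i]]) (use G ig in auto)
    then have inv: "?a (inv\<^bsub>G i\<^esub> g) \<otimes>\<^bsub>?F\<^esub> ?a g = \<one>\<^bsub>?F\<^esub>"
      using ig by (simp add: free_product_incl_one)
    \<comment> \<open>If \<open>B\<close> is a left inverse of the tail, then \<open>B\<close> times
      the inverse of the first letter is a left inverse of the whole word.\<close>
    have "(B \<otimes>\<^bsub>?F\<^esub> ?a (inv\<^bsub>G i\<^esub> g)) \<otimes>\<^bsub>?F\<^esub> (?a g \<otimes>\<^bsub>?F\<^esub> free_word_class I G w) =
        B \<otimes>\<^bsub>?F\<^esub> ((?a (inv\<^bsub>G i\<^esub> g) \<otimes>\<^bsub>?F\<^esub> ?a g) \<otimes>\<^bsub>?F\<^esub> free_word_class I G w)"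
      using B c by (simp add: assoc mult)
    also have "\<dots> = \<one>\<^bsub>?F\<^esub>" using B c by (simp add: inv one_left)
    finally show ?case
      using free_product_Cons[OF G ig] x mult[OF B(1) c(2)] by auto
  qed
  then show "\<exists>B\<in>carrier ?F. B \<otimes>\<^bsub>?F\<^esub> A = \<one>\<^bsub>?F\<^esub>" if "A \<in> carrier ?F" for A
    using that by (auto simp: carrier_free_product)
qed

lemma free_product_hom_unique:
  assumes G: "\<And>i. i \<in> I \<Longrightarrow> group (G i)" and P: "group P"
    and h: "h \<in> hom (free_product I G) P" and k: "k \<in> hom (free_product I G) P"
    and eq: "\<And>i g. i \<in> I \<Longrightarrow> g \<in> carrier (G i) \<Longrightarrow>
      h (free_product_incl I G i g) = k (free_product_incl I G i g)"
    and A: "A \<in> carrier (free_product I G)"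
  shows "h A = k A"
proof -
  have "h (free_word_class I G w) = k (free_word_class I G w)" if "w \<in> free_words I G" for w
    using that
  proof (induction w)
    case Nil
    then show ?case
      using hom_one[OF h group_free_product[OF G] P] hom_one[OF k group_free_product[OF G] P]
      by (simp add: one_free_product)
  next
    case (Cons x w)
    obtain i g where x: "x = (i, g)" by (cases x)
    have ig: "i \<in> I" "g \<in> carrier (G i)" "w \<in> free_words I G"
      using Cons.prems x by (auto simp: free_words_def)
    then have "free_product_incl I G i g \<in> carrier (free_product I G)"
      "free_word_class I G w \<in> carrier (free_product I G)"
      using free_product_incl_closed[of i I g G] by (auto simp: carrier_free_product)
    then show ?case
      using Cons.IH ig eq h k by (simp add: x free_product_Cons[OF G ig] hom_def)
  qed
  then show ?thesis using A by (auto simp: carrier_free_product)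
qed

fun eval_word :: "('c, 'd) monoid_scheme \<Rightarrow> ('i \<Rightarrow> 'a \<Rightarrow> 'c) \<Rightarrow> ('i \<times> 'a) list \<Rightarrow> 'c" where
  "eval_word P f [] = \<one>\<^bsub>P\<^esub>"
| "eval_word P f (x # w) = f (fst x) (snd x) \<otimes>\<^bsub>P\<^esub> eval_word P f w"

text \<open>Evaluating a word letter by letter in \<open>P\<close> respects both generating
  relations, since every \<open>f i\<close> preserves units and products. Hence evaluation descends
  to classes.\<close>

lemma free_product_lift:
  assumes G: "\<And>i. i \<in> I \<Longrightarrow> group (G i)" and P: "group P"
    and f: "\<And>i. i \<in> I \<Longrightarrow> f i \<in> hom (G i) P"
  shows "\<exists>h\<in>hom (free_product I G) P. \<forall>i\<in>I. \<forall>g\<in>carrier (G i). h (free_product_incl I G i g) = f i g"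
proof -
  interpret P: group P by fact
  have fc: "f i g \<in> carrier P" if "i \<in> I" "g \<in> carrier (G i)" for i g
    using f that by (auto simp: hom_def)
  have fm: "f i (g \<otimes>\<^bsub>G i\<^esub> h) = f i g \<otimes>\<^bsub>P\<^esub> f i h"
    if "i \<in> I" "g \<in> carrier (G i)" "h \<in> carrier (G i)" for i g h
    using f that by (auto simp: hom_def)
  have f1: "f i \<one>\<^bsub>G i\<^esub> = \<one>\<^bsub>P\<^esub>" if "i \<in> I" for i
    using f G P that hom_one by blast
  have ec: "eval_word P f w \<in> carrier P" if "w \<in> free_words I G" for w
    using that by (induction w) (auto simp: free_words_def fc)
  have ea: "eval_word P f (v @ w) = eval_word P f v \<otimes>\<^bsub>P\<^esub> eval_word P f w"
    if "v \<in> free_words I G" "w \<in> free_words I G" for v w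
    using that(1)
  proof (induction v)
    case Nil
    then show ?case using ec[OF that(2)] by simp
  next
    case (Cons x v)
    then have "v \<in> free_words I G" "f (fst x) (snd x) \<in> carrier P"
      by (auto simp: free_words_def fc)
    then show ?case using Cons.IH ec that(2) by (simp add: P.m_assoc)
  qed
  have ew: "eval_word P f v = eval_word P f w" if "free_word_eq I G v w" for v w
    using that
  proof (induction rule: free_word_eq.induct)
    case (one i u v)
    have "[(i, \<one>\<^bsub>G i\<^esub>)] @ v \<in> free_words I G"
      using one G by (auto simp: free_words_def group.is_monoid)
    then show ?case using one ec f1 by (simp add: ea)
  next
    case (mult i g h u v)
    have "[(i, g), (i, h)] @ v \<in> free_words I G" "[(i, g \<otimes>\<^bsub>G i\<^esub> h)] @ v \<in> free_words I G"
      using mult G by (auto simp: free_words_def intro: monoid.m_closed group.is_monoid)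
    then show ?case using mult ec fc fm by (simp add: ea P.m_assoc)
  qed auto
  \<comment> \<open>Any representative may be chosen, because evaluation is constant on equivalence
    classes by \<open>ew\<close>.\<close>
  define h where "h A = eval_word P f (SOME w. w \<in> A)" for A
  have hw: "h (free_word_class I G w) = eval_word P f w" if "w \<in> free_words I G" for w
  proof -
    have "w \<in> free_word_class I G w" using that by (simp add: free_word_class_def free_word_eq.refl)
    then have "(SOME v. v \<in> free_word_class I G w) \<in> free_word_class I G w" by (rule someI)
    then show ?thesis using ew unfolding h_def free_word_class_def by (metis mem_Collect_eq)
  qed
  show ?thesis
  proof (intro bexI ballI)
    show "h \<in> hom (free_product I G) P"
    proof (rule homI)
      fix A B assume AB: "A \<in> carrier (free_product I G)" "B \<in> carrier (free_product I G)"
      then obtain v w where vw: "v \<in> free_words I G" "w \<in> free_words I G"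
        "A = free_word_class I G v" "B = free_word_class I G w"
        unfolding carrier_free_product by blast
      then have "v @ w \<in> free_words I G" by (auto simp: free_words_def)
      then show "h (A \<otimes>\<^bsub>free_product I G\<^esub> B) = h A \<otimes>\<^bsub>P\<^esub> h B"
        using vw by (simp add: free_product_mult[OF G] hw ea)
    qed (auto simp: carrier_free_product hw ec)
  next
    show "h (free_product_incl I G i g) = f i g" if "i \<in> I" "g \<in> carrier (G i)" for i g
      using that fc by (simp add: free_product_incl_def hw free_words_def)
  qed
qed

section \<open>Free pro-\<open>p\<close> products\<close>

lemma (in group) r_coset_eq_iff:
  assumes "subgroup N G" "a \<in> carrier G" "b \<in> carrier G"
  shows "N #> a = N #> b \<longleftrightarrow> a \<otimes> inv b \<in> N"
proof -
  have "a \<in> N #> b \<longleftrightarrow> a \<otimes> inv b \<in> N"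
    using subgroup.rcos_module[OF assms(1) is_group assms(3,2)] .
  then show ?thesis
    using repr_independence[OF _ assms(3,1), of a] rcos_self[OF assms(2,1)]
    by auto
qed

text \<open>Computes the transition maps of the inverse system on representatives; it rests on
  \<open>M <#> N = M\<close>.\<close>

lemma (in group) set_mult_r_coset_subset:
  assumes N: "subgroup N G" and M: "subgroup M G" and "N \<subseteq> M" "a \<in> carrier G"
  shows "M <#> (N #> a) = M #> a"
proof -
  have "M <#> N = M"
  proof
    show "M <#> N \<subseteq> M"
      using assms(3) subgroup.m_closed[OF M] by (auto simp: set_mult_def)
    have "m = m \<otimes> \<one>" if "m \<in> M" for m
      using that subgroup.mem_carrier[OF M] by simp
    then show "M \<subseteq> M <#> N"
      using subgroup.one_closed[OF N] by (fastforce simp: set_mult_def)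
  qed
  then show ?thesis
    using setmult_rcos_assoc[OF subgroup.subset[OF M] subgroup.subset[OF N] assms(4)] by simp
qed

text \<open>The index is the order of the image, which divides the order of \<open>P\<close> by
  Lagrange's theorem; a divisor of a prime power is again a power of the prime.\<close>

lemma rcosets_kernel_p_power:
  assumes p: "prime p" and F: "group F" and P: "finite_p_group p P" and h: "h \<in> hom F P"
  shows "\<exists>k. card (rcosets\<^bsub>F\<^esub> (kernel F P h)) = p ^ k"
proof -
  obtain k where k: "card (carrier P) = p ^ k" and gP: "group P"
    using P by (auto simp: finite_p_group_def)
  interpret h: group_hom F P h
    using F gP h by (simp add: group_hom_def group_hom_axioms_def)
  let ?Q = "F Mod kernel F P h" and ?\<phi> = "\<lambda>X. the_elem (h ` X)"
  interpret \<phi>: group_hom ?Q P ?\<phi>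
    using h.FactGroup_hom normal.factorgroup_is_group[OF h.normal_kernel] gP
    by (simp add: group_hom_def group_hom_axioms_def)
  have "card (carrier ?Q) = card (?\<phi> ` carrier ?Q)"
    using h.FactGroup_inj_on by (simp add: card_image)
  moreover have "card (?\<phi> ` carrier ?Q) dvd card (carrier P)"
    using group.lagrange[OF gP \<phi>.subgroup_img_is_subgroup[OF \<phi>.subgroup_self]]
    by (metis dvd_triv_right order_def)
  ultimately have "card (rcosets\<^bsub>F\<^esub> (kernel F P h)) dvd p ^ k"
    by (simp add: k FactGroup_def)
  then show ?thesis using divides_primepow_nat[OF p] by blast
qed

section \<open>The system of subgroups that defines the completion\<close>

locale free_pro_p =
  fixes p :: nat and I :: "'i set" and G :: "'i \<Rightarrow> ('a, 'b) monoid_scheme" and T :: "'i \<Rightarrow> 'a topology"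
  assumes prime_p: "prime p"
    and top_group: "\<And>i. i \<in> I \<Longrightarrow> topological_group (G i) (T i)"
begin

abbreviation F where "F \<equiv> free_product I G"
abbreviation incl where "incl \<equiv> free_product_incl I G"
abbreviation \<N> where "\<N> \<equiv> free_pro_p_subgroups p I G T"
abbreviation H where "H \<equiv> free_pro_p_product p I G T"
abbreviation S where "S \<equiv> free_pro_p_topology p I G T"

definition completion :: "('i \<times> 'a) list set \<Rightarrow> (('i \<times> 'a) list set set \<Rightarrow> ('i \<times> 'a) list set set)" where
  "completion a = (\<lambda>N\<in>\<N>. N #>\<^bsub>F\<^esub> a)"

definition \<iota> :: "'i \<Rightarrow> 'a \<Rightarrow> (('i \<times> 'a) list set set \<Rightarrow> ('i \<times> 'a) list set set)" where
  "\<iota> i g = completion (incl i g)"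

lemma p_pos: "0 < p"
  using prime_p prime_gt_0_nat by blast

lemma group_G: "i \<in> I \<Longrightarrow> group (G i)"
  using top_group by (simp add: topological_group_def)

lemma topspace_T: "i \<in> I \<Longrightarrow> topspace (T i) = carrier (G i)"
  using top_group by (simp add: topological_group_def)

sublocale F: group F
  using group_free_product group_G by blast

lemma incl_closed: "i \<in> I \<Longrightarrow> g \<in> carrier (G i) \<Longrightarrow> incl i g \<in> carrier F"
  using free_product_incl_closed .

lemma incl_mult: "i \<in> I \<Longrightarrow> g \<in> carrier (G i) \<Longrightarrow> h \<in> carrier (G i) \<Longrightarrow>
    incl i (g \<otimes>\<^bsub>G i\<^esub> h) = incl i g \<otimes>\<^bsub>F\<^esub> incl i h"
  using hom_mult[OF free_product_incl_hom[of I G i]] group_G by blast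

lemma group_hom_incl: "i \<in> I \<Longrightarrow> group_hom (G i) F (incl i)"
  using free_product_incl_hom[of I G i] group_G F.is_group
  by (simp add: group_hom_def group_hom_axioms_def)

lemma normal_\<N>: "N \<in> \<N> \<Longrightarrow> N \<lhd> F"
  by (simp add: free_pro_p_subgroups_def)

lemma subgroup_\<N>: "N \<in> \<N> \<Longrightarrow> subgroup N F"
  using normal_\<N> normal_imp_subgroup by blast

lemma group_Mod: "N \<in> \<N> \<Longrightarrow> group (F Mod N)"
  using normal_\<N> normal.factorgroup_is_group by blast

lemma finite_p_group_Mod: "N \<in> \<N> \<Longrightarrow> finite_p_group p (F Mod N)"
  using group_Mod unfolding finite_p_group_def free_pro_p_subgroups_def by (auto simp: FactGroup_def)

text \<open>The source of all members of the system that are constructed here. The preimage of the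
  kernel in \<open>G i\<close> is the kernel of the composite with \<open>incl i\<close>, so each
  condition on \<open>N\<close> becomes one on \<open>h\<close>.\<close>

lemma kernel_in_\<N>:
  assumes P: "finite_p_group p P" and h: "h \<in> hom F P"
    and op: "\<And>i. i \<in> I \<Longrightarrow> openin (T i) {g \<in> carrier (G i). h (incl i g) = \<one>\<^bsub>P\<^esub>}"
    and fin: "finite {i \<in> I. \<exists>g\<in>carrier (G i). h (incl i g) \<noteq> \<one>\<^bsub>P\<^esub>}"
  shows "kernel F P h \<in> \<N>"
proof -
  have "group P" using P by (simp add: finite_p_group_def)
  then interpret h: group_hom F P h
    using h by (simp add: group_hom_def group_hom_axioms_def F.is_group)
  have "{g \<in> carrier (G i). incl i g \<in> kernel F P h} = {g \<in> carrier (G i). h (incl i g) = \<one>\<^bsub>P\<^esub>}"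
    if "i \<in> I" for i using that incl_closed by (auto simp: kernel_def)
  moreover have "{i \<in> I. \<not> incl i ` carrier (G i) \<subseteq> kernel F P h} =
      {i \<in> I. \<exists>g\<in>carrier (G i). h (incl i g) \<noteq> \<one>\<^bsub>P\<^esub>}"
    using incl_closed by (auto simp: kernel_def)
  ultimately show ?thesis
    using op fin rcosets_kernel_p_power[OF prime_p F.is_group P h] h.normal_kernel
    by (simp add: free_pro_p_subgroups_def)
qed

text \<open>The kernel of the zero map to C_p. It is the lower bound of the empty family in
  \<open>completion_dense\<close>.\<close>

lemma carrier_in_\<N>: "carrier F \<in> \<N>"
proof -
  let ?P = "integer_mod_group p"
  have "kernel F ?P (\<lambda>_. 0) \<in> \<N>"
  proof (rule kernel_in_\<N>)
    show "(\<lambda>_. 0) \<in> hom F ?P" by (auto simp: hom_def)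
    show "openin (T i) {g \<in> carrier (G i). 0 = \<one>\<^bsub>?P\<^esub>}" if "i \<in> I" for i
      using topspace_T[OF that] openin_topspace[of "T i"] by simp
  qed (use finite_p_group_integer_mod[OF p_pos] in auto)
  then show ?thesis by (simp add: kernel_def)
qed

text \<open>The intersection is the kernel of the diagonal map into the product of the two
  quotients, again a finite p-group. This makes the system directed.\<close>

lemma Int_in_\<N>:
  assumes N: "N \<in> \<N>" and M: "M \<in> \<N>"
  shows "N \<inter> M \<in> \<N>"
proof -
  let ?P = "(F Mod N) \<times>\<times> (F Mod M)" and ?h = "\<lambda>a. (N #>\<^bsub>F\<^esub> a, M #>\<^bsub>F\<^esub> a)"
  interpret N: normal N F using normal_\<N>[OF N] .
  interpret M: normal M F using normal_\<N>[OF M] .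
  obtain k l where "card (carrier (F Mod N)) = p ^ k" "card (carrier (F Mod M)) = p ^ l"
    using finite_p_group_Mod[OF N] finite_p_group_Mod[OF M] by (auto simp: finite_p_group_def)
  then have "card (carrier ?P) = p ^ (k + l)"
    by (simp add: DirProd_def card_cartesian_product power_add)
  then have P: "finite_p_group p ?P"
    unfolding finite_p_group_def using DirProd_group group_Mod N M by blast
  have h: "?h \<in> hom F ?P"
    using N.r_coset_hom_Mod M.r_coset_hom_Mod by (auto simp: hom_def DirProd_def)
  have NN: "N #>\<^bsub>F\<^esub> a = N \<longleftrightarrow> a \<in> N" "M #>\<^bsub>F\<^esub> a = M \<longleftrightarrow> a \<in> M" if "a \<in> carrier F" for a
    using that F.coset_join1 F.coset_join2 N.is_subgroup M.is_subgroup N.subset M.subset by metis+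
  have ker: "kernel F ?P ?h = N \<inter> M"
    using NN N.subset by (auto simp: kernel_def DirProd_def FactGroup_def)
  have one: "?h (incl i g) = \<one>\<^bsub>?P\<^esub> \<longleftrightarrow> incl i g \<in> N \<and> incl i g \<in> M"
    if "i \<in> I" "g \<in> carrier (G i)" for i g
    using NN[OF incl_closed[OF that]] by (simp add: DirProd_def FactGroup_def)
  have "kernel F ?P ?h \<in> \<N>"
  proof (rule kernel_in_\<N>[OF P h])
    fix i assume i: "i \<in> I"
    have "{g \<in> carrier (G i). ?h (incl i g) = \<one>\<^bsub>?P\<^esub>} =
        {g \<in> carrier (G i). incl i g \<in> N} \<inter> {g \<in> carrier (G i). incl i g \<in> M}"
      using one[OF i] by blast
    then show "openin (T i) {g \<in> carrier (G i). ?h (incl i g) = \<one>\<^bsub>?P\<^esub>}"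
      using N M i by (auto simp: free_pro_p_subgroups_def)
  next
    have "{i \<in> I. \<exists>g\<in>carrier (G i). ?h (incl i g) \<noteq> \<one>\<^bsub>?P\<^esub>} \<subseteq>
        {i \<in> I. \<not> incl i ` carrier (G i) \<subseteq> N} \<union> {i \<in> I. \<not> incl i ` carrier (G i) \<subseteq> M}"
      using one by blast
    then show "finite {i \<in> I. \<exists>g\<in>carrier (G i). ?h (incl i g) \<noteq> \<one>\<^bsub>?P\<^esub>}"
      using N M by (auto simp: free_pro_p_subgroups_def elim!: finite_subset)
  qed
  then show ?thesis using ker by simp
qed

section \<open>The inverse limit as a topological group\<close>

lemma carrier_H:
  "carrier H = {x \<in> (\<Pi>\<^sub>E N\<in>\<N>. carrier (F Mod N)). \<forall>N\<in>\<N>. \<forall>M\<in>\<N>. N \<subseteq> M \<longrightarrow> M <#>\<^bsub>F\<^esub> x N = x M}"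
  by (simp add: free_pro_p_product_def Let_def)

lemma H_eq: "H = (product_group \<N> (\<lambda>N. F Mod N))\<lparr>carrier := carrier H\<rparr>"
  by (simp add: free_pro_p_product_def Let_def)

lemma mult_H: "x \<otimes>\<^bsub>H\<^esub> y = (\<lambda>N\<in>\<N>. x N <#>\<^bsub>F\<^esub> y N)"
  by (subst H_eq) simp

lemma one_H: "\<one>\<^bsub>H\<^esub> = (\<lambda>N\<in>\<N>. N)"
  by (subst H_eq) simp

lemma H_component:
  assumes "x \<in> carrier H" "N \<in> \<N>"
  obtains a where "a \<in> carrier F" "x N = N #>\<^bsub>F\<^esub> a"
  using assms by (auto simp: carrier_H PiE_iff carrier_FactGroup)

lemma H_component_mono:
  assumes "x \<in> carrier H" "N \<in> \<N>" "M \<in> \<N>" "N \<subseteq> M" "a \<in> carrier F" "x N = N #>\<^bsub>F\<^esub> a"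
  shows "x M = M #>\<^bsub>F\<^esub> a"
  using assms F.set_mult_r_coset_subset[OF subgroup_\<N>[OF assms(2)] subgroup_\<N>[OF assms(3)] assms(4,5)]
  by (auto simp: carrier_H)

lemma H_memI:
  assumes "\<And>N. N \<in> \<N> \<Longrightarrow> a N \<in> carrier F"
    and "\<And>N M. N \<in> \<N> \<Longrightarrow> M \<in> \<N> \<Longrightarrow> N \<subseteq> M \<Longrightarrow> M #>\<^bsub>F\<^esub> a N = M #>\<^bsub>F\<^esub> a M"
  shows "(\<lambda>N\<in>\<N>. N #>\<^bsub>F\<^esub> a N) \<in> carrier H"
proof -
  have "M <#>\<^bsub>F\<^esub> (N #>\<^bsub>F\<^esub> a N) = M #>\<^bsub>F\<^esub> a M" if "N \<in> \<N>" "M \<in> \<N>" "N \<subseteq> M" for N M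
    using F.set_mult_r_coset_subset[OF subgroup_\<N>[OF that(1)] subgroup_\<N>[OF that(2)] that(3) assms(1)[OF that(1)]]
      assms(2)[OF that] by simp
  then show ?thesis
    using assms(1) by (simp add: carrier_H carrier_FactGroup)
qed

text \<open>Representatives chosen for all \<open>N\<close> at once and compatible modulo larger
  subgroups. Together with \<open>H_memI\<close> they reduce closure of the limit under products and
  inverses to coset arithmetic in \<open>F\<close>.\<close>

lemma H_rep:
  assumes "x \<in> carrier H"
  shows "\<exists>a. (\<forall>N\<in>\<N>. a N \<in> carrier F) \<and> x = (\<lambda>N\<in>\<N>. N #>\<^bsub>F\<^esub> a N) \<and>
    (\<forall>N M. N \<in> \<N> \<longrightarrow> M \<in> \<N> \<longrightarrow> N \<subseteq> M \<longrightarrow> M #>\<^bsub>F\<^esub> a N = M #>\<^bsub>F\<^esub> a M)"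
proof -
  have "\<forall>N\<in>\<N>. \<exists>a. a \<in> carrier F \<and> x N = N #>\<^bsub>F\<^esub> a"
    using H_component[OF assms] by metis
  then obtain a where a: "\<And>N. N \<in> \<N> \<Longrightarrow> a N \<in> carrier F" "\<And>N. N \<in> \<N> \<Longrightarrow> x N = N #>\<^bsub>F\<^esub> a N"
    by metis
  moreover have "x \<in> extensional \<N>" using assms by (auto simp: carrier_H PiE_def)
  then have "x = (\<lambda>N\<in>\<N>. N #>\<^bsub>F\<^esub> a N)"
    using a by (auto simp: extensional_def fun_eq_iff)
  moreover have "M #>\<^bsub>F\<^esub> a N = M #>\<^bsub>F\<^esub> a M" if "N \<in> \<N>" "M \<in> \<N>" "N \<subseteq> M" for N M
    using H_component_mono[OF assms that a(1,2)] that a(2) by simp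
  ultimately show ?thesis by blast
qed

lemma subgroup_H: "subgroup (carrier H) (product_group \<N> (\<lambda>N. F Mod N))"
proof (rule group.subgroupI)
  let ?P = "product_group \<N> (\<lambda>N. F Mod N)"
  have rc: "(N #>\<^bsub>F\<^esub> a) <#>\<^bsub>F\<^esub> (N #>\<^bsub>F\<^esub> b) = N #>\<^bsub>F\<^esub> (a \<otimes>\<^bsub>F\<^esub> b)"
    if "N \<in> \<N>" "a \<in> carrier F" "b \<in> carrier F" for N a b
    using normal.rcos_sum[OF normal_\<N>] that by blast
  have ri: "inv\<^bsub>F Mod N\<^esub> (N #>\<^bsub>F\<^esub> a) = N #>\<^bsub>F\<^esub> inv\<^bsub>F\<^esub> a" if "N \<in> \<N>" "a \<in> carrier F" for N a
    using that normal.inv_FactGroup[OF normal_\<N>] normal.rcos_inv[OF normal_\<N>]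
    by (auto simp: carrier_FactGroup)
  show "group ?P" by (simp add: group_Mod)
  show "carrier H \<subseteq> carrier ?P" by (auto simp: carrier_H)
  show "carrier H \<noteq> {}" using H_memI[of "\<lambda>_. \<one>\<^bsub>F\<^esub>"] by auto
  show "x \<otimes>\<^bsub>?P\<^esub> y \<in> carrier H" if x: "x \<in> carrier H" and y: "y \<in> carrier H" for x y
  proof -
    obtain a where a: "\<And>N. N \<in> \<N> \<Longrightarrow> a N \<in> carrier F" "x = (\<lambda>N\<in>\<N>. N #>\<^bsub>F\<^esub> a N)"
      "\<And>N M. N \<in> \<N> \<Longrightarrow> M \<in> \<N> \<Longrightarrow> N \<subseteq> M \<Longrightarrow> M #>\<^bsub>F\<^esub> a N = M #>\<^bsub>F\<^esub> a M"
      using H_rep[OF x] by blast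
    obtain b where b: "\<And>N. N \<in> \<N> \<Longrightarrow> b N \<in> carrier F" "y = (\<lambda>N\<in>\<N>. N #>\<^bsub>F\<^esub> b N)"
      "\<And>N M. N \<in> \<N> \<Longrightarrow> M \<in> \<N> \<Longrightarrow> N \<subseteq> M \<Longrightarrow> M #>\<^bsub>F\<^esub> b N = M #>\<^bsub>F\<^esub> b M"
      using H_rep[OF y] by blast
    have "x \<otimes>\<^bsub>?P\<^esub> y = (\<lambda>N\<in>\<N>. N #>\<^bsub>F\<^esub> (a N \<otimes>\<^bsub>F\<^esub> b N))"
      using a(1) b(1) by (auto simp: a(2) b(2) rc intro!: restrict_ext)
    moreover have "\<dots> \<in> carrier H"
    proof (rule H_memI)
      show "M #>\<^bsub>F\<^esub> (a N \<otimes>\<^bsub>F\<^esub> b N) = M #>\<^bsub>F\<^esub> (a M \<otimes>\<^bsub>F\<^esub> b M)" if "N \<in> \<N>" "M \<in> \<N>" "N \<subseteq> M" for N M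
        using rc[OF that(2) a(1)[OF that(1)] b(1)[OF that(1)]] rc[OF that(2) a(1)[OF that(2)] b(1)[OF that(2)]]
          a(3)[OF that] b(3)[OF that] by simp
    qed (use a(1) b(1) in simp)
    ultimately show ?thesis by simp
  qed
  show "inv\<^bsub>?P\<^esub> x \<in> carrier H" if x: "x \<in> carrier H" for x
  proof -
    obtain a where a: "\<And>N. N \<in> \<N> \<Longrightarrow> a N \<in> carrier F" "x = (\<lambda>N\<in>\<N>. N #>\<^bsub>F\<^esub> a N)"
      "\<And>N M. N \<in> \<N> \<Longrightarrow> M \<in> \<N> \<Longrightarrow> N \<subseteq> M \<Longrightarrow> M #>\<^bsub>F\<^esub> a N = M #>\<^bsub>F\<^esub> a M"
      using H_rep[OF x] by blast
    have "x \<in> (\<Pi>\<^sub>E N\<in>\<N>. carrier (F Mod N))" using x by (simp add: carrier_H)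
    then have "inv\<^bsub>?P\<^esub> x = (\<lambda>N\<in>\<N>. inv\<^bsub>F Mod N\<^esub> x N)" by (simp add: group_Mod)
    also have "\<dots> = (\<lambda>N\<in>\<N>. N #>\<^bsub>F\<^esub> inv\<^bsub>F\<^esub> (a N))"
      using a(1) by (auto simp: a(2) ri intro!: restrict_ext)
    also have "\<dots> \<in> carrier H"
    proof (rule H_memI)
      show "M #>\<^bsub>F\<^esub> inv\<^bsub>F\<^esub> (a N) = M #>\<^bsub>F\<^esub> inv\<^bsub>F\<^esub> (a M)" if "N \<in> \<N>" "M \<in> \<N>" "N \<subseteq> M" for N M
        using ri[OF that(2) a(1)[OF that(1)]] ri[OF that(2) a(1)[OF that(2)]] a(3)[OF that] by simp
    qed (use a(1) in simp)
    finally show ?thesis .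
  qed
qed

lemma group_P: "group (product_group \<N> (\<lambda>N. F Mod N))"
  by (simp add: group_Mod)

sublocale H: group H
  using subgroup.subgroup_is_group[OF subgroup_H group_P] H_eq by simp

lemma inv_H: "x \<in> carrier H \<Longrightarrow> inv\<^bsub>H\<^esub> x = (\<lambda>N\<in>\<N>. inv\<^bsub>F Mod N\<^esub> x N)"
proof -
  assume x: "x \<in> carrier H"
  have "inv\<^bsub>H\<^esub> x = inv\<^bsub>product_group \<N> (\<lambda>N. F Mod N)\<^esub> x"
    by (subst H_eq) (rule group.m_inv_consistent[OF group_P subgroup_H x])
  then show ?thesis using x by (simp add: group_Mod carrier_H)
qed

lemma topspace_S: "topspace S = carrier H"
  by (auto simp: free_pro_p_topology_def carrier_H)

lemma continuous_map_component:
  "N \<in> \<N> \<Longrightarrow> continuous_map S (discrete_topology (carrier (F Mod N))) (\<lambda>x. x N)"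
  unfolding free_pro_p_topology_def
  by (intro continuous_map_from_subtopology continuous_map_product_projection)

lemma continuous_map_into_S:
  assumes "\<And>N. N \<in> \<N> \<Longrightarrow> continuous_map X (discrete_topology (carrier (F Mod N))) (\<lambda>x. f x N)"
    and "f ` topspace X \<subseteq> carrier H"
  shows "continuous_map X S f"
  unfolding free_pro_p_topology_def continuous_map_in_subtopology continuous_map_componentwise
  using assms by (auto simp: carrier_H PiE_def)

lemma topological_group_H: "topological_group H S"
  unfolding topological_group_def
proof (intro conjI)
  show "continuous_map (prod_topology S S) S (\<lambda>(x, y). x \<otimes>\<^bsub>H\<^esub> y)"
  proof (rule continuous_map_into_S)
    fix N assume N: "N \<in> \<N>"
    let ?D = "discrete_topology (carrier (F Mod N))"
    have "continuous_map (prod_topology S S) (prod_topology ?D ?D) (\<lambda>z. (fst z N, snd z N))"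
      using continuous_map_compose[OF continuous_map_fst[of S S] continuous_map_component[OF N]]
        continuous_map_compose[OF continuous_map_snd[of S S] continuous_map_component[OF N]]
      by (simp add: continuous_map_paired o_def)
    moreover have "continuous_map (prod_topology ?D ?D) ?D (\<lambda>z. fst z <#>\<^bsub>F\<^esub> snd z)"
      using group.is_monoid[OF group_Mod[OF N]] monoid.m_closed[of "F Mod N"]
      by (auto simp: simp flip: prod_topology_discrete_topology)
    ultimately show "continuous_map (prod_topology S S) ?D (\<lambda>x. (case x of (x, y) \<Rightarrow> x \<otimes>\<^bsub>H\<^esub> y) N)"
      using continuous_map_compose[of "prod_topology S S" "prod_topology ?D ?D" "\<lambda>z. (fst z N, snd z N)" ?D "\<lambda>z. fst z <#>\<^bsub>F\<^esub> snd z"] N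
      by (simp add: o_def mult_H case_prod_beta)
  qed (auto simp: topspace_S)
  show "continuous_map S S (\<lambda>x. inv\<^bsub>H\<^esub> x)"
  proof (rule continuous_map_into_S)
    fix N assume N: "N \<in> \<N>"
    let ?D = "discrete_topology (carrier (F Mod N))"
    have "continuous_map ?D ?D (\<lambda>z. inv\<^bsub>F Mod N\<^esub> z)"
      using group.inv_closed[OF group_Mod[OF N]] by auto
    then have "continuous_map S ?D (\<lambda>x. inv\<^bsub>F Mod N\<^esub> x N)"
      using continuous_map_compose[OF continuous_map_component[OF N], of ?D "\<lambda>z. inv\<^bsub>F Mod N\<^esub> z"]
      by (simp add: o_def)
    then show "continuous_map S ?D (\<lambda>x. (inv\<^bsub>H\<^esub> x) N)"
      by (rule continuous_map_eq) (simp add: topspace_S inv_H N)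
  qed (auto simp: topspace_S)
qed (simp_all add: H.is_group topspace_S)

lemma completion_closed: "a \<in> carrier F \<Longrightarrow> completion a \<in> carrier H"
  unfolding completion_def by (rule H_memI) auto

lemma completion_hom: "completion \<in> hom F H"
  using completion_closed normal.rcos_sum[OF normal_\<N>]
  by (auto simp: hom_def mult_H completion_def intro!: restrict_ext)

lemma \<iota>_hom: "i \<in> I \<Longrightarrow> \<iota> i \<in> hom (G i) H"
  using completion_hom incl_closed incl_mult by (auto simp: hom_def \<iota>_def Pi_def)

text \<open>A fibre of the component at \<open>N\<close> is empty or a translate of the preimage of
  \<open>N\<close> in \<open>G i\<close>, which is open by the definition of the system.\<close>

lemma \<iota>_continuous:
  assumes i: "i \<in> I"
  shows "continuous_map (T i) S (\<iota> i)"
proof (rule continuous_map_into_S)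
  interpret incl: group_hom "G i" F "incl i" using group_hom_incl[OF i] .
  fix N assume N: "N \<in> \<N>"
  have "continuous_map (T i) (discrete_topology (carrier (F Mod N))) (\<lambda>g. N #>\<^bsub>F\<^esub> incl i g)"
    unfolding continuous_map_def
  proof (intro conjI allI impI)
    show "(\<lambda>g. N #>\<^bsub>F\<^esub> incl i g) \<in> topspace (T i) \<rightarrow> topspace (discrete_topology (carrier (F Mod N)))"
      using i by (auto simp: topspace_T carrier_FactGroup)
    fix U
    have "openin (T i) {g \<in> carrier (G i). N #>\<^bsub>F\<^esub> incl i g = c}" for c
    proof (cases "\<exists>h\<in>carrier (G i). N #>\<^bsub>F\<^esub> incl i h = c")
      case True
      then obtain h where h: "h \<in> carrier (G i)" "c = N #>\<^bsub>F\<^esub> incl i h" by auto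
      let ?W = "{g \<in> carrier (G i). incl i g \<in> N}"
      have W: "openin (T i) ?W" using N i by (auto simp: free_pro_p_subgroups_def)
      have "continuous_map (T i) (T i) (\<lambda>g. \<one>\<^bsub>G i\<^esub> \<otimes>\<^bsub>G i\<^esub> g \<otimes>\<^bsub>G i\<^esub> inv\<^bsub>G i\<^esub> h)"
        using h by (intro topological_group_translation top_group i) auto
      then have "openin (T i) {g \<in> topspace (T i). \<one>\<^bsub>G i\<^esub> \<otimes>\<^bsub>G i\<^esub> g \<otimes>\<^bsub>G i\<^esub> inv\<^bsub>G i\<^esub> h \<in> ?W}"
        using W by (rule openin_continuous_map_preimage)
      moreover have "N #>\<^bsub>F\<^esub> incl i g = c \<longleftrightarrow> \<one>\<^bsub>G i\<^esub> \<otimes>\<^bsub>G i\<^esub> g \<otimes>\<^bsub>G i\<^esub> inv\<^bsub>G i\<^esub> h \<in> ?W"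
        if "g \<in> carrier (G i)" for g
        unfolding h(2) using F.r_coset_eq_iff[OF subgroup_\<N>[OF N] incl.hom_closed[OF that] incl.hom_closed[OF h(1)]] that h(1)
        by simp
      then have "{g \<in> topspace (T i). \<one>\<^bsub>G i\<^esub> \<otimes>\<^bsub>G i\<^esub> g \<otimes>\<^bsub>G i\<^esub> inv\<^bsub>G i\<^esub> h \<in> ?W} =
          {g \<in> carrier (G i). N #>\<^bsub>F\<^esub> incl i g = c}"
        unfolding topspace_T[OF i] by blast
      ultimately show ?thesis by simp
    next
      case False
      then have "{g \<in> carrier (G i). N #>\<^bsub>F\<^esub> incl i g = c} = {}" by auto
      then show ?thesis by (metis (lifting) openin_empty)
    qed
    then have "openin (T i) (\<Union>c\<in>U. {g \<in> carrier (G i). N #>\<^bsub>F\<^esub> incl i g = c})"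
      by (intro openin_Union) auto
    moreover have "(\<Union>c\<in>U. {g \<in> carrier (G i). N #>\<^bsub>F\<^esub> incl i g = c}) =
        {g \<in> topspace (T i). N #>\<^bsub>F\<^esub> incl i g \<in> U}"
      using i by (auto simp: topspace_T)
    ultimately show "openin (T i) {g \<in> topspace (T i). N #>\<^bsub>F\<^esub> incl i g \<in> U}" by simp
  qed
  then show "continuous_map (T i) (discrete_topology (carrier (F Mod N))) (\<lambda>g. \<iota> i g N)"
    using N by (simp add: \<iota>_def completion_def)
qed (use i completion_closed incl_closed in \<open>auto simp: topspace_T \<iota>_def\<close>)

lemma discrete_hom_\<iota>:
  assumes "h \<in> discrete_hom H S P" "i \<in> I"
  shows "(\<lambda>g. h (\<iota> i g)) \<in> discrete_hom (G i) (T i) P"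
  using discrete_hom_continuous_compose[OF assms(1) \<iota>_hom \<iota>_continuous topspace_T] assms(2) by blast

section \<open>The universal property of the free pro-p product\<close>

text \<open>A basic open set of the product topology restricts only finitely many coordinates; these
  form the family.\<close>

lemma basic_neighbourhood:
  assumes "openin S U" "x \<in> U"
  obtains \<F> where "finite \<F>" "\<F> \<subseteq> \<N>" "\<forall>y\<in>carrier H. (\<forall>N\<in>\<F>. y N = x N) \<longrightarrow> y \<in> U"
proof -
  let ?D = "\<lambda>N. discrete_topology (carrier (F Mod N))"
  obtain V where V: "openin (product_topology ?D \<N>) V" "U = V \<inter> carrier H"
    using assms(1) by (auto simp: free_pro_p_topology_def openin_subtopology)
  have "x \<in> V" using assms(2) V(2) by blast
  from bspec[OF V(1)[unfolded openin_product_topology_alt] this]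
  obtain W where "finite {N \<in> \<N>. W N \<noteq> topspace (?D N)} \<and>
      (\<forall>N\<in>\<N>. openin (?D N) (W N)) \<and> x \<in> Pi\<^sub>E \<N> W \<and> Pi\<^sub>E \<N> W \<subseteq> V" ..
  then have W: "finite {N \<in> \<N>. W N \<noteq> topspace (?D N)}" "x \<in> Pi\<^sub>E \<N> W" "Pi\<^sub>E \<N> W \<subseteq> V"
    by simp_all
  show thesis
  proof
    show "\<forall>y\<in>carrier H. (\<forall>N\<in>{N \<in> \<N>. W N \<noteq> topspace (?D N)}. y N = x N) \<longrightarrow> y \<in> U"
    proof (intro ballI impI)
      fix y assume y: "y \<in> carrier H" "\<forall>N\<in>{N \<in> \<N>. W N \<noteq> topspace (?D N)}. y N = x N"
      have "y N \<in> W N" if "N \<in> \<N>" for N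
      proof (cases "W N = topspace (?D N)")
        case True
        then show ?thesis using y(1) that by (auto simp: carrier_H PiE_iff)
      next
        case False
        then show ?thesis using y(2) that W(2) by auto
      qed
      then have "y \<in> Pi\<^sub>E \<N> W" using y(1) by (auto simp: carrier_H PiE_iff)
      then show "y \<in> U" using V W y(1) by blast
    qed
  qed (use W in auto)
qed

text \<open>By directedness some \<open>M\<close> of the system lies below all of the finitely many
  \<open>N\<close>. A representative of \<open>x\<close> at \<open>M\<close> then represents
  \<open>x\<close> at each of them.\<close>

lemma completion_dense:
  assumes "finite \<F>" "\<F> \<subseteq> \<N>" "x \<in> carrier H"
  obtains a where "a \<in> carrier F" "\<forall>N\<in>\<F>. completion a N = x N"
proof -
  have "\<exists>M\<in>\<N>. \<forall>N\<in>\<F>. M \<subseteq> N"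
    using assms(1,2)
  proof (induction rule: finite_induct)
    case empty
    then show ?case using carrier_in_\<N> by auto
  next
    case (insert N \<F>)
    then obtain M where "M \<in> \<N>" "\<forall>N\<in>\<F>. M \<subseteq> N" by auto
    then show ?case using insert.prems Int_in_\<N>[of N M] by (intro bexI[of _ "N \<inter> M"]) auto
  qed
  then obtain M where M: "M \<in> \<N>" "\<forall>N\<in>\<F>. M \<subseteq> N" by blast
  obtain a where a: "a \<in> carrier F" "x M = M #>\<^bsub>F\<^esub> a" using H_component[OF assms(3) M(1)] .
  have "completion a N = x N" if "N \<in> \<F>" for N
    using H_component_mono[OF assms(3) M(1) _ _ a] M(2) that assms(2) by (auto simp: completion_def)
  then show thesis using a(1) that by blast
qed

text \<open>Agreement on the factors gives agreement on the image of the abstract free product,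
  which is dense.\<close>

theorem discrete_hom_eqI:
  assumes P: "group P" and h: "h \<in> discrete_hom H S P" and k: "k \<in> discrete_hom H S P"
    and eq: "\<And>i g. i \<in> I \<Longrightarrow> g \<in> carrier (G i) \<Longrightarrow> h (\<iota> i g) = k (\<iota> i g)"
    and x: "x \<in> carrier H"
  shows "h x = k x"
proof -
  \<comment> \<open>Both maps are constant on this neighbourhood of \<open>x\<close>, so one point
    of the dense image inside it compares them at \<open>x\<close>.\<close>
  let ?V = "{y \<in> carrier H. h y = h x} \<inter> {y \<in> carrier H. k y = k x}"
  have V: "openin S ?V" "x \<in> ?V"
    using discrete_homD(4)[OF h] discrete_homD(4)[OF k] x by auto
  obtain \<F> where \<F>: "finite \<F>" "\<F> \<subseteq> \<N>"
    "\<forall>y\<in>carrier H. (\<forall>N\<in>\<F>. y N = x N) \<longrightarrow>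
y \<in> ?V"
    using basic_neighbourhood[OF V] by blast
  obtain a where a: "a \<in> carrier F" "\<forall>N\<in>\<F>. completion a N = x N"
    using completion_dense[OF \<F>(1,2) x] .
  have "h (completion a) = k (completion a)"
  proof (rule free_product_hom_unique[OF group_G P _ _ _ a(1), where h = "\<lambda>a. h (completion a)" and k = "\<lambda>a. k (completion a)"])
    show "(\<lambda>a. h (completion a)) \<in> hom F P" "(\<lambda>a. k (completion a)) \<in> hom F P"
      using hom_compose[OF completion_hom discrete_homD(1)[OF h]]
        hom_compose[OF completion_hom discrete_homD(1)[OF k]] by (simp_all add: o_def)
  qed (use eq in \<open>auto simp: \<iota>_def\<close>)
  then show ?thesis using \<F>(3) completion_closed[OF a(1)] a(2) by auto
qed

text \<open>The open kernel contains every element that is trivial at some finite set of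
  \<open>N\<close>, and each \<open>N\<close> contains almost all factors. So the finiteness
  condition under which families extend holds automatically for families that come from the
  product.\<close>

theorem discrete_hom_almost_trivial:
  assumes P: "group P" and h: "h \<in> discrete_hom H S P"
  shows "finite {i \<in> I. \<exists>g\<in>carrier (G i). h (\<iota> i g) \<noteq> \<one>\<^bsub>P\<^esub>}"
proof -
  have one: "\<one>\<^bsub>H\<^esub> \<in> {y \<in> carrier H. h y = \<one>\<^bsub>P\<^esub>}"
    using discrete_hom_one[OF H.is_group P h] by simp
  obtain \<F> where \<F>: "finite \<F>" "\<F> \<subseteq> \<N>"
    "\<forall>y\<in>carrier H. (\<forall>N\<in>\<F>. y N = \<one>\<^bsub>H\<^esub> N) \<longrightarrow> y \<in> {y \<in> carrier H. h y = \<one>\<^bsub>P\<^esub>}"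
    using basic_neighbourhood[OF discrete_homD(4)[OF h] one] by blast
  have "h (\<iota> i g) = \<one>\<^bsub>P\<^esub>"
    if i: "i \<in> I" "\<forall>N\<in>\<F>. incl i ` carrier (G i) \<subseteq> N" and g: "g \<in> carrier (G i)" for i g
  proof -
    have "\<iota> i g N = \<one>\<^bsub>H\<^esub> N" if "N \<in> \<F>" for N
      using that i g \<F>(2) F.coset_join2[OF incl_closed[OF i(1) g] subgroup_\<N>, of N]
      by (auto simp: \<iota>_def completion_def one_H)
    then show ?thesis
      using \<F>(3) completion_closed[OF incl_closed[OF i(1) g]] by (auto simp: \<iota>_def)
  qed
  then have "\<not> (\<forall>N\<in>\<F>. incl i ` carrier (G i) \<subseteq> N)"
    if "i \<in> I" "\<exists>g\<in>carrier (G i). h (\<iota> i g) \<noteq> \<one>\<^bsub>P\<^esub>" for i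
    using that by meson
  then have "{i \<in> I. \<exists>g\<in>carrier (G i). h (\<iota> i g) \<noteq> \<one>\<^bsub>P\<^esub>} \<subseteq>
      (\<Union>N\<in>\<F>. {i \<in> I. \<not> incl i ` carrier (G i) \<subseteq> N})" by fast
  moreover have "finite (\<Union>N\<in>\<F>. {i \<in> I. \<not> incl i ` carrier (G i) \<subseteq> N})"
    using \<F>(1,2) by (intro finite_UN_I) (auto simp: free_pro_p_subgroups_def)
  ultimately show ?thesis by (rule finite_subset)
qed

text \<open>The extension to the abstract free product has its kernel \<open>N\<close> in the
  system: the order of \<open>P\<close> controls the index, open fibres and finiteness do the rest.
  So it factors through the component at \<open>N\<close>, which is continuous on the limit.\<close>

theorem discrete_hom_extend:
  assumes P: "finite_p_group p P"
    and f: "\<And>i. i \<in> I \<Longrightarrow> f i \<in> discrete_hom (G i) (T i) P"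
    and fin: "finite {i \<in> I. \<exists>g\<in>carrier (G i). f i g \<noteq> \<one>\<^bsub>P\<^esub>}"
  shows "\<exists>h\<in>discrete_hom H S P. \<forall>i\<in>I. \<forall>g\<in>carrier (G i). h (\<iota> i g) = f i g"
proof -
  have gP: "group P" using P by (simp add: finite_p_group_def)
  have "\<exists>k\<in>hom F P. \<forall>i\<in>I. \<forall>g\<in>carrier (G i). k (incl i g) = f i g"
    by (rule free_product_lift) (use group_G gP discrete_homD(1)[OF f] in auto)
  then obtain k where k: "k \<in> hom F P" "\<And>i g. i \<in> I \<Longrightarrow> g \<in> carrier (G i) \<Longrightarrow> k (incl i g) = f i g"
    by blast
  interpret k: group_hom F P k
    using k(1) gP by (simp add: group_hom_def group_hom_axioms_def F.is_group)
  define N where "N = kernel F P k"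
  have N: "N \<in> \<N>"
    unfolding N_def
  proof (rule kernel_in_\<N>[OF P k(1)])
    show "openin (T i) {g \<in> carrier (G i). k (incl i g) = \<one>\<^bsub>P\<^esub>}" if "i \<in> I" for i
      using discrete_homD(4)[OF f[OF that], of "\<one>\<^bsub>P\<^esub>"] k(2)[OF that] by (simp cong: conj_cong)
    show "finite {i \<in> I. \<exists>g\<in>carrier (G i). k (incl i g) \<noteq> \<one>\<^bsub>P\<^esub>}"
      using fin k(2) by (simp cong: conj_cong)
  qed
  define e where "e c = k (SOME a. a \<in> carrier F \<and> c = N #>\<^bsub>F\<^esub> a)" for c
  have e: "e (N #>\<^bsub>F\<^esub> a) = k a" if a: "a \<in> carrier F" for a
  proof -
    let ?b = "SOME b. b \<in> carrier F \<and> N #>\<^bsub>F\<^esub> a = N #>\<^bsub>F\<^esub> b"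
    have b: "?b \<in> carrier F \<and> N #>\<^bsub>F\<^esub> a = N #>\<^bsub>F\<^esub> ?b"
      by (rule someI[of _ a]) (use a in simp)
    then have "a \<otimes>\<^bsub>F\<^esub> inv\<^bsub>F\<^esub> ?b \<in> N"
      using F.r_coset_eq_iff[OF subgroup_\<N>[OF N] a] by blast
    then have "k a \<otimes>\<^bsub>P\<^esub> inv\<^bsub>P\<^esub> k ?b = \<one>\<^bsub>P\<^esub>"
      using a b by (simp add: N_def kernel_def)
    moreover have "k a = (k a \<otimes>\<^bsub>P\<^esub> inv\<^bsub>P\<^esub> k ?b) \<otimes>\<^bsub>P\<^esub> k ?b"
      using k.hom_closed[OF a] k.hom_closed[of ?b] b by (simp add: k.H.m_assoc)
    ultimately have "k a = k ?b" using b by simp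
    then show ?thesis by (simp add: e_def)
  qed
  show ?thesis
  proof (intro bexI ballI)
    show "(\<lambda>x. e (x N)) \<in> discrete_hom H S P"
    proof (rule discrete_homI)
      show "e (x N) \<in> carrier P" if "x \<in> carrier H" for x
        using H_component[OF that N] e by (metis k.hom_closed)
      show "e ((x \<otimes>\<^bsub>H\<^esub> y) N) = e (x N) \<otimes>\<^bsub>P\<^esub> e (y N)" if x: "x \<in> carrier H" and y: "y \<in> carrier H" for x y
      proof -
        obtain a where a: "a \<in> carrier F" "x N = N #>\<^bsub>F\<^esub> a" using H_component[OF x N] .
        obtain b where b: "b \<in> carrier F" "y N = N #>\<^bsub>F\<^esub> b" using H_component[OF y N] .
        have "(x \<otimes>\<^bsub>H\<^esub> y) N = N #>\<^bsub>F\<^esub> (a \<otimes>\<^bsub>F\<^esub> b)"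
          using a b N normal.rcos_sum[OF normal_\<N>[OF N]] by (simp add: mult_H)
        then show ?thesis using a b by (simp add: e)
      qed
      have "openin S {x \<in> carrier H. x N = c}" for c
      proof (cases "c \<in> carrier (F Mod N)")
        case True
        then show ?thesis
          using openin_continuous_map_preimage[OF continuous_map_component[OF N], of "{c}"] topspace_S by simp
      next
        case False
        then have "{x \<in> carrier H. x N = c} = {}" using N by (auto simp: carrier_H)
        then show ?thesis by (metis (lifting) openin_empty)
      qed
      then show "openin S {x \<in> carrier H. e (x N) = y}" for y by (rule openin_fibre_comp)
    qed
  next
    show "e (\<iota> i g N) = f i g" if "i \<in> I" "g \<in> carrier (G i)" for i g
      using that N by (simp add: \<iota>_def completion_def e incl_closed k(2))
  qed
qed

end

section \<open>Cohomology in degrees one and two\<close>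

definition hom_radical :: "nat \<Rightarrow> ('a, 'b) monoid_scheme \<Rightarrow> 'a topology \<Rightarrow> ('a \<Rightarrow> int) set" where
  "hom_radical p G T =
     {\<alpha> \<in> discrete_hom G T (integer_mod_group p).
        \<forall>\<beta> \<in> discrete_hom G T (integer_mod_group p).
          \<exists>h \<in> discrete_hom G T (heisenberg p).
            \<forall>g\<in>carrier G. fst (h g) = \<alpha> g \<and> fst (snd (h g)) = \<beta> g}"

text \<open>The homomorphism \<open>\<phi>\<close> composed with the classical transfer into the
  abelianised kernel of \<open>\<kappa>\<close>, where \<open>s j\<close> represents the right coset
  on which \<open>\<kappa>\<close> is \<open>j\<close>.\<close>

definition transfer ::
  "nat \<Rightarrow> ('a, 'b) monoid_scheme \<Rightarrow> ('a \<Rightarrow> int) \<Rightarrow> (int \<Rightarrow> 'a) \<Rightarrow> ('a \<Rightarrow> int) \<Rightarrow> 'a \<Rightarrow> int" where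
  "transfer p G \<kappa> s \<phi> g =
     (\<Sum>j\<in>{0..<int p}. \<phi> (s j \<otimes>\<^bsub>G\<^esub> g \<otimes>\<^bsub>G\<^esub> inv\<^bsub>G\<^esub> s ((j + \<kappa> g) mod int p))) mod int p"

text \<open>A left-invariant function of two arguments depends only on the quotient of its
  arguments. The restriction to tuples makes the cochain insensitive to values of \<open>f\<close>
  outside the carrier.\<close>

definition homogeneous :: "('a, 'b) monoid_scheme \<Rightarrow> ('a \<Rightarrow> int) \<Rightarrow> (nat \<Rightarrow> 'a) \<Rightarrow> int" where
  "homogeneous G f = (\<lambda>s\<in>tuples G 1. f (inv\<^bsub>G\<^esub> s 0 \<otimes>\<^bsub>G\<^esub> s 1))"

definition discrete_maps :: "nat \<Rightarrow> ('a, 'b) monoid_scheme \<Rightarrow> 'a topology \<Rightarrow> ('a \<Rightarrow> int) set" where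
  "discrete_maps p G T =
     {f. (\<forall>g\<in>carrier G. f g \<in> {0..<int p}) \<and> (\<forall>x. openin T {g \<in> carrier G. f g = x})}"

section \<open>Homogeneous and inhomogeneous cochains\<close>

lemma tuples_mem: "s \<in> tuples G n \<Longrightarrow> i \<le> n \<Longrightarrow> s i \<in> carrier G"
  by (auto simp: tuples_def)

lemma tuples_restrict: "(\<And>i. i \<le> n \<Longrightarrow> s i \<in> carrier G) \<Longrightarrow> (\<lambda>i\<in>{..n}. s i) \<in> tuples G n"
  by (auto simp: tuples_def)

text \<open>Replaces ring operations by integers reduced once at the end, so that the cochain
  computations become congruences mod p.\<close>

lemma residue_coboundary:
  assumes "1 < p"
  shows "coboundary_map (residue_ring (int p)) G n x =
    (\<lambda>s\<in>tuples G (Suc n). (\<Sum>i\<le>Suc n. (-1) ^ i * x (face n i s)) mod int p)"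
proof -
  interpret residues "int p" "residue_ring (int p)"
    using assms by unfold_locales auto
  have "(\<ominus>\<^bsub>residue_ring (int p)\<^esub> \<one>\<^bsub>residue_ring (int p)\<^esub>) [^]\<^bsub>residue_ring (int p)\<^esub> i
      \<otimes>\<^bsub>residue_ring (int p)\<^esub> y = ((-1) ^ i * y) mod int p" for i :: nat and y
    unfolding res_neg_eq res_one_eq pow_cong res_mult_eq by (rule mod_mult_left_eq)
  then show ?thesis
    unfolding coboundary_map_def by (simp add: sum_cong)
qed

lemma cochain_group_simps:
  "carrier (cochain_group R G T n) = cochains R G T n"
  "x \<otimes>\<^bsub>cochain_group R G T n\<^esub> y = (\<lambda>s\<in>tuples G n. x s \<oplus>\<^bsub>R\<^esub> y s)"
  "\<one>\<^bsub>cochain_group R G T n\<^esub> = (\<lambda>s\<in>tuples G n. \<zero>\<^bsub>R\<^esub>)"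
  by (simp_all add: cochain_group_def)

lemma residue_ring_simps:
  "carrier (residue_ring m) = {0..m - 1}" "x \<oplus>\<^bsub>residue_ring m\<^esub> y = (x + y) mod m"
  "\<zero>\<^bsub>residue_ring m\<^esub> = 0" "x \<otimes>\<^bsub>residue_ring m\<^esub> y = (x * y) mod m"
  by (simp_all add: residue_ring_def)

lemma homogeneous_eq_iff:
  fixes G (structure)
  assumes "group G"
  shows "homogeneous G f = homogeneous G f' \<longleftrightarrow> (\<forall>g\<in>carrier G. f g = f' g)"
proof
  interpret group G by fact
  assume eq: "homogeneous G f = homogeneous G f'"
  show "\<forall>g\<in>carrier G. f g = f' g"
  proof
    fix g assume g: "g \<in> carrier G"
    \<comment> \<open>At the tuple with entries \<open>\<one>\<close> and \<open>g\<close> the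
      homogeneous cochain takes the value \<open>f g\<close>.\<close>
    let ?s = "\<lambda>i\<in>{..1::nat}. if i = 0 then \<one> else g"
    have "?s \<in> tuples G 1" using g by (intro tuples_restrict) auto
    then show "f g = f' g" using fun_cong[OF eq, of ?s] g by (simp add: homogeneous_def)
  qed
next
  interpret group G by fact
  assume "\<forall>g\<in>carrier G. f g = f' g"
  then show "homogeneous G f = homogeneous G f'"
    unfolding homogeneous_def by (intro restrict_ext) (auto dest: tuples_mem)
qed

lemma homogeneous_cochain:
  fixes G (structure)
  assumes G: "topological_group G T" and f: "f \<in> discrete_maps p G T"
  shows "homogeneous G f \<in> cochains (residue_ring (int p)) G T 1"
proof -
  interpret group G using G by (simp add: topological_group_def)
  have ts: "topspace T = carrier G" and m: "continuous_map (prod_topology T T) T (\<lambda>(x, y). x \<otimes> y)"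
    and iv: "continuous_map T T (\<lambda>x. inv x)"
    using G by (auto simp: topological_group_def)
  let ?P = "product_topology (\<lambda>_. T) {..1::nat}"
  have tP: "topspace ?P = tuples G 1" by (simp add: tuples_def ts)
  have 0: "continuous_map ?P T (\<lambda>s. inv s 0)"
    using continuous_map_compose[OF continuous_map_product_projection[of 0 "{..1::nat}" "\<lambda>_. T"] iv] by (simp add: o_def)
  have 1: "continuous_map ?P T (\<lambda>s. s 1)"
    by (rule continuous_map_product_projection) simp
  have c: "continuous_map ?P T (\<lambda>s. inv s 0 \<otimes> s 1)"
    using continuous_map_compose[OF _ m, of ?P "\<lambda>s. (inv s 0, s 1)"] 0 1
    by (simp add: o_def continuous_map_paired)
  have quot: "inv s 0 \<otimes> s 1 \<in> carrier G" if "s \<in> tuples G 1" for s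
    using tuples_mem[OF that, of 0] tuples_mem[OF that, of 1] by simp
  have "continuous_map ?P (discrete_topology {0..int p - 1}) (homogeneous G f)"
    unfolding continuous_map_def
  proof (intro conjI allI impI)
    show "homogeneous G f \<in> topspace ?P \<rightarrow> topspace (discrete_topology {0..int p - 1})"
      using f quot unfolding tP by (auto simp: homogeneous_def discrete_maps_def)
    fix U
    have "openin ?P {s \<in> topspace ?P. inv s 0 \<otimes> s 1 \<in> (\<Union>x\<in>U. {g \<in> carrier G. f g = x})}"
      using f by (intro openin_continuous_map_preimage[OF c] openin_Union) (auto simp: discrete_maps_def)
    moreover have "{s \<in> topspace ?P. inv s 0 \<otimes> s 1 \<in> (\<Union>x\<in>U. {g \<in> carrier G. f g = x})} =
        {s \<in> topspace ?P. homogeneous G f s \<in> U}"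
      unfolding tP using quot by (auto simp: homogeneous_def)
    ultimately show "openin ?P {s \<in> topspace ?P. homogeneous G f s \<in> U}" by simp
  qed
  moreover have "homogeneous G f (\<lambda>i\<in>{..1}. g \<otimes> s i) = homogeneous G f s"
    if "g \<in> carrier G" "s \<in> tuples G 1" for g s
  proof -
    have s: "s 0 \<in> carrier G" "s 1 \<in> carrier G" using that by (auto dest: tuples_mem)
    have "inv g \<otimes> (g \<otimes> s 1) = s 1" using s that(1) by (simp flip: m_assoc)
    then have "inv (g \<otimes> s 0) \<otimes> (g \<otimes> s 1) = inv s 0 \<otimes> s 1"
      using s that(1) by (simp add: inv_mult_group m_assoc)
    moreover have "(\<lambda>i\<in>{..1}. g \<otimes> s i) \<in> tuples G 1"
      using that tuples_mem by (intro tuples_restrict) blast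
    ultimately show ?thesis using that(2) by (simp add: homogeneous_def)
  qed
  ultimately show ?thesis
    by (simp add: cochains_def residue_ring_simps) (simp add: homogeneous_def)
qed

text \<open>Translation by the inverse of the first entry moves any pair to one that starts with
  \<open>\<one>\<close>. Hence \<open>x\<close> is recovered from the function \<open>g\<close>
  \<mapsto> \<open>x (?t g)\<close>.\<close>

lemma cochain_homogeneous:
  fixes G (structure)
  assumes G: "topological_group G T" and x: "x \<in> cochains (residue_ring (int p)) G T 1"
  obtains f where "f \<in> discrete_maps p G T" "x = homogeneous G f"
proof -
  interpret group G using G by (simp add: topological_group_def)
  have ts: "topspace T = carrier G" using G by (simp add: topological_group_def)
  let ?P = "product_topology (\<lambda>_. T) {..1::nat}"
  let ?t = "\<lambda>g. \<lambda>i\<in>{..1::nat}. if i = 0 then \<one> else g"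
  have cx: "continuous_map ?P (discrete_topology {0..int p - 1}) x"
    and inv: "\<And>g s. g \<in> carrier G \<Longrightarrow> s \<in> tuples G 1 \<Longrightarrow> x (\<lambda>i\<in>{..1}. g \<otimes> s i) = x s"
    and ext: "x \<in> extensional (tuples G 1)"
    using x by (auto simp: cochains_def residue_ring_simps)
  have t: "?t g \<in> tuples G 1" if "g \<in> carrier G" for g
    using that by (intro tuples_restrict) auto
  have ct: "continuous_map T ?P ?t"
    unfolding continuous_map_componentwise by (auto simp: ts)
  have c: "continuous_map T (discrete_topology {0..int p - 1}) (\<lambda>g. x (?t g))"
    using continuous_map_compose[OF ct cx] by (simp add: o_def)
  show thesis
  proof
    show "(\<lambda>g. x (?t g)) \<in> discrete_maps p G T"
      unfolding discrete_maps_def mem_Collect_eq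
    proof (intro conjI ballI allI)
      show x_in: "x (?t g) \<in> {0..<int p}" if "g \<in> carrier G" for g
        using continuous_map_funspace[OF c] that by (auto simp: ts)
      show "openin T {g \<in> carrier G. x (?t g) = y}" for y
      proof (cases "y \<in> {0..int p - 1}")
        case True
        then show ?thesis
          using openin_continuous_map_preimage[OF c, of "{y}"] by (simp add: ts)
      next
        case False
        then have "{g \<in> carrier G. x (?t g) = y} = {}" using x_in by fastforce
        then show ?thesis by (metis (lifting) openin_empty)
      qed
    qed
    show "x = homogeneous G (\<lambda>g. x (?t g))"
    proof
      fix s
      show "x s = homogeneous G (\<lambda>g. x (?t g)) s"
      proof (cases "s \<in> tuples G 1")
        case True
        then have s: "s 0 \<in> carrier G" "s 1 \<in> carrier G" by (auto dest: tuples_mem)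
        have "(\<lambda>i\<in>{..1}. inv s 0 \<otimes> s i) = ?t (inv s 0 \<otimes> s 1)"
          using s by (auto intro!: restrict_ext simp: le_Suc_eq)
        then show ?thesis using inv[of "inv s 0" s] s True by (simp add: homogeneous_def)
      next
        case False
        then show ?thesis using ext by (simp add: homogeneous_def extensional_def)
      qed
    qed
  qed
qed

text \<open>With \<open>a\<close> and \<open>b\<close> the quotients of consecutive entries, this is
  the bar coboundary f(b) - f(ab) + f(a), written as a function of homogeneous tuples.\<close>

definition inhomogeneous_coboundary ::
  "nat \<Rightarrow> ('a, 'b) monoid_scheme \<Rightarrow> ('a \<Rightarrow> int) \<Rightarrow> (nat \<Rightarrow> 'a) \<Rightarrow> int" where
  "inhomogeneous_coboundary p G f =
     (\<lambda>s\<in>tuples G 2. (f (inv\<^bsub>G\<^esub> s 1 \<otimes>\<^bsub>G\<^esub> s 2) - f (inv\<^bsub>G\<^esub> s 0 \<otimes>\<^bsub>G\<^esub> s 2) + f (inv\<^bsub>G\<^esub> s 0 \<otimes>\<^bsub>G\<^esub> s 1)) mod int p)"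

lemma coboundary_homogeneous:
  assumes "1 < p"
  shows "coboundary_map (residue_ring (int p)) G 1 (homogeneous G f) = inhomogeneous_coboundary p G f"
proof -
  have "homogeneous G f (face 1 0 s) = f (inv\<^bsub>G\<^esub> s 1 \<otimes>\<^bsub>G\<^esub> s 2)"
    "homogeneous G f (face 1 (Suc 0) s) = f (inv\<^bsub>G\<^esub> s 0 \<otimes>\<^bsub>G\<^esub> s 2)"
    "homogeneous G f (face 1 (Suc (Suc 0)) s) = f (inv\<^bsub>G\<^esub> s 0 \<otimes>\<^bsub>G\<^esub> s 1)"
    if s: "s \<in> tuples G 2" for s
  proof -
    have t: "face 1 i s \<in> tuples G 1" for i
      using tuples_mem[OF s] unfolding face_def by (intro tuples_restrict) auto
    show "homogeneous G f (face 1 0 s) = f (inv\<^bsub>G\<^esub> s 1 \<otimes>\<^bsub>G\<^esub> s 2)"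
      "homogeneous G f (face 1 (Suc 0) s) = f (inv\<^bsub>G\<^esub> s 0 \<otimes>\<^bsub>G\<^esub> s 2)"
      "homogeneous G f (face 1 (Suc (Suc 0)) s) = f (inv\<^bsub>G\<^esub> s 0 \<otimes>\<^bsub>G\<^esub> s 1)"
      using t[of 0] t[of "Suc 0"] t[of "Suc (Suc 0)"] unfolding homogeneous_def
      by (simp_all add: face_def numeral_2_eq_2)
  qed
  then show ?thesis
    unfolding residue_coboundary[OF assms] inhomogeneous_coboundary_def
    by (intro ext) (simp add: restrict_def numeral_2_eq_2)
qed

lemma inhomogeneous_coboundary_eq_iff:
  fixes G (structure)
  assumes "group G"
  shows "inhomogeneous_coboundary p G f = (\<lambda>s\<in>tuples G 2. c (inv\<^bsub>G\<^esub> s 0 \<otimes>\<^bsub>G\<^esub> s 1) (inv\<^bsub>G\<^esub> s 1 \<otimes>\<^bsub>G\<^esub> s 2)) \<longleftrightarrow>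
    (\<forall>a\<in>carrier G. \<forall>b\<in>carrier G. (f b - f (a \<otimes>\<^bsub>G\<^esub> b) + f a) mod int p = c a b)"
    (is "?l = ?r \<longleftrightarrow> _")
proof
  interpret group G by fact
  assume eq: "?l = ?r"
  show "\<forall>a\<in>carrier G. \<forall>b\<in>carrier G. (f b - f (a \<otimes> b) + f a) mod int p = c a b"
  proof (intro ballI)
    fix a b assume ab: "a \<in> carrier G" "b \<in> carrier G"
    \<comment> \<open>The tuple with entries \<open>\<one>\<close>, \<open>a\<close>,
      \<open>a \<otimes> b\<close> has consecutive quotients \<open>a\<close> and
      \<open>b\<close>.\<close>
    let ?s = "\<lambda>i\<in>{..2::nat}. if i = 0 then \<one> else if i = 1 then a else a \<otimes> b"
    have "?s \<in> tuples G 2" using ab by (intro tuples_restrict) auto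
    moreover have "inv a \<otimes> (a \<otimes> b) = b" using ab by (simp flip: m_assoc)
    ultimately show "(f b - f (a \<otimes> b) + f a) mod int p = c a b"
      using fun_cong[OF eq, of ?s] ab by (simp add: inhomogeneous_coboundary_def)
  qed
next
  interpret group G by fact
  assume r: "\<forall>a\<in>carrier G. \<forall>b\<in>carrier G. (f b - f (a \<otimes> b) + f a) mod int p = c a b"
  show "?l = ?r"
    unfolding inhomogeneous_coboundary_def
  proof (rule restrict_ext)
    fix s assume t: "s \<in> tuples G 2"
    have s: "s 0 \<in> carrier G" "s 1 \<in> carrier G" "s 2 \<in> carrier G"
      using tuples_mem[OF t, of 0] tuples_mem[OF t, of 1] tuples_mem[OF t, of 2] by simp_all
    have "s 1 \<otimes> (inv s 1 \<otimes> s 2) = s 2" using s by (simp flip: m_assoc)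
    then have "(inv s 0 \<otimes> s 1) \<otimes> (inv s 1 \<otimes> s 2) = inv s 0 \<otimes> s 2"
      using s by (simp add: m_assoc)
    then show "(f (inv s 1 \<otimes> s 2) - f (inv s 0 \<otimes> s 2) + f (inv s 0 \<otimes> s 1)) mod int p =
        c (inv s 0 \<otimes> s 1) (inv s 1 \<otimes> s 2)"
      using r[rule_format, of "inv s 0 \<otimes> s 1" "inv s 1 \<otimes> s 2"] s by simp
  qed
qed

text \<open>Invariant \<open>0\<close>-cochains are constant.\<close>

lemma coboundaries_1:
  fixes G (structure)
  assumes p: "1 < p" and G: "topological_group G T"
  shows "coboundaries (residue_ring (int p)) G T 1 = {\<lambda>s\<in>tuples G 1. 0}"
proof -
  interpret group G using G by (simp add: topological_group_def)
  let ?R = "residue_ring (int p)"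
  have "coboundary_map ?R G 0 x = (\<lambda>s\<in>tuples G 1. 0)" if x: "x \<in> cochains ?R G T 0" for x
  proof -
    have "x (face 0 0 s) = x (face 0 (Suc 0) s)" if s: "s \<in> tuples G (Suc 0)" for s
    proof -
      have m: "s 0 \<in> carrier G" "s (Suc 0) \<in> carrier G" using s by (auto dest: tuples_mem)
      have t: "face 0 (Suc 0) s \<in> tuples G 0" using m unfolding face_def by (intro tuples_restrict) auto
      have "(\<lambda>i\<in>{..0}. (s (Suc 0) \<otimes> inv s 0) \<otimes> face 0 (Suc 0) s i) = face 0 0 s"
        using m unfolding face_def by (intro restrict_ext) (auto simp: m_assoc)
      moreover have "x (\<lambda>i\<in>{..0}. (s (Suc 0) \<otimes> inv s 0) \<otimes> face 0 (Suc 0) s i) = x (face 0 (Suc 0) s)"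
        using x t m by (simp add: cochains_def)
      ultimately show ?thesis by simp
    qed
    then show ?thesis
      unfolding residue_coboundary[OF p] by (auto intro!: restrict_ext)
  qed
  moreover have "(\<lambda>s\<in>tuples G 0. 0) \<in> cochains ?R G T 0"
  proof -
    have tP: "topspace (product_topology (\<lambda>_. T) {..0::nat}) = tuples G 0"
      using G by (simp add: tuples_def topological_group_def)
    have "continuous_map (product_topology (\<lambda>_. T) {..0::nat}) (discrete_topology {0..int p - 1}) (\<lambda>s. 0)"
      using p by simp
    then have "continuous_map (product_topology (\<lambda>_. T) {..0::nat}) (discrete_topology {0..int p - 1}) (\<lambda>s\<in>tuples G 0. 0)"
      by (rule continuous_map_eq) (unfold tP, simp)
    moreover have "(\<lambda>i\<in>{..0}. g \<otimes> s i) \<in> tuples G 0" if "g \<in> carrier G" "s \<in> tuples G 0" for g s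
      using that by (intro tuples_restrict) (auto dest: tuples_mem)
    ultimately show ?thesis by (simp add: cochains_def residue_ring_simps)
  qed
  ultimately show ?thesis unfolding coboundaries_def by (auto simp: image_iff)
qed

section \<open>Classes, cup products and the radical in terms of homomorphisms\<close>

text \<open>The zero cochain is the only coboundary in degree one, so the class is a single cochain.
  Adding zero in the ring reduces mod p, which changes nothing because the values of
  \<open>f\<close> are reduced.\<close>

lemma cochain_class_1:
  fixes G (structure)
  assumes p: "1 < p" and G: "topological_group G T" and "\<And>g. g \<in> carrier G \<Longrightarrow> f g \<in> {0..<int p}"
  shows "cochain_class (residue_ring (int p)) G T 1 (homogeneous G f) = {homogeneous G f}"
proof -
  interpret group G using G by (simp add: topological_group_def)
  have "f (inv s 0 \<otimes> s 1) mod int p = f (inv s 0 \<otimes> s 1)" if "s \<in> tuples G 1" for s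
    using assms(3)[of "inv s 0 \<otimes> s 1"] tuples_mem[OF that] by simp
  then show ?thesis
    unfolding cochain_class_def coboundaries_1[OF p G]
    by (auto simp: r_coset_def cochain_group_simps residue_ring_simps homogeneous_def intro!: restrict_ext)
qed

text \<open>Since values are reduced residues, vanishing of f(b) - f(ab) + f(a) mod p is exactly
  additivity in \<open>integer_mod_group p\<close>.\<close>

lemma cocycles_1:
  assumes p: "1 < p" and G: "topological_group G T"
  shows "cocycles (residue_ring (int p)) G T 1 = homogeneous G ` discrete_hom G T (integer_mod_group p)"
proof -
  have gr: "group G" using G by (simp add: topological_group_def)
  have key: "coboundary_map (residue_ring (int p)) G 1 (homogeneous G f) =
      \<one>\<^bsub>cochain_group (residue_ring (int p)) G T (Suc 1)\<^esub> \<longleftrightarrow> f \<in> discrete_hom G T (integer_mod_group p)"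
    if f: "f \<in> discrete_maps p G T" for f
  proof -
    have fm: "f g mod int p = f g" if "g \<in> carrier G" for g
      using f that by (auto simp: discrete_maps_def)
    have e: "(f b - f (a \<otimes>\<^bsub>G\<^esub> b) + f a) mod int p = 0 \<longleftrightarrow> f (a \<otimes>\<^bsub>G\<^esub> b) = (f a + f b) mod int p"
      if "a \<in> carrier G" "b \<in> carrier G" for a b
    proof -
      have "(f b - f (a \<otimes>\<^bsub>G\<^esub> b) + f a) mod int p = 0 \<longleftrightarrow> (f a + f b) mod int p = f (a \<otimes>\<^bsub>G\<^esub> b) mod int p"
        unfolding mod_eq_dvd_iff by (simp add: dvd_eq_mod_eq_0 algebra_simps)
      then show ?thesis
        using fm[OF monoid.m_closed[OF group.is_monoid[OF gr] that]] by auto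
    qed
    have "coboundary_map (residue_ring (int p)) G 1 (homogeneous G f) =
      \<one>\<^bsub>cochain_group (residue_ring (int p)) G T (Suc 1)\<^esub> \<longleftrightarrow>
        inhomogeneous_coboundary p G f = (\<lambda>s\<in>tuples G 2. 0)"
      unfolding coboundary_homogeneous[OF p] by (simp add: cochain_group_simps residue_ring_simps numeral_2_eq_2)
    also have "\<dots> \<longleftrightarrow> (\<forall>a\<in>carrier G. \<forall>b\<in>carrier G. f (a \<otimes>\<^bsub>G\<^esub> b) = (f a + f b) mod int p)"
      unfolding inhomogeneous_coboundary_eq_iff[OF gr, of p f "\<lambda>_ _. 0"] using e by simp
    also have "\<dots> \<longleftrightarrow> f \<in> discrete_hom G T (integer_mod_group p)"
      using f p by (auto simp: discrete_maps_def discrete_hom_def hom_def carrier_integer_mod_group)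
    finally show ?thesis .
  qed
  have sub: "f \<in> discrete_maps p G T" if "f \<in> discrete_hom G T (integer_mod_group p)" for f
    using that p by (auto simp: discrete_maps_def discrete_hom_def hom_def carrier_integer_mod_group Pi_iff)
  show ?thesis
  proof (intro equalityI subsetI)
    fix x assume x: "x \<in> cocycles (residue_ring (int p)) G T 1"
    then have "x \<in> cochains (residue_ring (int p)) G T 1"
      by (simp add: cocycles_def kernel_def cochain_group_simps)
    then obtain f where f: "f \<in> discrete_maps p G T" "x = homogeneous G f"
      by (rule cochain_homogeneous[OF G])
    then show "x \<in> homogeneous G ` discrete_hom G T (integer_mod_group p)"
      using x key[OF f(1)] by (auto simp: cocycles_def kernel_def)
  next
    fix x assume "x \<in> homogeneous G ` discrete_hom G T (integer_mod_group p)"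
    then obtain f where f: "f \<in> discrete_hom G T (integer_mod_group p)" "x = homogeneous G f" by blast
    then show "x \<in> cocycles (residue_ring (int p)) G T 1"
      using key[OF sub[OF f(1)]] homogeneous_cochain[OF G sub[OF f(1)]]
      by (simp add: cocycles_def kernel_def cochain_group_simps)
  qed
qed

lemma cohomology_1:
  assumes p: "1 < p" and G: "topological_group G T"
  shows "carrier (cohomology (residue_ring (int p)) G T 1) =
    (\<lambda>\<phi>. {homogeneous G \<phi>}) ` discrete_hom G T (integer_mod_group p)"
proof -
  let ?R = "residue_ring (int p)"
  have "carrier (cohomology ?R G T 1) = (\<lambda>x. cochain_class ?R G T 1 x) ` cocycles ?R G T 1"
    by (auto simp: cohomology_def carrier_FactGroup cochain_class_def r_coset_def)
  moreover have "cochain_class ?R G T 1 (homogeneous G \<phi>) = {homogeneous G \<phi>}"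
    if "\<phi> \<in> discrete_hom G T (integer_mod_group p)" for \<phi>
    using p discrete_homD(2)[OF that] by (intro cochain_class_1 G) (auto simp: carrier_integer_mod_group)
  ultimately show ?thesis
    unfolding cocycles_1[OF assms] by (simp add: image_image cong: image_cong)
qed

text \<open>The front face of a triple has quotient a and the back face has quotient b. The product
  cochain is therefore \<phi>(a) \<psi>(b), the pullback of the factor set of
  \<open>heisenberg p\<close>.\<close>

lemma cup_1_1:
  assumes p: "1 < p"
  shows "cup (residue_ring (int p)) G T 1 1 {homogeneous G \<phi>} {homogeneous G \<psi>} =
    cochain_class (residue_ring (int p)) G T 2
      (\<lambda>s\<in>tuples G 2. \<phi> (inv\<^bsub>G\<^esub> s 0 \<otimes>\<^bsub>G\<^esub> s 1) * \<psi> (inv\<^bsub>G\<^esub> s 1 \<otimes>\<^bsub>G\<^esub> s 2) mod int p)"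
proof -
  have "homogeneous G \<phi> (\<lambda>i\<in>{..1}. s i) = \<phi> (inv\<^bsub>G\<^esub> s 0 \<otimes>\<^bsub>G\<^esub> s 1)"
    "homogeneous G \<psi> (\<lambda>i\<in>{..1}. s (1 + i)) = \<psi> (inv\<^bsub>G\<^esub> s 1 \<otimes>\<^bsub>G\<^esub> s 2)" if s: "s \<in> tuples G 2" for s
  proof -
    have "(\<lambda>i\<in>{..1}. s i) \<in> tuples G 1" "(\<lambda>i\<in>{..1}. s (1 + i)) \<in> tuples G 1"
      by (intro tuples_restrict tuples_mem[OF s]; simp)+
    then show "homogeneous G \<phi> (\<lambda>i\<in>{..1}. s i) = \<phi> (inv\<^bsub>G\<^esub> s 0 \<otimes>\<^bsub>G\<^esub> s 1)"
      "homogeneous G \<psi> (\<lambda>i\<in>{..1}. s (1 + i)) = \<psi> (inv\<^bsub>G\<^esub> s 1 \<otimes>\<^bsub>G\<^esub> s 2)"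
      unfolding homogeneous_def by (simp_all add: numeral_2_eq_2)
  qed
  then have "cup_cochain (residue_ring (int p)) G 1 1 (homogeneous G \<phi>) (homogeneous G \<psi>) =
      (\<lambda>s\<in>tuples G 2. \<phi> (inv\<^bsub>G\<^esub> s 0 \<otimes>\<^bsub>G\<^esub> s 1) * \<psi> (inv\<^bsub>G\<^esub> s 1 \<otimes>\<^bsub>G\<^esub> s 2) mod int p)"
    unfolding cup_cochain_def one_add_one by (intro restrict_ext) (simp only: residue_ring_simps)
  then show ?thesis unfolding cup_def one_add_one by simp
qed

lemma coboundaries_2:
  assumes p: "1 < p" and G: "topological_group G T"
  shows "coboundaries (residue_ring (int p)) G T 2 = inhomogeneous_coboundary p G ` discrete_maps p G T"
proof -
  have "cochains (residue_ring (int p)) G T 1 = homogeneous G ` discrete_maps p G T"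
    using homogeneous_cochain[OF G] cochain_homogeneous[OF G] by blast
  then show ?thesis
    unfolding coboundaries_def
    by (simp add: numeral_2_eq_2 image_image coboundary_homogeneous[OF p, simplified])
qed

text \<open>A coset of the coboundaries equals the coboundaries iff its representative is one of
  them. The group law on coboundaries is supplied by explicit combinations of the underlying
  functions.\<close>

lemma cochain_class_2_trivial_iff:
  fixes G (structure)
  assumes p: "1 < p" and G: "topological_group G T" and z: "\<And>a b. z a b \<in> {0..<int p}"
  defines "Z \<equiv> (\<lambda>s\<in>tuples G 2. z (inv s 0 \<otimes> s 1) (inv s 1 \<otimes> s 2))"
  shows "cochain_class (residue_ring (int p)) G T 2 Z = coboundaries (residue_ring (int p)) G T 2 \<longleftrightarrow>
    (\<exists>f\<in>discrete_maps p G T. \<forall>a\<in>carrier G. \<forall>b\<in>carrier G. (f b - f (a \<otimes> b) + f a) mod int p = z a b)"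
    (is "?B = ?C \<longleftrightarrow> _")
proof -
  let ?R = "residue_ring (int p)" and ?D = "inhomogeneous_coboundary p G" and ?M = "discrete_maps p G T"
  have gr: "group G" and ts: "topspace T = carrier G" using G by (auto simp: topological_group_def)
  have opn: "openin T (carrier G)" using ts openin_topspace[of T] by simp
  have B: "?B = (\<lambda>f. \<lambda>s\<in>tuples G 2. (?D f s + Z s) mod int p) ` ?M"
    unfolding cochain_class_def coboundaries_2[OF p G]
    by (auto simp: r_coset_def cochain_group_simps residue_ring_simps)
  have C: "?C = ?D ` ?M" by (rule coboundaries_2[OF p G])
  have "{g \<in> carrier G. (0::int) = x} = (if x = 0 then carrier G else {})" for x by auto
  then have zero: "(\<lambda>_. 0) \<in> ?M" using p opn by (simp add: discrete_maps_def)
  \<comment> \<open>The values \<open>k = 1\<close> and \<open>k = -1\<close> serve the two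
    inclusions between the coset and the set of coboundaries.\<close>
  have comb: "(\<lambda>g. (f g + k * h g) mod int p) \<in> ?M" if "f \<in> ?M" "h \<in> ?M" for f h and k :: int
    using that p openin_fibre_comp2[of T "carrier G" f h "\<lambda>x y. (x + k * y) mod int p"]
    by (simp add: discrete_maps_def)
  have D_comb: "?D (\<lambda>g. (f g + k * h g) mod int p) s = (?D f s + k * ?D h s) mod int p"
    if "s \<in> tuples G 2" for f h and k :: int and s
  proof -
    have e: "((x1 + k * y1) mod int p - (x2 + k * y2) mod int p + (x3 + k * y3) mod int p) mod int p =
      ((x1 - x2 + x3) mod int p + k * ((y1 - y2 + y3) mod int p)) mod int p" for x1 x2 x3 y1 y2 y3
    proof -
      have "((x1 + k * y1) mod int p - (x2 + k * y2) mod int p + (x3 + k * y3) mod int p) mod int p =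
          ((x1 + k * y1) - (x2 + k * y2) + (x3 + k * y3)) mod int p"
        by (intro mod_add_cong mod_diff_cong) simp_all
      also have "\<dots> = ((x1 - x2 + x3) + k * (y1 - y2 + y3)) mod int p"
        by (simp add: algebra_simps)
      also have "\<dots> = ((x1 - x2 + x3) mod int p + k * ((y1 - y2 + y3) mod int p)) mod int p"
        by (intro mod_add_cong mod_mult_cong) simp_all
      finally show ?thesis .
    qed
    show ?thesis using that e by (simp add: inhomogeneous_coboundary_def)
  qed
  have D_range: "?D f s mod int p = ?D f s" if "s \<in> tuples G 2" for f s
    using that by (simp add: inhomogeneous_coboundary_def)
  have D_ext: "?D f \<in> extensional (tuples G 2)" for f
    by (simp add: inhomogeneous_coboundary_def)
  have ZD: "Z = ?D f \<longleftrightarrow>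
      (\<forall>a\<in>carrier G. \<forall>b\<in>carrier G. (f b - f (a \<otimes> b) + f a) mod int p = z a b)" for f
    unfolding Z_def inhomogeneous_coboundary_eq_iff[OF gr, of p f z, symmetric] by (rule eq_commute)
  have "?B = ?C \<longleftrightarrow> Z \<in> ?C"
  proof
    assume eq: "?B = ?C"
    have "(\<lambda>s\<in>tuples G 2. (?D (\<lambda>_. 0) s + Z s) mod int p) = Z"
      using z by (auto simp: Z_def inhomogeneous_coboundary_def intro!: restrict_ext)
    then have "Z \<in> ?B" unfolding B by (intro image_eqI[OF _ zero]) (rule HOL.sym)
    then show "Z \<in> ?C" unfolding eq .
  next
    assume "Z \<in> ?C"
    then obtain h where h: "h \<in> ?M" "Z = ?D h" unfolding C by blast
    show "?B = ?C"
    proof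
      have "(\<lambda>s\<in>tuples G 2. (?D f s + Z s) mod int p) = ?D (\<lambda>g. (f g + 1 * h g) mod int p)" for f
        using D_comb[of _ f 1 h] D_ext by (intro extensionalityI[of _ "tuples G 2"]) (auto simp: h(2))
      then show "?B \<subseteq> ?C" unfolding B C using comb[OF _ h(1), of _ 1] by auto
      have "?D f = (\<lambda>s\<in>tuples G 2. (?D (\<lambda>g. (f g + (-1) * h g) mod int p) s + Z s) mod int p)" for f
      proof (rule extensionalityI[of _ "tuples G 2"])
        fix s assume s: "s \<in> tuples G 2"
        show "?D f s = (\<lambda>s\<in>tuples G 2. (?D (\<lambda>g. (f g + (-1) * h g) mod int p) s + Z s) mod int p) s"
          using s D_comb[OF s, of f "-1" h] D_range[OF s, of f] by (simp add: h(2) mod_simps)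
      qed (simp_all add: D_ext)
      then show "?C \<subseteq> ?B" unfolding B C using comb[OF _ h(1), of _ "-1"] by blast
    qed
  qed
  then show ?thesis unfolding C using ZD by blast
qed

text \<open>The last coordinate c of a lift satisfies c(ab) = c(a) + c(b) + \<alpha>(a) \<beta>(b),
  so f = -c has coboundary \<alpha>(a) \<beta>(b); conversely -f is a valid last coordinate. The
  sign comes from the convention for the coboundary.\<close>

lemma heisenberg_lift_iff:
  fixes G (structure)
  assumes p: "1 < p" and G: "topological_group G T"
    and \<alpha>: "\<alpha> \<in> discrete_hom G T (integer_mod_group p)" and \<beta>: "\<beta> \<in> discrete_hom G T (integer_mod_group p)"
  shows "(\<exists>f\<in>discrete_maps p G T. \<forall>a\<in>carrier G. \<forall>b\<in>carrier G.
        (f b - f (a \<otimes> b) + f a) mod int p = \<alpha> a * \<beta> b mod int p) \<longleftrightarrow>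
    (\<exists>h\<in>discrete_hom G T (heisenberg p). \<forall>g\<in>carrier G. fst (h g) = \<alpha> g \<and> fst (snd (h g)) = \<beta> g)"
    (is "?l \<longleftrightarrow> ?r")
proof
  interpret group G using G by (simp add: topological_group_def)
  have ab: "\<alpha> g \<in> {0..<int p}" "\<beta> g \<in> {0..<int p}" if "g \<in> carrier G" for g
    using that p discrete_homD(2)[OF \<alpha>] discrete_homD(2)[OF \<beta>] by (auto simp: carrier_integer_mod_group)
  assume ?l
  then obtain f where f: "f \<in> discrete_maps p G T" and
    eq: "\<And>a b. a \<in> carrier G \<Longrightarrow> b \<in> carrier G \<Longrightarrow> (f b - f (a \<otimes> b) + f a) mod int p = \<alpha> a * \<beta> b mod int p" by blast
  have "(\<lambda>g. (\<alpha> g, \<beta> g, (- f g) mod int p)) \<in> discrete_hom G T (heisenberg p)"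
  proof (rule discrete_homI)
    fix g h assume gh: "g \<in> carrier G" "h \<in> carrier G"
    have "(- f g + - f h + \<alpha> g * \<beta> h) mod int p = (- f g + - f h + (f h - f (g \<otimes> h) + f g)) mod int p"
      by (rule mod_add_cong) (simp_all add: eq[OF gh])
    also have "\<dots> = (- f (g \<otimes> h)) mod int p" by simp
    finally have "(- f g + - f h + \<alpha> g * \<beta> h) mod int p = (- f (g \<otimes> h)) mod int p" .
    moreover have "((- f g) mod int p + (- f h) mod int p + \<alpha> g * \<beta> h) mod int p = (- f g + - f h + \<alpha> g * \<beta> h) mod int p"
      by (intro mod_add_cong) simp_all
    ultimately show "(\<alpha> (g \<otimes> h), \<beta> (g \<otimes> h), - f (g \<otimes> h) mod int p) =
       (\<alpha> g, \<beta> g, - f g mod int p) \<otimes>\<^bsub>heisenberg p\<^esub> (\<alpha> h, \<beta> h, - f h mod int p)"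
      using discrete_homD(3)[OF \<alpha> gh] discrete_homD(3)[OF \<beta> gh] by simp
  next
    show "openin T {g \<in> carrier G. (\<alpha> g, \<beta> g, - f g mod int p) = x}" for x
      using discrete_homD(4)[OF \<alpha>] discrete_homD(4)[OF \<beta>] f
        openin_fibre_comp[of T "carrier G" f "\<lambda>x. - x mod int p"]
      by (intro openin_fibre_Pair) (auto simp: discrete_maps_def)
  qed (use ab p in auto)
  then show ?r by (intro bexI) auto
next
  interpret group G using G by (simp add: topological_group_def)
  assume ?r
  then obtain h where h: "h \<in> discrete_hom G T (heisenberg p)"
    "\<And>g. g \<in> carrier G \<Longrightarrow> fst (h g) = \<alpha> g \<and> fst (snd (h g)) = \<beta> g" by blast
  let ?k = "\<lambda>g. snd (snd (h g))"
  have k: "?k (a \<otimes> b) = (?k a + ?k b + \<alpha> a * \<beta> b) mod int p" if "a \<in> carrier G" "b \<in> carrier G" for a b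
    using discrete_homD(3)[OF h(1) that] h(2)[OF that(1)] h(2)[OF that(2)] by (simp add: mult_heisenberg)
  have "(\<lambda>g. (- ?k g) mod int p) \<in> discrete_maps p G T"
    using openin_fibre_comp[OF discrete_homD(4)[OF h(1)], of "\<lambda>x. (- snd (snd x)) mod int p"] p
    by (simp add: discrete_maps_def)
  moreover have "((- ?k b) mod int p - (- ?k (a \<otimes> b)) mod int p + (- ?k a) mod int p) mod int p = \<alpha> a * \<beta> b mod int p"
    if "a \<in> carrier G" "b \<in> carrier G" for a b
  proof -
    have "((- ?k b) mod int p - (- ?k (a \<otimes> b)) mod int p + (- ?k a) mod int p) mod int p =
        (- ?k b - (- (?k a + ?k b + \<alpha> a * \<beta> b)) + - ?k a) mod int p"
      unfolding k[OF that] by (intro mod_add_cong mod_diff_cong) (simp_all add: mod_simps)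
    then show ?thesis by simp
  qed
  ultimately show ?l by (intro bexI[of _ "\<lambda>g. (- ?k g) mod int p"]) auto
qed

text \<open>The unit of the degree-two cohomology group is the set of coboundaries. So each
  vanishing condition is triviality of one explicit class, which \<open>heisenberg_lift_iff\<close>
  turns into a lift.\<close>

lemma cup_radical_eq:
  assumes p: "1 < p" and G: "topological_group G T"
  shows "cup_radical p G T = (\<lambda>\<phi>. {homogeneous G \<phi>}) ` hom_radical p G T"
proof -
  let ?R = "residue_ring (int p)" and ?H = "discrete_hom G T (integer_mod_group p)"
  have one: "\<one>\<^bsub>cohomology ?R G T (1 + 1)\<^esub> = coboundaries ?R G T 2"
    by (simp add: cohomology_def numeral_2_eq_2)
  have iff: "cup ?R G T 1 1 {homogeneous G \<alpha>} {homogeneous G \<beta>} = \<one>\<^bsub>cohomology ?R G T (1 + 1)\<^esub> \<longleftrightarrow>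
      (\<exists>h\<in>discrete_hom G T (heisenberg p). \<forall>g\<in>carrier G. fst (h g) = \<alpha> g \<and> fst (snd (h g)) = \<beta> g)"
    if "\<alpha> \<in> ?H" "\<beta> \<in> ?H" for \<alpha> \<beta>
    unfolding one cup_1_1[OF p] heisenberg_lift_iff[OF p G that, symmetric]
    using p by (intro cochain_class_2_trivial_iff[OF p G]) simp
  have "cup_radical p G T = (\<lambda>\<phi>. {homogeneous G \<phi>}) ` {\<alpha> \<in> ?H. \<forall>\<beta>\<in>?H.
      cup ?R G T 1 1 {homogeneous G \<alpha>} {homogeneous G \<beta>} = \<one>\<^bsub>cohomology ?R G T (1 + 1)\<^esub>}"
    unfolding cup_radical_def Let_def cohomology_1[OF assms] by blast
  also have "{\<alpha> \<in> ?H. \<forall>\<beta>\<in>?H.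
      cup ?R G T 1 1 {homogeneous G \<alpha>} {homogeneous G \<beta>} = \<one>\<^bsub>cohomology ?R G T (1 + 1)\<^esub>} = hom_radical p G T"
    unfolding hom_radical_def by (intro Collect_cong conj_cong ball_cong HOL.refl iff)
  finally show ?thesis .
qed

section \<open>Corestriction and the Kijima--Nishi property\<close>

lemma topological_subgroup:
  assumes G: "topological_group G T" and U: "subgroup U G"
  shows "topological_group (G\<lparr>carrier := U\<rparr>) (subtopology T U)"
proof -
  have gr: "group G" and ts: "topspace T = carrier G"
    and m: "continuous_map (prod_topology T T) T (\<lambda>(x, y). x \<otimes>\<^bsub>G\<^esub> y)"
    and iv: "continuous_map T T (\<lambda>x. inv\<^bsub>G\<^esub> x)"
    using G by (auto simp: topological_group_def)
  have tU: "topspace (subtopology T U) = U" using subgroup.subset[OF U] ts by auto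
  have "continuous_map (prod_topology (subtopology T U) (subtopology T U)) (subtopology T U)
      (\<lambda>(x, y). x \<otimes>\<^bsub>G\<^esub> y)"
    using m subgroup.m_closed[OF U] tU unfolding subtopology_Times[symmetric] continuous_map_in_subtopology
    by (auto intro: continuous_map_from_subtopology)
  moreover have "continuous_map (subtopology T U) (subtopology T U) (\<lambda>x. inv\<^bsub>G\<^esub> x)"
    using iv subgroup.m_inv_closed[OF U] tU unfolding continuous_map_in_subtopology
    by (auto intro: continuous_map_from_subtopology)
  then have "continuous_map (subtopology T U) (subtopology T U) (\<lambda>x. inv\<^bsub>G\<lparr>carrier := U\<rparr>\<^esub> x)"
    by (rule continuous_map_eq) (simp add: tU group.m_inv_consistent[OF gr U])
  ultimately show ?thesis
    using tU subgroup.subgroup_is_group[OF U gr] by (simp add: topological_group_def)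
qed

section \<open>Cosets of a kernel and the transfer\<close>

locale section_hom =
  fixes p :: nat and G :: "('a, 'b) monoid_scheme" (structure) and T :: "'a topology"
    and \<kappa> :: "'a \<Rightarrow> int" and s :: "int \<Rightarrow> 'a"
  assumes p: "1 < p" and top_G: "topological_group G T"
    and \<kappa>: "\<kappa> \<in> discrete_hom G T (integer_mod_group p)" and s: "section_of p G \<kappa> s"
begin

abbreviation U where "U \<equiv> zero_fibre G \<kappa>"
abbreviation fibre where "fibre j \<equiv> {g \<in> carrier G. \<kappa> g = j}"

sublocale group G using top_G by (simp add: topological_group_def)

sublocale \<kappa>: group_hom G "integer_mod_group p" \<kappa>
  using discrete_homD(1)[OF \<kappa>] by (simp add: group_hom_def group_hom_axioms_def is_group)

lemma \<kappa>_range: "g \<in> carrier G \<Longrightarrow> \<kappa> g \<in> {0..<int p}"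
  using \<kappa>.hom_closed p by (auto simp: carrier_integer_mod_group)

lemma \<kappa>_mult: "g \<in> carrier G \<Longrightarrow> h \<in> carrier G \<Longrightarrow> \<kappa> (g \<otimes> h) = (\<kappa> g + \<kappa> h) mod int p"
  by simp

lemma \<kappa>_inv: "g \<in> carrier G \<Longrightarrow> \<kappa> (inv g) = (- \<kappa> g) mod int p"
  using \<kappa>.hom_closed by simp

lemma section_closed: "j \<in> {0..<int p} \<Longrightarrow> s j \<in> carrier G"
  and section_val: "j \<in> {0..<int p} \<Longrightarrow> \<kappa> (s j) = j"
  using s by (auto simp: section_of_def)

lemma U_kernel: "U = kernel G (integer_mod_group p) \<kappa>"
  by (auto simp: zero_fibre_def kernel_def)

lemma normal_U: "U \<lhd> G"
  unfolding U_kernel by (rule \<kappa>.normal_kernel)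

lemma subgroup_U: "subgroup U G"
  using normal_U normal_imp_subgroup by blast

lemma openin_U: "openin T U"
  using discrete_homD(4)[OF \<kappa>] by (simp add: zero_fibre_def)

lemma topological_group_U: "topological_group (G\<lparr>carrier := U\<rparr>) (subtopology T U)"
  using topological_subgroup[OF top_G subgroup_U] .

lemma mod_mem: "x mod int p \<in> {0..<int p}"
  using p by simp

lemma quotient_in_U:
  assumes "g \<in> carrier G" "h \<in> carrier G" "\<kappa> g = \<kappa> h"
  shows "g \<otimes> inv h \<in> U"
  using assms p by (simp add: zero_fibre_def \<kappa>_inv \<kappa>_mult mod_add_right_eq del: \<kappa>.hom_mult \<kappa>.hom_inv)

text \<open>Numbers the right cosets by the values of \<open>\<kappa>\<close>, so that sums over
  cosets become sums over residues.\<close>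

lemma r_coset_U:
  assumes "g \<in> carrier G"
  shows "U #> g = fibre (\<kappa> g)"
proof (intro equalityI subsetI)
  fix x assume "x \<in> U #> g"
  then obtain u where u: "u \<in> carrier G" "\<kappa> u = 0" "x = u \<otimes> g"
    by (auto simp: r_coset_def zero_fibre_def)
  then show "x \<in> fibre (\<kappa> g)"
    using assms \<kappa>_range[OF assms] by (simp add: \<kappa>_mult)
next
  fix x assume "x \<in> fibre (\<kappa> g)"
  then have x: "x \<in> carrier G" "\<kappa> x = \<kappa> g" by auto
  then have "x \<otimes> inv g \<in> U" "x = (x \<otimes> inv g) \<otimes> g"
    using quotient_in_U assms by (simp_all add: m_assoc)
  then show "x \<in> U #> g" unfolding r_coset_def by blast
qed

lemma rcosets_U: "rcosets U = fibre ` {0..<int p}"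
proof -
  have "rcosets U = (\<lambda>g. fibre (\<kappa> g)) ` carrier G"
    by (auto simp: RCOSETS_def r_coset_U)
  also have "\<dots> = fibre ` (\<kappa> ` carrier G)" by (simp add: image_image)
  also have "\<kappa> ` carrier G = {0..<int p}"
  proof
    show "\<kappa> ` carrier G \<subseteq> {0..<int p}" using \<kappa>_range by blast
    show "{0..<int p} \<subseteq> \<kappa> ` carrier G"
    proof
      fix j assume "j \<in> {0..<int p}"
      then show "j \<in> \<kappa> ` carrier G" by (intro image_eqI[of _ _ "s j"]) (simp_all add: section_val section_closed)
    qed
  qed
  finally show ?thesis .
qed

lemma inj_fibre: "inj_on fibre {0..<int p}"
proof (rule inj_onI)
  fix i j assume i: "i \<in> {0..<int p}" and eq: "fibre i = fibre j"
  have "s i \<in> fibre i" using section_closed[OF i] section_val[OF i] by simp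
  then have "s i \<in> fibre j" unfolding eq .
  then show "i = j" using section_val[OF i] by simp
qed

lemma card_rcosets_U: "card (rcosets U) = p"
  unfolding rcosets_U using inj_fibre by (simp add: card_image)

text \<open>The representatives chosen in the definition of corestriction form a section of their
  own, which is why independence of the section is required below.\<close>

lemma section_coset_rep: "section_of p G \<kappa> (\<lambda>j. coset_rep (fibre j))"
proof -
  have "coset_rep (fibre j) \<in> fibre j" if "j \<in> {0..<int p}" for j
    unfolding coset_rep_def by (rule someI[of _ "s j"]) (use that section_closed section_val in blast)
  then show ?thesis by (auto simp: section_of_def)
qed

text \<open>Right translation by \<open>g\<close> shifts the number of a coset by
  \<open>\<kappa> g\<close>; this is the shift built into \<open>transfer\<close> and
  \<open>wreath\<close>.\<close>

lemma fibre_r_coset: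
  assumes "j \<in> {0..<int p}" "g \<in> carrier G"
  shows "fibre j #> g = fibre ((j + \<kappa> g) mod int p)"
proof -
  have "fibre j #> g = U #> s j #> g"
    using r_coset_U[OF section_closed[OF assms(1)]] section_val[OF assms(1)] by simp
  also have "\<dots> = U #> (s j \<otimes> g)"
    using assms section_closed subgroup.subset[OF subgroup_U] by (simp add: coset_mult_assoc)
  finally show ?thesis
    using assms section_closed section_val by (simp add: r_coset_U)
qed

text \<open>The values at \<open>s j (s' j)\<^sup>-\<^sup>1\<close> by which two transfers differ cancel in the sum.\<close>

lemma transfer_section_indep:
  assumes s': "section_of p G \<kappa> s'" and \<phi>: "\<phi> \<in> hom (G\<lparr>carrier := U\<rparr>) (integer_mod_group p)"
    and g: "g \<in> carrier G"
  shows "transfer p G \<kappa> s \<phi> g = transfer p G \<kappa> s' \<phi> g"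
proof -
  let ?J = "{0..<int p}" and ?k = "\<lambda>j. (j + \<kappa> g) mod int p"
  have s'c: "s' j \<in> carrier G" "\<kappa> (s' j) = j" if "j \<in> ?J" for j
    using s' that by (auto simp: section_of_def)
  have \<phi>m: "\<phi> (u \<otimes> v) = (\<phi> u + \<phi> v) mod int p" if "u \<in> U" "v \<in> U" for u v
    using \<phi> that by (simp add: hom_def)
  have \<phi>1: "\<phi> \<one> = 0"
    using hom_one[OF \<phi> subgroup.subgroup_is_group[OF subgroup_U is_group]] by simp
  \<comment> \<open>Both representatives lie in the same coset, so the argument is in the kernel and
    \<open>\<phi>\<close> is defined on it.\<close>
  define d where "d j = \<phi> (s j \<otimes> inv (s' j))" for j
  have e: "\<phi> (s j \<otimes> g \<otimes> inv s (?k j)) mod int p =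
      (d j + \<phi> (s' j \<otimes> g \<otimes> inv s' (?k j)) - d (?k j)) mod int p" if j: "j \<in> ?J" for j
  proof -
    have k: "?k j \<in> ?J" by (rule mod_mem)
    note c = section_closed[OF j] section_closed[OF k] s'c(1)[OF j] s'c(1)[OF k] g
    have a: "s j \<otimes> inv (s' j) \<in> U" "s (?k j) \<otimes> inv (s' (?k j)) \<in> U" "s' (?k j) \<otimes> inv (s (?k j)) \<in> U"
      using c j k section_val s'c(2) by (auto intro!: quotient_in_U)
    have b: "s' j \<otimes> g \<otimes> inv s' (?k j) \<in> U"
      using c j k s'c(2) by (intro quotient_in_U) (auto simp: \<kappa>_mult)
    have can: "inv x \<otimes> (x \<otimes> y) = y" if "x \<in> carrier G" "y \<in> carrier G" for x y
      using that by (simp flip: m_assoc)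
    \<comment> \<open>All three factors lie in the kernel, where \<open>\<phi>\<close> is additive.
      The last one is inverse to the element that defines \<open>d (?k j)\<close> and thus
      contributes \<open>- d (?k j)\<close>.\<close>
    have "s j \<otimes> g \<otimes> inv s (?k j) = (s j \<otimes> inv s' j) \<otimes> (s' j \<otimes> g \<otimes> inv s' (?k j)) \<otimes> (s' (?k j) \<otimes> inv s (?k j))"
      using c by (simp add: m_assoc can)
    then have "\<phi> (s j \<otimes> g \<otimes> inv s (?k j)) =
        ((d j + \<phi> (s' j \<otimes> g \<otimes> inv s' (?k j))) mod int p + \<phi> (s' (?k j) \<otimes> inv s (?k j))) mod int p"
      using a b subgroup.m_closed[OF subgroup_U] by (simp add: \<phi>m d_def)
    moreover have "(d (?k j) + \<phi> (s' (?k j) \<otimes> inv s (?k j))) mod int p = 0"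
    proof -
      have "(s (?k j) \<otimes> inv s' (?k j)) \<otimes> (s' (?k j) \<otimes> inv s (?k j)) = \<one>"
        using c by (simp add: m_assoc can)
      then show ?thesis using \<phi>m[OF a(2,3)] \<phi>1 by (simp add: d_def)
    qed
    then have "(- d (?k j) + (d (?k j) + \<phi> (s' (?k j) \<otimes> inv s (?k j)))) mod int p = (- d (?k j) + 0) mod int p"
      by (intro mod_add_cong) simp_all
    then have "\<phi> (s' (?k j) \<otimes> inv s (?k j)) mod int p = (- d (?k j)) mod int p"
      by simp
    then have "((d j + \<phi> (s' j \<otimes> g \<otimes> inv s' (?k j))) mod int p + \<phi> (s' (?k j) \<otimes> inv s (?k j))) mod int p =
        (d j + \<phi> (s' j \<otimes> g \<otimes> inv s' (?k j)) + - d (?k j)) mod int p"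
      by (intro mod_add_cong) simp_all
    ultimately show ?thesis by simp
  qed
  have "transfer p G \<kappa> s \<phi> g = (\<Sum>j\<in>?J. \<phi> (s j \<otimes> g \<otimes> inv s (?k j)) mod int p) mod int p"
    unfolding transfer_def by (rule mod_sum_eq[symmetric])
  also have "\<dots> = (\<Sum>j\<in>?J. (d j + \<phi> (s' j \<otimes> g \<otimes> inv s' (?k j)) - d (?k j)) mod int p) mod int p"
    using e by simp
  also have "\<dots> = (\<Sum>j\<in>?J. d j + \<phi> (s' j \<otimes> g \<otimes> inv s' (?k j)) - d (?k j)) mod int p"
    by (rule mod_sum_eq)
  also have "(\<Sum>j\<in>?J. d j + \<phi> (s' j \<otimes> g \<otimes> inv s' (?k j)) - d (?k j)) = (\<Sum>j\<in>?J. \<phi> (s' j \<otimes> g \<otimes> inv s' (?k j)))"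
    using sum_add_mod[of p d "\<kappa> g"] p by (simp add: sum.distrib sum_subtractf)
  finally show ?thesis by (simp add: transfer_def)
qed

text \<open>The summand of coset \<open>j\<close> is \<open>\<phi>\<close> at
  \<open>inv a \<otimes> b\<close>, where \<open>a\<close> and \<open>b\<close> are the Schreier
  elements of \<open>t 0\<close> and \<open>t 1\<close>. The representative of \<open>j\<close>
  cancels, leaving the Schreier element of \<open>inv (t 0) \<otimes> t 1\<close> at the coset
  \<open>j + \<kappa> (t 0)\<close>; shifting the summation index gives the transfer.\<close>

lemma corestriction_1:
  assumes \<phi>: "\<phi> \<in> discrete_hom (G\<lparr>carrier := U\<rparr>) (subtopology T U) (integer_mod_group p)"
  shows "corestriction (residue_ring (int p)) G T U 1 {homogeneous (G\<lparr>carrier := U\<rparr>) \<phi>} =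
    {homogeneous G (transfer p G \<kappa> s \<phi>)}"
proof -
  let ?R = "residue_ring (int p)" and ?x = "homogeneous (G\<lparr>carrier := U\<rparr>) \<phi>"
  let ?J = "{0..<int p}" and ?c = "\<lambda>j. coset_rep (fibre j)"
  interpret R: residues "int p" ?R
    using p by unfold_locales auto
  have c: "?c j \<in> carrier G" "\<kappa> (?c j) = j" if "j \<in> ?J" for j
    using section_coset_rep that by (auto simp: section_of_def)
  have "cor_cochain ?R G U 1 ?x t = homogeneous G (transfer p G \<kappa> ?c \<phi>) t" if t: "t \<in> tuples G 1" for t
  proof -
    let ?f = "\<lambda>b. ?x (\<lambda>i\<in>{..1}. coset_rep b \<otimes> t i \<otimes> inv (coset_rep (b #> t i)))"
    have tc: "t 0 \<in> carrier G" "t 1 \<in> carrier G"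
      using tuples_mem[OF t, of 0] tuples_mem[OF t, of 1] by simp_all
    define g where "g = inv t 0 \<otimes> t 1"
    have g: "g \<in> carrier G" "t 0 \<otimes> g = t 1"
      using tc by (simp_all add: g_def flip: m_assoc)
    have val: "?f (fibre j) = \<phi> (?c ((j + \<kappa> (t 0)) mod int p) \<otimes> g \<otimes>
        inv ?c (((j + \<kappa> (t 0)) mod int p + \<kappa> g) mod int p))" if j: "j \<in> ?J" for j
    proof -
      let ?k = "(j + \<kappa> (t 0)) mod int p" and ?l = "(j + \<kappa> (t 1)) mod int p"
      have kl: "?k \<in> ?J" "?l \<in> ?J" by (rule mod_mem)+
      have l: "(?k + \<kappa> g) mod int p = ?l"
        using \<kappa>_mult[OF tc(1) g(1)] g(2) by (simp add: mod_simps add.assoc)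
      let ?a = "?c j \<otimes> t 0 \<otimes> inv ?c ?k" and ?b = "?c j \<otimes> t 1 \<otimes> inv ?c ?l"
      have ab: "?a \<in> U" "?b \<in> U"
        using c[OF j] c[OF kl(1)] c[OF kl(2)] tc by (auto intro!: quotient_in_U simp: \<kappa>_mult)
      let ?r = "\<lambda>i\<in>{..1}. ?c j \<otimes> t i \<otimes> inv (coset_rep (fibre j #> t i))"
      have r: "?r 0 = ?a" "?r 1 = ?b"
        using fibre_r_coset[OF j] tc by simp_all
      have rU: "?r i \<in> U" if "i \<in> {..1}" for i using that r ab by (cases i) auto
      have "?r \<in> tuples (G\<lparr>carrier := U\<rparr>) 1"
        unfolding tuples_def by (rule PiE_I) (use rU in simp_all)
      then have "?x ?r = \<phi> (inv\<^bsub>G\<lparr>carrier := U\<rparr>\<^esub> (?r 0) \<otimes> ?r 1)"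
        unfolding homogeneous_def by (simp only: restrict_apply if_True) simp
      also have "\<dots> = \<phi> (inv ?a \<otimes> ?b)"
        unfolding r using m_inv_consistent[OF subgroup_U ab(1)] by simp
      also have "inv ?a \<otimes> ?b = ?c ?k \<otimes> g \<otimes> inv ?c ?l"
      proof -
        have can: "inv x \<otimes> (x \<otimes> y) = y" if "x \<in> carrier G" "y \<in> carrier G" for x y
          using that by (simp flip: m_assoc)
        show ?thesis
          using c(1)[OF j] c(1)[OF kl(1)] c(1)[OF kl(2)] tc
          by (simp add: g_def inv_mult_group m_assoc can)
      qed
      finally show ?thesis unfolding l .
    qed
    have "?f (fibre j) \<in> {0..<int p}" if j: "j \<in> ?J" for j
    proof -
      let ?k = "(j + \<kappa> (t 0)) mod int p"
      have "?c ?k \<otimes> g \<otimes> inv ?c ((?k + \<kappa> g) mod int p) \<in> U"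
        using c[OF mod_mem] g by (intro quotient_in_U) (auto simp: \<kappa>_mult)
      then show ?thesis
        unfolding val[OF j] using discrete_homD(2)[OF \<phi>] p by (simp add: carrier_integer_mod_group)
    qed
    then have fm: "?f b mod int p = ?f b \<and> ?f b \<in> carrier ?R" if "b \<in> rcosets U" for b
      using that unfolding rcosets_U by (auto simp: residue_ring_simps)
    have fin: "finite (rcosets U)" unfolding rcosets_U by simp
    \<comment> \<open>The summands are already reduced, so \<open>mod\<close> may be inserted; in
      this form the ring sum becomes an integer sum reduced once.\<close>
    have "(\<Oplus>\<^bsub>?R\<^esub>b\<in>rcosets U. ?f b) = (\<Oplus>\<^bsub>?R\<^esub>b\<in>rcosets U. ?f b mod int p)"
      using fm by (intro R.finsum_cong') auto
    also have "\<dots> = (\<Sum>b\<in>rcosets U. ?f b) mod int p" by (rule R.sum_cong[OF fin])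
    also have "(\<Sum>b\<in>rcosets U. ?f b) = (\<Sum>j\<in>?J. ?f (fibre j))"
      unfolding rcosets_U using inj_fibre by (simp add: sum.reindex)
    also have "\<dots> = (\<Sum>j\<in>?J. \<phi> (?c ((j + \<kappa> (t 0)) mod int p) \<otimes> g \<otimes>
        inv ?c (((j + \<kappa> (t 0)) mod int p + \<kappa> g) mod int p)))"
      using val by (rule sum.cong[OF HOL.refl])
    also have "\<dots> = (\<Sum>j\<in>?J. \<phi> (?c j \<otimes> g \<otimes> inv ?c ((j + \<kappa> g) mod int p)))"
      using p by (intro sum_add_mod) simp
    finally have "(\<Oplus>\<^bsub>?R\<^esub>b\<in>rcosets U. ?f b) = transfer p G \<kappa> ?c \<phi> g"
      by (simp only: transfer_def)
    moreover have "cor_cochain ?R G U 1 ?x t = (\<Oplus>\<^bsub>?R\<^esub>b\<in>rcosets U. ?f b)"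
      unfolding cor_cochain_def using t by (simp only: restrict_apply if_True)
    moreover have "homogeneous G (transfer p G \<kappa> ?c \<phi>) t = transfer p G \<kappa> ?c \<phi> g"
      unfolding homogeneous_def g_def using t by (simp only: restrict_apply if_True)
    ultimately show ?thesis by simp
  qed
  then have cor: "cor_cochain ?R G U 1 ?x = homogeneous G (transfer p G \<kappa> ?c \<phi>)"
    by (intro extensionalityI[of _ "tuples G 1"]) (auto simp: cor_cochain_def homogeneous_def)
  also have "\<dots> = homogeneous G (transfer p G \<kappa> s \<phi>)"
    unfolding homogeneous_eq_iff[OF is_group]
    using transfer_section_indep[OF section_coset_rep discrete_homD(1)[OF \<phi>]] by simp
  finally have "cor_cochain ?R G U 1 ?x = homogeneous G (transfer p G \<kappa> s \<phi>)" .
  moreover have "cochain_class ?R G T 1 (homogeneous G (transfer p G \<kappa> s \<phi>)) = {homogeneous G (transfer p G \<kappa> s \<phi>)}"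
    using p by (intro cochain_class_1 top_G) (auto simp: transfer_def)
  ultimately show ?thesis by (simp add: corestriction_def)
qed

end

section \<open>Open normal subgroups of index p as kernels\<close>

text \<open>The quotient has prime order, so any non-trivial coset generates it, and the exponent of
  a coset with respect to that generator serves as \<open>\<kappa>\<close>. Its fibres are unions of
  translates of the open subgroup.\<close>

lemma index_p_kernel:
  fixes G (structure)
  assumes p: "prime p" and G: "topological_group G T" and U: "U \<lhd> G" and op: "openin T U"
    and idx: "card (rcosets U) = p"
  obtains \<kappa> s where "\<kappa> \<in> discrete_hom G T (integer_mod_group p)" "section_of p G \<kappa> s" "zero_fibre G \<kappa> = U"
proof -
  interpret U: normal U G by fact
  have ts: "topspace T = carrier G" using G by (simp add: topological_group_def)
  have p1: "1 < p" using p prime_gt_1_nat by blast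
  let ?Q = "G Mod U"
  interpret Q: group ?Q by (rule U.factorgroup_is_group)
  have cQ: "card (carrier ?Q) = p" using idx by (simp add: FactGroup_def)
  then have fQ: "finite (carrier ?Q)" using p1 by (metis card.infinite not_one_less_zero)
  have "carrier ?Q \<noteq> {\<one>\<^bsub>?Q\<^esub>}" using cQ p1 by auto
  then obtain x where x: "x \<in> carrier ?Q" "x \<noteq> \<one>\<^bsub>?Q\<^esub>" using Q.one_closed by blast
  have "Q.ord x dvd p" using Q.ord_dvd_group_order[OF x(1)] cQ by (simp add: order_def)
  then have ord: "Q.ord x = p"
    using p x Q.ord_eq_1[OF x(1)] by (auto simp: prime_nat_iff)
  let ?e = "\<lambda>k::nat. x [^]\<^bsub>?Q\<^esub> k"
  have "{0..p - 1} = {..<p}" using p1 by auto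
  then have inj: "inj_on ?e {..<p}" using Q.ord_inj[OF x(1)] ord by simp
  have surj: "?e ` {..<p} = carrier ?Q"
    using fQ x(1) cQ inj by (intro card_subset_eq) (auto simp: card_image)
  \<comment> \<open>Exponents count only mod p, so the exponent of a product is the sum reduced mod
    p, as in \<open>integer_mod_group p\<close>.\<close>
  have per: "?e (k mod p) = ?e k" for k
  proof -
    have "?e k = ?e (p * (k div p) + k mod p)" by simp
    also have "\<dots> = (?e p) [^]\<^bsub>?Q\<^esub> (k div p) \<otimes>\<^bsub>?Q\<^esub> ?e (k mod p)"
      using x(1) by (simp only: Q.nat_pow_mult Q.nat_pow_pow)
    also have "?e p = \<one>\<^bsub>?Q\<^esub>" using Q.pow_ord_eq_1[OF x(1)] ord by simp
    finally show ?thesis using x(1) by (simp del: one_FactGroup mult_FactGroup)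
  qed
  \<comment> \<open>The discrete logarithm to the base \<open>x\<close>, with values below
    \<open>p\<close>.\<close>
  define n where "n c = inv_into {..<p} ?e c" for c
  have n: "n c < p" "?e (n c) = c" if "c \<in> carrier ?Q" for c
    using that inv_into_into[of c ?e "{..<p}"] f_inv_into_f[of c ?e "{..<p}"]
    by (auto simp: n_def surj)
  have ne: "n (?e k) = k mod p" for k
  proof -
    have "k mod p \<in> {..<p}" using p1 by simp
    then have "n (?e (k mod p)) = k mod p" unfolding n_def by (rule inv_into_f_f[OF inj])
    then show ?thesis by (simp only: per)
  qed
  define \<kappa> where "\<kappa> g = int (n (U #> g))" for g
  have cos: "U #> g \<in> carrier ?Q" if "g \<in> carrier G" for g
    using that by (simp add: carrier_FactGroup)
  have \<kappa>: "\<kappa> \<in> discrete_hom G T (integer_mod_group p)"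
  proof (rule discrete_homI)
    show "\<kappa> g \<in> carrier (integer_mod_group p)" if "g \<in> carrier G" for g
      using n(1)[OF cos[OF that]] p1 by (simp add: \<kappa>_def carrier_integer_mod_group)
    show "\<kappa> (g \<otimes> h) = \<kappa> g \<otimes>\<^bsub>integer_mod_group p\<^esub> \<kappa> h" if "g \<in> carrier G" "h \<in> carrier G" for g h
    proof -
      have "U #> (g \<otimes> h) = (U #> g) \<otimes>\<^bsub>?Q\<^esub> (U #> h)" using that U.rcos_sum by simp
      also have "\<dots> = ?e (n (U #> g)) \<otimes>\<^bsub>?Q\<^esub> ?e (n (U #> h))"
        by (simp only: n(2)[OF cos[OF that(1)]] n(2)[OF cos[OF that(2)]])
      also have "\<dots> = ?e (n (U #> g) + n (U #> h))"
        using x(1) by (rule Q.nat_pow_mult)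
      finally have "n (U #> (g \<otimes> h)) = (n (U #> g) + n (U #> h)) mod p" by (simp only: ne)
      then show ?thesis by (simp add: \<kappa>_def zmod_int)
    qed
    have "openin T {g \<in> carrier G. U #> g = c}" for c
    proof (cases "\<exists>h\<in>carrier G. c = U #> h")
      case True
      then obtain h where h: "h \<in> carrier G" "c = U #> h" by auto
      have "continuous_map T T (\<lambda>g. \<one> \<otimes> g \<otimes> inv h)"
        using h by (intro topological_group_translation G) auto
      then have "openin T {g \<in> topspace T. \<one> \<otimes> g \<otimes> inv h \<in> U}"
        using op by (rule openin_continuous_map_preimage)
      moreover have "U #> g = c \<longleftrightarrow> \<one> \<otimes> g \<otimes> inv h \<in> U" if "g \<in> carrier G" for g
        using U.r_coset_eq_iff[OF U.is_subgroup that h(1)] h that by simp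
      then have "{g \<in> topspace T. \<one> \<otimes> g \<otimes> inv h \<in> U} = {g \<in> carrier G. U #> g = c}"
        unfolding ts by blast
      ultimately show ?thesis by simp
    next
      case False
      then have "{g \<in> carrier G. U #> g = c} = {}" by auto
      then show ?thesis by (metis (lifting) openin_empty)
    qed
    then show "openin T {g \<in> carrier G. \<kappa> g = y}" for y
      unfolding \<kappa>_def by (rule openin_fibre_comp)
  qed
  have "\<exists>g\<in>carrier G. \<kappa> g = j" if j: "j \<in> {0..<int p}" for j
  proof -
    have "?e (nat j) \<in> carrier ?Q" using x(1) by simp
    then obtain g where g: "g \<in> carrier G" "U #> g = ?e (nat j)" by (auto simp: carrier_FactGroup)
    moreover have "nat j < p" using j by auto
    ultimately have "\<kappa> g = j" using j ne[of "nat j"] by (simp add: \<kappa>_def)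
    then show ?thesis using g(1) by blast
  qed
  then have "\<exists>s. \<forall>j\<in>{0..<int p}. s j \<in> carrier G \<and> \<kappa> (s j) = j" by metis
  then obtain s where s: "section_of p G \<kappa> s" unfolding section_of_def by blast
  have "\<kappa> g = 0 \<longleftrightarrow> g \<in> U" if g: "g \<in> carrier G" for g
  proof
    assume "\<kappa> g = 0"
    then have "n (U #> g) = 0" by (simp add: \<kappa>_def)
    then have "U #> g = ?e 0" using n(2)[OF cos[OF g]] by metis
    then show "g \<in> U" using U.coset_join1[OF _ g U.is_subgroup] by simp
  next
    assume "g \<in> U"
    then have "U #> g = ?e 0" using U.coset_join2[OF g U.is_subgroup] by simp
    then have "n (U #> g) = 0 mod p" using ne[of 0] by (simp only:)
    then show "\<kappa> g = 0" by (simp add: \<kappa>_def)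
  qed
  then have "zero_fibre G \<kappa> = U" using U.subset by (auto simp: zero_fibre_def)
  then show thesis using that \<kappa> s by blast
qed

text \<open>A surjection with a section takes the place of the subgroup of index p: unlike the
  subgroup, it can be restricted to a factor and extended from one.\<close>

definition hom_kijima_nishi :: "nat \<Rightarrow> ('a, 'b) monoid_scheme \<Rightarrow> 'a topology \<Rightarrow> bool" where
  "hom_kijima_nishi p G T \<longleftrightarrow>
     (\<forall>\<kappa>\<in>discrete_hom G T (integer_mod_group p). \<forall>s. section_of p G \<kappa> s \<longrightarrow>
       (\<forall>\<alpha>\<in>hom_radical p G T.
         \<exists>\<phi>\<in>hom_radical p (G\<lparr>carrier := zero_fibre G \<kappa>\<rparr>) (subtopology T (zero_fibre G \<kappa>)).
           \<forall>g\<in>carrier G. \<alpha> g = transfer p G \<kappa> s \<phi> g))"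

text \<open>Degree-one classes are singletons, so equality of classes is equality of homomorphisms
  on the carrier. Kernels of surjections to C_p with open fibres and open normal subgroups of index
  p are the same sets.\<close>

lemma kijima_nishi_iff:
  assumes p: "prime p" and G: "topological_group G T"
  shows "kijima_nishi p G T \<longleftrightarrow> hom_kijima_nishi p G T"
proof
  have p1: "1 < p" using p prime_gt_1_nat by blast
  have gr: "group G" using G by (simp add: topological_group_def)
  have rad: "\<phi> \<in> discrete_hom (G\<lparr>carrier := V\<rparr>) (subtopology T V) (integer_mod_group p)"
    if "\<phi> \<in> hom_radical p (G\<lparr>carrier := V\<rparr>) (subtopology T V)" for \<phi> V
    using that by (simp add: hom_radical_def)
  {
    assume KN: "kijima_nishi p G T"
    show "hom_kijima_nishi p G T"
      unfolding hom_kijima_nishi_def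
    proof (intro ballI allI impI)
      fix \<kappa> s \<alpha> assume \<kappa>: "\<kappa> \<in> discrete_hom G T (integer_mod_group p)" and s: "section_of p G \<kappa> s"
        and \<alpha>: "\<alpha> \<in> hom_radical p G T"
      interpret section_hom p G T \<kappa> s by unfold_locales (fact p1 G \<kappa> s)+
      have "{homogeneous G \<alpha>} \<in> cup_radical p G T"
        using \<alpha> unfolding cup_radical_eq[OF p1 G] by blast
      then have "{homogeneous G \<alpha>} \<in> corestriction (residue_ring (int p)) G T U 1 `
          cup_radical p (G\<lparr>carrier := U\<rparr>) (subtopology T U)"
        using KN normal_U openin_U card_rcosets_U unfolding kijima_nishi_def by blast
      then obtain \<phi> where \<phi>: "\<phi> \<in> hom_radical p (G\<lparr>carrier := U\<rparr>) (subtopology T U)"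
        "{homogeneous G \<alpha>} = corestriction (residue_ring (int p)) G T U 1 {homogeneous (G\<lparr>carrier := U\<rparr>) \<phi>}"
        unfolding cup_radical_eq[OF p1 topological_group_U] by blast
      then have "homogeneous G \<alpha> = homogeneous G (transfer p G \<kappa> s \<phi>)"
        using corestriction_1[OF rad[OF \<phi>(1)]] by simp
      then show "\<exists>\<phi>\<in>hom_radical p (G\<lparr>carrier := U\<rparr>) (subtopology T U).
          \<forall>g\<in>carrier G. \<alpha> g = transfer p G \<kappa> s \<phi> g"
        using \<phi>(1) unfolding homogeneous_eq_iff[OF gr] by blast
    qed
  next
    assume KN: "hom_kijima_nishi p G T"
    show "kijima_nishi p G T"
      unfolding kijima_nishi_def
    proof (intro allI impI subsetI)
      fix V x assume V: "V \<lhd> G \<and> openin T V \<and> card (rcosets\<^bsub>G\<^esub> V) = p" and x: "x \<in> cup_radical p G T"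
      obtain \<kappa> s where \<kappa>: "\<kappa> \<in> discrete_hom G T (integer_mod_group p)" and s: "section_of p G \<kappa> s"
        and VU: "zero_fibre G \<kappa> = V"
        using index_p_kernel[OF p G] V by blast
      interpret section_hom p G T \<kappa> s by unfold_locales (fact p1 G \<kappa> s)+
      obtain \<alpha> where \<alpha>: "\<alpha> \<in> hom_radical p G T" "x = {homogeneous G \<alpha>}"
        using x unfolding cup_radical_eq[OF p1 G] by blast
      obtain \<phi> where \<phi>: "\<phi> \<in> hom_radical p (G\<lparr>carrier := U\<rparr>) (subtopology T U)"
        "\<forall>g\<in>carrier G. \<alpha> g = transfer p G \<kappa> s \<phi> g"
        using KN \<kappa> s \<alpha>(1) unfolding hom_kijima_nishi_def by blast
      have "x = corestriction (residue_ring (int p)) G T U 1 {homogeneous (G\<lparr>carrier := U\<rparr>) \<phi>}"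
        unfolding \<alpha>(2) corestriction_1[OF rad[OF \<phi>(1)]] using \<phi>(2) homogeneous_eq_iff[OF gr] by blast
      then show "x \<in> corestriction (residue_ring (int p)) G T V 1 `
          cup_radical p (G\<lparr>carrier := V\<rparr>) (subtopology T V)"
        using \<phi>(1) unfolding VU[symmetric] cup_radical_eq[OF p1 topological_group_U] by blast
    qed
  }
qed

section \<open>Lifting problems\<close>

lemma discrete_hom_const_one:
  assumes "topological_group G T" "group P"
  shows "(\<lambda>_. \<one>\<^bsub>P\<^esub>) \<in> discrete_hom G T P"
proof (rule discrete_homI)
  have "{g \<in> carrier G. \<one>\<^bsub>P\<^esub> = x} = (if \<one>\<^bsub>P\<^esub> = x then topspace T else {})" for x
    using assms(1) by (auto simp: topological_group_def)
  then show "openin T {g \<in> carrier G. \<one>\<^bsub>P\<^esub> = x}" for x by simp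
qed (use group.is_monoid[OF assms(2)] in simp_all)

lemma discrete_hom_cong:
  assumes "f \<in> discrete_hom G T P" "group G" "\<And>g. g \<in> carrier G \<Longrightarrow> f g = f' g"
  shows "f' \<in> discrete_hom G T P"
proof (rule discrete_homI)
  show "openin T {g \<in> carrier G. f' g = x}" for x
    using discrete_homD(4)[OF assms(1), of x] assms(3) by (simp cong: conj_cong)
qed (use discrete_homD(2,3)[OF assms(1)] assms(3) group.is_monoid[OF assms(2)] monoid.m_closed in \<open>metis+\<close>)

abbreviation heisenberg_abel :: "int \<times> int \<times> int \<Rightarrow> int \<times> int" where
  "heisenberg_abel x \<equiv> (fst x, fst (snd x))"

lemma heisenberg_abel_hom:
  "heisenberg_abel \<in> hom (heisenberg p) (integer_mod_group p \<times>\<times> integer_mod_group p)"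
  by (auto simp: hom_def DirProd_def carrier_integer_mod_group)

lemma discrete_hom_Pair:
  assumes "f \<in> discrete_hom G T P" "h \<in> discrete_hom G T Q"
  shows "(\<lambda>g. (f g, h g)) \<in> discrete_hom G T (P \<times>\<times> Q)"
  using discrete_homD(2,3)[OF assms(1)] discrete_homD(2,3)[OF assms(2)]
    openin_fibre_Pair[OF discrete_homD(4)[OF assms(1)] discrete_homD(4)[OF assms(2)]]
  by (intro discrete_homI) (simp_all add: DirProd_def)

lemma hom_radicalI:
  assumes "\<alpha> \<in> discrete_hom G T (integer_mod_group p)"
    and "\<And>\<beta>. \<beta> \<in> discrete_hom G T (integer_mod_group p) \<Longrightarrow>
      \<exists>h\<in>discrete_hom G T (heisenberg p). \<forall>g\<in>carrier G. heisenberg_abel (h g) = (\<alpha> g, \<beta> g)"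
  shows "\<alpha> \<in> hom_radical p G T"
  using assms unfolding hom_radical_def by simp

lemma hom_radicalD:
  assumes "\<alpha> \<in> hom_radical p G T"
  shows "\<alpha> \<in> discrete_hom G T (integer_mod_group p)"
    and "\<beta> \<in> discrete_hom G T (integer_mod_group p) \<Longrightarrow>
      \<exists>h\<in>discrete_hom G T (heisenberg p). \<forall>g\<in>carrier G. heisenberg_abel (h g) = (\<alpha> g, \<beta> g)"
  using assms unfolding hom_radical_def by simp_all

text \<open>The factor set \<open>a * b'\<close> vanishes for \<open>a = 0\<close>, so the extension
  splits over the second coordinate.\<close>

lemma heisenberg_split:
  assumes p: "0 < p"
  shows "(\<lambda>b. (0, b, 0)) \<in> hom (integer_mod_group p) (heisenberg p)"
  using p by (auto simp: hom_def carrier_integer_mod_group)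

lemma zero_in_hom_radical:
  assumes p: "0 < p" and G: "topological_group G T"
  shows "(\<lambda>_. 0) \<in> hom_radical p G T"
proof (rule hom_radicalI)
  show "(\<lambda>_. 0) \<in> discrete_hom G T (integer_mod_group p)"
    using discrete_hom_const_one[OF G, of "integer_mod_group p"] by simp
  show "\<exists>h\<in>discrete_hom G T (heisenberg p). \<forall>g\<in>carrier G. heisenberg_abel (h g) = (0, \<beta> g)"
    if "\<beta> \<in> discrete_hom G T (integer_mod_group p)" for \<beta>
    using discrete_hom_compose[OF that heisenberg_split[OF p]] by (intro bexI) auto
qed

lemma hom_radical_cong:
  assumes "\<alpha> \<in> hom_radical p G T" "group G" "\<And>g. g \<in> carrier G \<Longrightarrow> \<alpha> g = \<alpha>' g"
  shows "\<alpha>' \<in> hom_radical p G T"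
  using assms discrete_hom_cong[OF hom_radicalD(1)[OF assms(1)] assms(2,3)] hom_radicalD(2)[OF assms(1)]
  by (intro hom_radicalI) auto

text \<open>Converse of \<open>discrete_hom_wreathI\<close>: the base components of a homomorphism
  over \<open>\<kappa>\<close> form a cocycle with open fibres.\<close>

lemma wreath_hom_component:
  assumes p: "0 < p" and G: "topological_group G T" and M: "M \<in> discrete_hom G T (wreath p P)"
    and \<kappa>: "\<forall>g\<in>carrier G. fst (M g) = \<kappa> g"
  shows "j \<in> {0..<int p} \<Longrightarrow> g \<in> carrier G \<Longrightarrow> snd (M g) j \<in> carrier P"
    and "j \<in> {0..<int p} \<Longrightarrow> g \<in> carrier G \<Longrightarrow> h \<in> carrier G \<Longrightarrow>
      snd (M (g \<otimes>\<^bsub>G\<^esub> h)) j = snd (M g) j \<otimes>\<^bsub>P\<^esub> snd (M h) ((j + \<kappa> g) mod int p)"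
    and "openin T {g \<in> carrier G. snd (M g) j = x}"
proof -
  show "snd (M g) j \<in> carrier P" if "j \<in> {0..<int p}" "g \<in> carrier G" for j g
    using discrete_homD(2)[OF M that(2)] that(1) by (auto simp: PiE_iff)
  show "snd (M (g \<otimes>\<^bsub>G\<^esub> h)) j = snd (M g) j \<otimes>\<^bsub>P\<^esub> snd (M h) ((j + \<kappa> g) mod int p)"
    if "j \<in> {0..<int p}" "g \<in> carrier G" "h \<in> carrier G" for j g h
    using discrete_homD(3)[OF M that(2,3)] that \<kappa> by simp
  show "openin T {g \<in> carrier G. snd (M g) j = x}"
    using openin_fibre_comp[OF discrete_homD(4)[OF M], of "\<lambda>z. snd z j"] .
qed

section \<open>Shapiro's lemma for wreath products\<close>

context section_hom
begin

text \<open>On the kernel the shift by \<open>\<kappa> u\<close> is zero, so coordinate 0 is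
  multiplicative there. This is evaluation at the trivial coset, one direction of Shapiro's
  lemma.\<close>

lemma wreath_restrict_component:
  assumes M: "M \<in> discrete_hom G T (wreath p P)" and \<kappa>M: "\<forall>g\<in>carrier G. fst (M g) = \<kappa> g"
  shows "(\<lambda>u. snd (M u) 0) \<in> discrete_hom (G\<lparr>carrier := U\<rparr>) (subtopology T U) P"
proof (rule discrete_homI)
  have p0: "0 < p" "0 \<in> {0..<int p}" using p by auto
  note W = wreath_hom_component[OF p0(1) top_G M \<kappa>M]
  have UG: "u \<in> carrier G" "\<kappa> u = 0" if "u \<in> U" for u using that by (auto simp: zero_fibre_def)
  show "snd (M u) 0 \<in> carrier P" if "u \<in> carrier (G\<lparr>carrier := U\<rparr>)" for u
    using W(1)[OF p0(2)] UG that by simp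
  show "snd (M (u \<otimes>\<^bsub>G\<lparr>carrier := U\<rparr>\<^esub> v)) 0 = snd (M u) 0 \<otimes>\<^bsub>P\<^esub> snd (M v) 0"
    if "u \<in> carrier (G\<lparr>carrier := U\<rparr>)" "v \<in> carrier (G\<lparr>carrier := U\<rparr>)" for u v
    using W(2)[OF p0(2)] UG that by simp
  show "openin (subtopology T U) {u \<in> carrier (G\<lparr>carrier := U\<rparr>). snd (M u) 0 = x}" for x
  proof -
    have "{u \<in> carrier (G\<lparr>carrier := U\<rparr>). snd (M u) 0 = x} = {g \<in> carrier G. snd (M g) 0 = x} \<inter> U"
      using UG by auto
    then show ?thesis using W(3)[of 0 x] by (auto simp: openin_subtopology)
  qed
qed

text \<open>Coordinate 0 of \<open>B\<close> on both sides of
  \<open>?u \<otimes> s ?k = s j \<otimes> g\<close>. Every coordinate is thus determined by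
  coordinate 0 on the kernel, up to the values at the section.\<close>

lemma wreath_component_shift:
  assumes B: "B \<in> discrete_hom G T (wreath p (integer_mod_group p))"
    and \<kappa>B: "\<forall>g\<in>carrier G. fst (B g) = \<kappa> g"
    and j: "j \<in> {0..<int p}" and g: "g \<in> carrier G"
  shows "(snd (B (s j \<otimes> g \<otimes> inv s ((j + \<kappa> g) mod int p))) 0 + snd (B (s ((j + \<kappa> g) mod int p))) 0) mod int p =
    (snd (B (s j)) 0 + snd (B g) j) mod int p"
proof -
  have p0: "0 < p" "0 \<in> {0..<int p}" using p by auto
  note W = wreath_hom_component(2)[OF p0(1) top_G B \<kappa>B p0(2)]
  let ?k = "(j + \<kappa> g) mod int p"
  have k: "?k \<in> {0..<int p}" by (rule mod_mem)
  let ?u = "s j \<otimes> g \<otimes> inv s ?k"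
  have u: "?u \<in> carrier G" "\<kappa> ?u = 0"
    using section_shift_in_zero_fibre[OF p0(1) is_group discrete_homD(1)[OF \<kappa>] s s g j]
    by (auto simp: zero_fibre_def)
  have "?u \<otimes> s ?k = s j \<otimes> g"
    using section_closed[OF j] section_closed[OF k] g by (simp add: m_assoc)
  then have "snd (B (?u \<otimes> s ?k)) 0 = snd (B (s j \<otimes> g)) 0" by simp
  then show ?thesis
    using W[OF u(1) section_closed[OF k]] W[OF section_closed[OF j] g] u(2) section_val[OF j] j by simp
qed

text \<open>Summing \<open>wreath_component_shift\<close> over \<open>j\<close> leaves the sum of
  the coordinates, since the values at the section occur once as they stand and once with shifted
  index. Corestriction is thereby a map on wreath products.\<close>

lemma transfer_component:
  assumes B: "B \<in> discrete_hom G T (wreath p (integer_mod_group p))"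
    and \<kappa>B: "\<forall>g\<in>carrier G. fst (B g) = \<kappa> g" and g: "g \<in> carrier G"
  shows "transfer p G \<kappa> s (\<lambda>u. snd (B u) 0) g = (\<Sum>j\<in>{0..<int p}. snd (B g) j) mod int p"
proof -
  let ?J = "{0..<int p}" and ?k = "\<lambda>j. (j + \<kappa> g) mod int p" and ?b = "\<lambda>x. snd (B x) 0"
  have "(?b (s j \<otimes> g \<otimes> inv s (?k j))) mod int p = (?b (s j) + snd (B g) j - ?b (s (?k j))) mod int p"
    if "j \<in> ?J" for j
  proof -
    have "(?b (s j \<otimes> g \<otimes> inv s (?k j)) + ?b (s (?k j)) - ?b (s (?k j))) mod int p =
        (?b (s j) + snd (B g) j - ?b (s (?k j))) mod int p"
      by (intro mod_diff_cong wreath_component_shift[OF B \<kappa>B that g]) simp_all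
    then show ?thesis by simp
  qed
  then have "(\<Sum>j\<in>?J. ?b (s j \<otimes> g \<otimes> inv s (?k j)) mod int p) mod int p =
      (\<Sum>j\<in>?J. (?b (s j) + snd (B g) j - ?b (s (?k j))) mod int p) mod int p"
    by simp
  then have "(\<Sum>j\<in>?J. ?b (s j \<otimes> g \<otimes> inv s (?k j))) mod int p =
      (\<Sum>j\<in>?J. ?b (s j) + snd (B g) j - ?b (s (?k j))) mod int p"
    by (simp only: mod_sum_eq)
  also have "(\<Sum>j\<in>?J. ?b (s j) + snd (B g) j - ?b (s (?k j))) = (\<Sum>j\<in>?J. snd (B g) j)"
    using sum_add_mod[of p "\<lambda>j. ?b (s j)" "\<kappa> g"] p by (simp add: sum.distrib sum_subtractf)
  finally show ?thesis by (simp add: transfer_def)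
qed

text \<open>Shows that restriction of coordinate 0 reaches every \<open>\<beta>\<close>. Its value
  at \<open>u\<close> is \<open>\<beta>\<close> of a conjugate of \<open>u\<close> by an element of
  the kernel, and such a conjugation is invisible to a homomorphism with abelian target.\<close>

lemma induced_hom:
  assumes \<beta>: "\<beta> \<in> discrete_hom (G\<lparr>carrier := U\<rparr>) (subtopology T U) (integer_mod_group p)"
  obtains B where "B \<in> discrete_hom G T (wreath p (integer_mod_group p))"
    "\<forall>g\<in>carrier G. fst (B g) = \<kappa> g"
    "\<And>g j. g \<in> carrier G \<Longrightarrow> j \<in> {0..<int p} \<Longrightarrow>
      snd (B g) j = \<beta> (s j \<otimes> g \<otimes> inv s ((j + \<kappa> g) mod int p))"
    "\<And>u. u \<in> U \<Longrightarrow> snd (B u) 0 = \<beta> u"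
proof -
  let ?Z = "integer_mod_group p" and ?k = "\<lambda>g j. (j + \<kappa> g) mod int p"
  have p0: "0 < p" "0 \<in> {0..<int p}" using p by auto
  \<comment> \<open>The shape is that of \<open>twisted_induction\<close> with every conjugating
    coordinate equal to 0, the identity of C_p.\<close>
  define B where "B g = (\<kappa> g, \<lambda>j\<in>{0..<int p}. inv\<^bsub>?Z\<^esub> 0 \<otimes>\<^bsub>?Z\<^esub> \<beta> (s j \<otimes> g \<otimes> inv s (?k g j)) \<otimes>\<^bsub>?Z\<^esub> 0)" for g
  have B: "B \<in> discrete_hom G T (wreath p ?Z)"
    unfolding B_def by (rule twisted_induction[OF p0(1) top_G _ \<kappa> s \<beta>]) simp_all
  have inU: "s j \<otimes> g \<otimes> inv s (?k g j) \<in> U" if "g \<in> carrier G" "j \<in> {0..<int p}" for g j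
    using section_shift_in_zero_fibre[OF p0(1) is_group discrete_homD(1)[OF \<kappa>] s s that] .
  have \<beta>r: "\<beta> u \<in> {0..<int p}" if "u \<in> U" for u
    using discrete_homD(2)[OF \<beta>] that p by (simp add: carrier_integer_mod_group)
  have \<beta>m: "\<beta> (u \<otimes> v) = (\<beta> u + \<beta> v) mod int p" if "u \<in> U" "v \<in> U" for u v
    using discrete_homD(3)[OF \<beta>] that by simp
  have Bj: "snd (B g) j = \<beta> (s j \<otimes> g \<otimes> inv s (?k g j))" if "g \<in> carrier G" "j \<in> {0..<int p}" for g j
    using \<beta>r[OF inU[OF that]] that(2) by (simp add: B_def)
  have "snd (B u) 0 = \<beta> u" if u: "u \<in> U" for u
  proof -
    have uG: "u \<in> carrier G" "\<kappa> u = 0" using u by (auto simp: zero_fibre_def)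
    \<comment> \<open>The representative of the trivial coset need not be the identity; being in the
      kernel is enough for the conjugation to drop out.\<close>
    have s0: "s 0 \<in> U" using section_closed[OF p0(2)] section_val[OF p0(2)] by (simp add: zero_fibre_def)
    have c: "s 0 \<otimes> u \<otimes> inv s 0 \<in> U" using inU[OF uG(1) p0(2)] uG(2) by simp
    have "(s 0 \<otimes> u \<otimes> inv s 0) \<otimes> s 0 = s 0 \<otimes> u"
      using section_closed[OF p0(2)] uG(1) by (simp add: m_assoc)
    then have "(\<beta> (s 0 \<otimes> u \<otimes> inv s 0) + \<beta> (s 0)) mod int p = (\<beta> (s 0) + \<beta> u) mod int p"
      using \<beta>m[OF c s0] \<beta>m[OF s0 u] by simp
    then have "(\<beta> (s 0 \<otimes> u \<otimes> inv s 0) + \<beta> (s 0) - \<beta> (s 0)) mod int p = (\<beta> (s 0) + \<beta> u - \<beta> (s 0)) mod int p"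
      by (intro mod_diff_cong) simp_all
    then have "\<beta> (s 0 \<otimes> u \<otimes> inv s 0) = \<beta> u"
      using \<beta>r[OF c] \<beta>r[OF u] by simp
    then show ?thesis using Bj[OF uG(1) p0(2)] uG(2) by simp
  qed
  then show thesis using that B Bj by (simp add: B_def)
qed

end

text \<open>A non-zero residue mod a prime generates C_p, so suitable powers of \<open>g\<close>
  attain every value. Hence a homomorphism to C_p is either zero or has a section.\<close>

lemma section_exists:
  assumes p: "prime p" and G: "topological_group G T"
    and \<kappa>: "\<kappa> \<in> discrete_hom G T (integer_mod_group p)" and g: "g \<in> carrier G" "\<kappa> g \<noteq> 0"
  obtains s where "section_of p G \<kappa> s"
proof -
  interpret \<kappa>: group_hom G "integer_mod_group p" \<kappa>
    using discrete_homD(1)[OF \<kappa>] G group_integer_mod_group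
    by (simp add: group_hom_def group_hom_axioms_def topological_group_def)
  have p1: "1 < p" using p prime_gt_1_nat by blast
  have r: "0 < \<kappa> g" "\<kappa> g < int p"
    using \<kappa>.hom_closed[OF g(1)] g(2) p1 by (auto simp: carrier_integer_mod_group)
  have "coprime (\<kappa> g) (int p)"
    using p r zdvd_not_zless[of "\<kappa> g" "int p"]
    by (metis coprime_commute prime_imp_coprime prime_int_nat_transfer nat_int of_nat_0_le_iff)
  then obtain x where x: "[\<kappa> g * x = 1] (mod int p)"
    using cong_solve_coprime_int by blast
  \<comment> \<open>As \<open>x\<close> inverts \<open>\<kappa> g\<close> mod p, the exponent
    \<open>x * j\<close> yields the value \<open>j\<close>; reduction mod p makes it a natural
    number.\<close>
  have "\<kappa> (g [^]\<^bsub>G\<^esub> nat ((x * j) mod int p)) = j" if j: "j \<in> {0..<int p}" for j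
  proof -
    have "\<kappa> (g [^]\<^bsub>G\<^esub> nat ((x * j) mod int p)) = ((x * j) mod int p * \<kappa> g) mod int p"
      unfolding \<kappa>.hom_nat_pow[OF g(1)] pow_integer_mod_group using p1 by simp
    also have "\<dots> = ((\<kappa> g * x) mod int p * j) mod int p"
      by (simp add: mod_simps ac_simps)
    also have "\<dots> = j" using x j p1 by (simp add: cong_def)
    finally show ?thesis .
  qed
  then have "section_of p G \<kappa> (\<lambda>j. g [^]\<^bsub>G\<^esub> nat ((x * j) mod int p))"
    using g(1) by (simp add: section_of_def)
  then show thesis by (rule that)
qed

section \<open>The local lifting statement\<close>

abbreviation wreath_abel :: "nat \<Rightarrow> int \<times> (int \<Rightarrow> int \<times> int \<times> int) \<Rightarrow> int \<times> (int \<Rightarrow> int \<times> int)" where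
  "wreath_abel p x \<equiv> (fst x, \<lambda>j\<in>{0..<int p}. heisenberg_abel (snd x j))"

lemma wreath_abel_hom:
  "wreath_abel p \<in> hom (wreath p (heisenberg p)) (wreath p (integer_mod_group p \<times>\<times> integer_mod_group p))"
  using wreath_map_hom[OF heisenberg_abel_hom] .

text \<open>
  The local form of the theorem: \<open>M\<close> is a class of the module induced along \<open>\<kappa>\<close> with trace \<open>\<alpha>\<close>
  whose cup product with every such class vanishes. When \<open>\<kappa>\<close> is not surjective it is zero, the
  induced module is a direct sum of trivial ones, and \<open>M = (\<alpha>, 0, \<dots>, 0)\<close> works.
\<close>

lemma induced_radical_lift:
  fixes G (structure)
  assumes prime: "prime p" and G: "topological_group G T" and KN: "hom_kijima_nishi p G T"
    and \<kappa>: "\<kappa> \<in> discrete_hom G T (integer_mod_group p)" and \<alpha>: "\<alpha> \<in> hom_radical p G T"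
  shows "\<exists>M\<in>discrete_hom G T (wreath p (integer_mod_group p)).
    (\<forall>g\<in>carrier G. fst (M g) = \<kappa> g) \<and>
    (\<forall>g\<in>carrier G. (\<Sum>j\<in>{0..<int p}. snd (M g) j) mod int p = \<alpha> g) \<and>
    ((\<forall>g\<in>carrier G. \<kappa> g = 0 \<and> \<alpha> g = 0) \<longrightarrow> (\<forall>g\<in>carrier G. M g = \<one>\<^bsub>wreath p (integer_mod_group p)\<^esub>)) \<and>
    (\<forall>B\<in>discrete_hom G T (wreath p (integer_mod_group p)). (\<forall>g\<in>carrier G. fst (B g) = \<kappa> g) \<longrightarrow>
      (\<exists>L\<in>discrete_hom G T (wreath p (heisenberg p)).
        \<forall>g\<in>carrier G. wreath_abel p (L g) = (\<kappa> g, \<lambda>j\<in>{0..<int p}. (snd (M g) j, snd (B g) j))))"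
proof (cases "\<forall>g\<in>carrier G. \<kappa> g = 0")
  case True
  have p0: "0 < p" using prime prime_gt_0_nat by blast
  have opn: "openin T (carrier G)" using G openin_topspace[of T] by (simp add: topological_group_def)
  have gr: "group G" using G by (simp add: topological_group_def)
  let ?Z = "integer_mod_group p" and ?J = "{0..<int p}"
  note \<alpha>d = hom_radicalD(1)[OF \<alpha>]
  have \<alpha>r: "\<alpha> g \<in> ?J" if "g \<in> carrier G" for g
    using discrete_homD(2)[OF \<alpha>d that] p0 by (simp add: carrier_integer_mod_group)
  \<comment> \<open>Without a shift the coordinates decouple: a homomorphism over
    \<open>\<kappa>\<close> is a family of p independent homomorphisms.\<close>
  have k: "(j + \<kappa> g) mod int p = j" if "g \<in> carrier G" "j \<in> ?J" for g j
    using True that by simp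
  let ?F = "\<lambda>g j. if j = 0 then \<alpha> g else 0"
  let ?M = "\<lambda>g. (\<kappa> g, \<lambda>j\<in>?J. ?F g j)"
  have F_hom: "(\<lambda>g. ?F g j) \<in> discrete_hom G T ?Z" for j
    using \<alpha>d discrete_hom_const_one[OF G, of ?Z] by (cases "j = 0") simp_all
  have M: "?M \<in> discrete_hom G T (wreath p ?Z)"
    using discrete_homD(2,3,4)[OF F_hom]
    by (intro discrete_hom_wreathI[OF p0 opn \<kappa>]) (simp_all only: k)
  show ?thesis
  proof (intro bexI[OF _ M] conjI ballI impI)
    show "fst (?M g) = \<kappa> g" for g by simp
    show "(\<Sum>j\<in>?J. snd (?M g) j) mod int p = \<alpha> g" if "g \<in> carrier G" for g
      using \<alpha>r[OF that] p0 by (simp add: sum.delta)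
    \<comment> \<open>This clause keeps the local solutions trivial on almost all factors, so that
      they extend to the product.\<close>
    show "?M g = \<one>\<^bsub>wreath p ?Z\<^esub>" if "\<forall>g\<in>carrier G. \<kappa> g = 0 \<and> \<alpha> g = 0" "g \<in> carrier G" for g
      using that by auto
    fix B assume B: "B \<in> discrete_hom G T (wreath p ?Z)" and \<kappa>B: "\<forall>g\<in>carrier G. fst (B g) = \<kappa> g"
    note W = wreath_hom_component[OF p0 G B \<kappa>B]
    have B_hom: "(\<lambda>g. snd (B g) j) \<in> discrete_hom G T ?Z" if "j \<in> ?J" for j
      using W(1)[OF that] W(2)[OF that] W(3) k that by (intro discrete_homI) simp_all
    \<comment> \<open>Each coordinate poses its own lifting problem: coordinate 0 is solved because
      \<open>\<alpha>\<close> is in the radical, the others because zero is.\<close>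
    have "\<exists>h\<in>discrete_hom G T (heisenberg p). \<forall>g\<in>carrier G. heisenberg_abel (h g) = (?F g j, snd (B g) j)"
      if j: "j \<in> ?J" for j
    proof (cases "j = 0")
      case True
      then show ?thesis using hom_radicalD(2)[OF \<alpha> B_hom[OF j]] by simp
    next
      case False
      then show ?thesis using hom_radicalD(2)[OF zero_in_hom_radical[OF p0 G] B_hom[OF j]] by simp
    qed
    then obtain h where h: "\<And>j. j \<in> ?J \<Longrightarrow> h j \<in> discrete_hom G T (heisenberg p)"
      "\<And>j g. j \<in> ?J \<Longrightarrow> g \<in> carrier G \<Longrightarrow> heisenberg_abel (h j g) = (?F g j, snd (B g) j)"
      by metis
    have "(\<lambda>g. (\<kappa> g, \<lambda>j\<in>?J. h j g)) \<in> discrete_hom G T (wreath p (heisenberg p))"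
      using discrete_homD(2,3,4)[OF h(1)]
      by (intro discrete_hom_wreathI[OF p0 opn \<kappa>]) (simp_all only: k)
    moreover have "wreath_abel p (\<kappa> g, \<lambda>j\<in>?J. h j g) = (\<kappa> g, \<lambda>j\<in>?J. (snd (?M g) j, snd (B g) j))"
      if "g \<in> carrier G" for g
      using h(2)[OF _ that] by (simp add: fun_eq_iff)
    ultimately show "\<exists>L\<in>discrete_hom G T (wreath p (heisenberg p)).
        \<forall>g\<in>carrier G. wreath_abel p (L g) = (\<kappa> g, \<lambda>j\<in>?J. (snd (?M g) j, snd (B g) j))"
      by (intro bexI[of _ "\<lambda>g. (\<kappa> g, \<lambda>j\<in>?J. h j g)"]) blast+
  qed
next
  case False
  then obtain s where s: "section_of p G \<kappa> s" using section_exists[OF prime G \<kappa>] by blast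
  have p1: "1 < p" using prime prime_gt_1_nat by blast
  have p0: "0 < p" "0 \<in> {0..<int p}" using p1 by auto
  interpret section_hom p G T \<kappa> s by unfold_locales (fact p1 G \<kappa> s)+
  let ?Z = "integer_mod_group p" and ?J = "{0..<int p}" and ?k = "\<lambda>g j. (j + \<kappa> g) mod int p"
  let ?He = "heisenberg p"
  interpret He: group ?He using group_heisenberg[OF p0(1)] .
  obtain \<phi> where \<phi>: "\<phi> \<in> hom_radical p (G\<lparr>carrier := U\<rparr>) (subtopology T U)"
    "\<forall>g\<in>carrier G. \<alpha> g = transfer p G \<kappa> s \<phi> g"
    using KN \<kappa> s \<alpha> unfolding hom_kijima_nishi_def by blast
  obtain M where M: "M \<in> discrete_hom G T (wreath p ?Z)" "\<forall>g\<in>carrier G. fst (M g) = \<kappa> g"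
    "\<And>g j. g \<in> carrier G \<Longrightarrow> j \<in> ?J \<Longrightarrow> snd (M g) j = \<phi> (s j \<otimes> g \<otimes> inv s (?k g j))"
    using induced_hom[OF hom_radicalD(1)[OF \<phi>(1)]] by metis
  show ?thesis
  proof (intro bexI[OF _ M(1)] conjI ballI impI)
    show "fst (M g) = \<kappa> g" if "g \<in> carrier G" for g using M(2) that by blast
    show "(\<Sum>j\<in>?J. snd (M g) j) mod int p = \<alpha> g" if "g \<in> carrier G" for g
      using \<phi>(2) M(3)[OF that] that by (simp add: transfer_def)
    \<comment> \<open>Vacuous in this case, since \<open>\<kappa>\<close> is not zero.\<close>
    show "M g = \<one>\<^bsub>wreath p ?Z\<^esub>" if "\<forall>g\<in>carrier G. \<kappa> g = 0 \<and> \<alpha> g = 0" for g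
      using that False by blast
    fix B assume B: "B \<in> discrete_hom G T (wreath p ?Z)" and \<kappa>B: "\<forall>g\<in>carrier G. fst (B g) = \<kappa> g"
    \<comment> \<open>Coordinate 0 of \<open>B\<close> is a class on the kernel, and
      \<open>\<phi>\<close> lies in the radical there.\<close>
    obtain l where l: "l \<in> discrete_hom (G\<lparr>carrier := U\<rparr>) (subtopology T U) ?He"
      "\<And>u. u \<in> U \<Longrightarrow> heisenberg_abel (l u) = (\<phi> u, snd (B u) 0)"
      using hom_radicalD(2)[OF \<phi>(1) wreath_restrict_component[OF B \<kappa>B]] by auto
    have Br: "snd (B g) j \<in> ?J" if "g \<in> carrier G" "j \<in> ?J" for g j
      using wreath_hom_component(1)[OF p0(1) top_G B \<kappa>B that(2,1)] p by (simp add: carrier_integer_mod_group)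
    \<comment> \<open>Inducing \<open>l\<close> directly yields the second coordinate of
      \<open>B\<close> only up to the values of \<open>B\<close> at the section. Conjugation by
      \<open>?y\<close> removes this difference, and the zero first entry of \<open>?y j\<close>
      leaves the coordinates of \<open>M\<close> unchanged.\<close>
    let ?y = "\<lambda>j. (0, snd (B (s j)) 0, 0)"
    have y: "?y j \<in> carrier ?He" if "j \<in> ?J" for j
      using Br[OF section_closed[OF that] p0(2)] p by simp
    let ?u = "\<lambda>g j. s j \<otimes> g \<otimes> inv s (?k g j)"
    let ?L = "\<lambda>g. (\<kappa> g, \<lambda>j\<in>?J. inv\<^bsub>?He\<^esub> (?y j) \<otimes>\<^bsub>?He\<^esub> l (?u g j) \<otimes>\<^bsub>?He\<^esub> ?y (?k g j))"
    have L: "?L \<in> discrete_hom G T (wreath p ?He)"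
      by (rule twisted_induction[OF p0(1) top_G He.is_group \<kappa> s l(1) y])
    have inv_y: "inv\<^bsub>?He\<^esub> (?y j) = (0, (- snd (B (s j)) 0) mod int p, 0)" if "j \<in> ?J" for j
      using y[OF that] p by (intro He.inv_equality) (auto simp: mod_simps)
    have "heisenberg_abel (inv\<^bsub>?He\<^esub> (?y j) \<otimes>\<^bsub>?He\<^esub> l (?u g j) \<otimes>\<^bsub>?He\<^esub> ?y (?k g j)) =
        (snd (M g) j, snd (B g) j)" if g: "g \<in> carrier G" and j: "j \<in> ?J" for g j
    proof -
      have uU: "?u g j \<in> U"
        using section_shift_in_zero_fibre[OF p0(1) is_group discrete_homD(1)[OF \<kappa>] s s g j] .
      have lu: "fst (l (?u g j)) = snd (M g) j" "fst (snd (l (?u g j))) = snd (B (?u g j)) 0"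
        using l(2)[OF uU] M(3)[OF g j] by simp_all
      have "l (?u g j) \<in> carrier ?He" using discrete_homD(2)[OF l(1)] uU by simp
      then have Mr: "snd (M g) j mod int p = snd (M g) j" using lu(1) by (cases "l (?u g j)") simp
      let ?b = "snd (B (s j)) 0" and ?b' = "snd (B (s (?k g j))) 0"
      \<comment> \<open>The second coordinate of the conjugated lift; by
        \<open>wreath_component_shift\<close> it is the coordinate \<open>j\<close> of
        \<open>B\<close> itself.\<close>
      have "(- ?b + (snd (B (?u g j)) 0 + ?b')) mod int p = (- ?b + (?b + snd (B g) j)) mod int p"
        by (intro mod_add_cong wreath_component_shift[OF B \<kappa>B j g]) simp
      then have e: "(- ?b + (snd (B (?u g j)) 0 + ?b')) mod int p = snd (B g) j"
        using Br[OF g j] by simp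
      have "(((- ?b) mod int p + snd (B (?u g j)) 0) mod int p + ?b') mod int p =
          (- ?b + (snd (B (?u g j)) 0 + ?b')) mod int p"
        by (simp add: mod_simps algebra_simps)
      also note e
      finally have e: "(((- ?b) mod int p + snd (B (?u g j)) 0) mod int p + ?b') mod int p = snd (B g) j" .
      show ?thesis
        unfolding inv_y[OF j] by (simp add: mult_heisenberg lu Mr e)
    qed
    then have "wreath_abel p (?L g) = (\<kappa> g, \<lambda>j\<in>?J. (snd (M g) j, snd (B g) j))"
      if "g \<in> carrier G" for g
      using that by (simp add: fun_eq_iff)
    then show "\<exists>L\<in>discrete_hom G T (wreath p ?He).
        \<forall>g\<in>carrier G. wreath_abel p (L g) = (\<kappa> g, \<lambda>j\<in>?J. (snd (M g) j, snd (B g) j))"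
      by (intro bexI[OF _ L] ballI)
  qed
qed

section \<open>Passage between the product and its factors\<close>

context free_pro_p
begin

text \<open>The local lifts are glued by \<open>discrete_hom_extend\<close>, and by
  \<open>discrete_hom_eqI\<close> the result covers \<open>x\<close> because it does so on each
  factor.\<close>

lemma lift_if_locally:
  assumes P: "finite_p_group p P" and Q: "group Q" and \<pi>: "\<pi> \<in> hom P Q" and x: "x \<in> discrete_hom H S Q"
    and loc: "\<And>i. i \<in> I \<Longrightarrow> \<exists>L\<in>discrete_hom (G i) (T i) P. \<forall>g\<in>carrier (G i). \<pi> (L g) = x (\<iota> i g)"
  shows "\<exists>L\<in>discrete_hom H S P. \<forall>y\<in>carrier H. \<pi> (L y) = x y"
proof -
  have gP: "group P" using P by (simp add: finite_p_group_def)
  \<comment> \<open>Trivial lifts where \<open>x\<close> is trivial keep almost all of the local lifts trivial.\<close>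
  have "\<exists>L\<in>discrete_hom (G i) (T i) P. (\<forall>g\<in>carrier (G i). \<pi> (L g) = x (\<iota> i g)) \<and>
      ((\<forall>g\<in>carrier (G i). x (\<iota> i g) = \<one>\<^bsub>Q\<^esub>) \<longrightarrow> (\<forall>g\<in>carrier (G i). L g = \<one>\<^bsub>P\<^esub>))" if "i \<in> I" for i
  proof (cases "\<forall>g\<in>carrier (G i). x (\<iota> i g) = \<one>\<^bsub>Q\<^esub>")
    case True
    then show ?thesis
      using discrete_hom_const_one[OF top_group[OF that] gP] hom_one[OF \<pi> gP Q]
      by (intro bexI[of _ "\<lambda>_. \<one>\<^bsub>P\<^esub>"]) auto
  next
    case False
    then show ?thesis using loc[OF that] by blast
  qed
  then have "\<exists>L. \<forall>i\<in>I. L i \<in> discrete_hom (G i) (T i) P \<and> (\<forall>g\<in>carrier (G i). \<pi> (L i g) = x (\<iota> i g)) \<and>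
      ((\<forall>g\<in>carrier (G i). x (\<iota> i g) = \<one>\<^bsub>Q\<^esub>) \<longrightarrow> (\<forall>g\<in>carrier (G i). L i g = \<one>\<^bsub>P\<^esub>))"
    by (intro bchoice) blast
  then obtain L where L: "\<And>i. i \<in> I \<Longrightarrow> L i \<in> discrete_hom (G i) (T i) P"
    "\<And>i g. i \<in> I \<Longrightarrow> g \<in> carrier (G i) \<Longrightarrow> \<pi> (L i g) = x (\<iota> i g)"
    "\<And>i. i \<in> I \<Longrightarrow> \<forall>g\<in>carrier (G i). x (\<iota> i g) = \<one>\<^bsub>Q\<^esub> \<Longrightarrow> \<forall>g\<in>carrier (G i). L i g = \<one>\<^bsub>P\<^esub>"
    by blast
  have "{i \<in> I. \<exists>g\<in>carrier (G i). L i g \<noteq> \<one>\<^bsub>P\<^esub>} \<subseteq> {i \<in> I. \<exists>g\<in>carrier (G i). x (\<iota> i g) \<noteq> \<one>\<^bsub>Q\<^esub>}"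
    using L(3) by blast
  then have "finite {i \<in> I. \<exists>g\<in>carrier (G i). L i g \<noteq> \<one>\<^bsub>P\<^esub>}"
    using discrete_hom_almost_trivial[OF Q x] by (rule finite_subset)
  then obtain K where K: "K \<in> discrete_hom H S P" "\<forall>i\<in>I. \<forall>g\<in>carrier (G i). K (\<iota> i g) = L i g"
    using discrete_hom_extend[OF P L(1)] by blast
  have "\<pi> (K y) = x y" if "y \<in> carrier H" for y
    by (rule discrete_hom_eqI[OF Q discrete_hom_compose[OF K(1) \<pi>] x _ that]) (simp add: K(2) L(2))
  then show ?thesis using K(1) by blast
qed

lemma extend_by_one:
  assumes P: "finite_p_group p P" and i: "i \<in> I" and f: "f \<in> discrete_hom (G i) (T i) P"
  obtains h where "h \<in> discrete_hom H S P" "\<And>g. g \<in> carrier (G i) \<Longrightarrow> h (\<iota> i g) = f g"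
    "\<And>k g. k \<in> I \<Longrightarrow> k \<noteq> i \<Longrightarrow> g \<in> carrier (G k) \<Longrightarrow> h (\<iota> k g) = \<one>\<^bsub>P\<^esub>"
proof -
  have gP: "group P" using P by (simp add: finite_p_group_def)
  let ?f = "\<lambda>k. if k = i then f else (\<lambda>_. \<one>\<^bsub>P\<^esub>)"
  have "?f k \<in> discrete_hom (G k) (T k) P" if "k \<in> I" for k
    using f discrete_hom_const_one[OF top_group[OF that] gP] by simp
  moreover have "finite {k \<in> I. \<exists>g\<in>carrier (G k). ?f k g \<noteq> \<one>\<^bsub>P\<^esub>}"
    by (rule finite_subset[of _ "{i}"]) auto
  ultimately obtain h where "h \<in> discrete_hom H S P" "\<forall>k\<in>I. \<forall>g\<in>carrier (G k). h (\<iota> k g) = ?f k g"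
    using discrete_hom_extend[OF P, of ?f] by blast
  then show thesis using that i by simp
qed

text \<open>To restrict, a test class on one factor is extended trivially to the others and the
  global lift is composed with \<open>\<iota> i\<close>. In the other direction the Heisenberg lifts
  on the factors are glued.\<close>

lemma hom_radical_H_iff:
  assumes \<alpha>: "\<alpha> \<in> discrete_hom H S (integer_mod_group p)"
  shows "\<alpha> \<in> hom_radical p H S \<longleftrightarrow> (\<forall>i\<in>I. (\<lambda>g. \<alpha> (\<iota> i g)) \<in> hom_radical p (G i) (T i))"
proof
  assume rad: "\<alpha> \<in> hom_radical p H S"
  show "\<forall>i\<in>I. (\<lambda>g. \<alpha> (\<iota> i g)) \<in> hom_radical p (G i) (T i)"
  proof (intro ballI hom_radicalI)
    fix i \<beta> assume i: "i \<in> I" and \<beta>: "\<beta> \<in> discrete_hom (G i) (T i) (integer_mod_group p)"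
    obtain b where b: "b \<in> discrete_hom H S (integer_mod_group p)"
      "\<And>g. g \<in> carrier (G i) \<Longrightarrow> b (\<iota> i g) = \<beta> g"
      using extend_by_one[OF finite_p_group_integer_mod[OF p_pos] i \<beta>] by metis
    obtain h where h: "h \<in> discrete_hom H S (heisenberg p)" "\<forall>y\<in>carrier H. heisenberg_abel (h y) = (\<alpha> y, b y)"
      using hom_radicalD(2)[OF rad b(1)] by blast
    have "\<iota> i g \<in> carrier H" if "g \<in> carrier (G i)" for g
      using \<iota>_hom[OF i] that by (auto simp: hom_def)
    then show "\<exists>h\<in>discrete_hom (G i) (T i) (heisenberg p).
        \<forall>g\<in>carrier (G i). heisenberg_abel (h g) = (\<alpha> (\<iota> i g), \<beta> g)"
      using h(2) b(2) by (intro bexI[OF _ discrete_hom_\<iota>[OF h(1) i]]) auto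
  qed (rule discrete_hom_\<iota>[OF \<alpha>])
next
  assume loc: "\<forall>i\<in>I. (\<lambda>g. \<alpha> (\<iota> i g)) \<in> hom_radical p (G i) (T i)"
  show "\<alpha> \<in> hom_radical p H S"
  proof (rule hom_radicalI[OF \<alpha>])
    fix \<beta> assume \<beta>: "\<beta> \<in> discrete_hom H S (integer_mod_group p)"
    show "\<exists>h\<in>discrete_hom H S (heisenberg p). \<forall>g\<in>carrier H. heisenberg_abel (h g) = (\<alpha> g, \<beta> g)"
    proof (rule lift_if_locally[OF finite_p_group_heisenberg[OF p_pos] _ heisenberg_abel_hom discrete_hom_Pair[OF \<alpha> \<beta>]])
      show "\<exists>h\<in>discrete_hom (G i) (T i) (heisenberg p).
          \<forall>g\<in>carrier (G i). heisenberg_abel (h g) = (\<alpha> (\<iota> i g), \<beta> (\<iota> i g))" if "i \<in> I" for i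
        using hom_radicalD(2)[OF bspec[OF loc that] discrete_hom_\<iota>[OF \<beta> that]] .
    qed (simp add: DirProd_group)
  qed
qed

text \<open>The data extend trivially to the other factors and the solution restricts to the kernel
  in \<open>G i\<close>. The difficulty is that a test class there must come from the kernel in the
  product; it is induced to the wreath product over \<open>G i\<close>, extended trivially as a
  homomorphism, and read off again in coordinate 0.\<close>

theorem hom_kijima_nishi_factor:
  assumes KN: "hom_kijima_nishi p H S" and i: "i \<in> I"
  shows "hom_kijima_nishi p (G i) (T i)"
  unfolding hom_kijima_nishi_def
proof (intro ballI allI impI)
  let ?Z = "integer_mod_group p" and ?J = "{0..<int p}"
  note Zp = finite_p_group_integer_mod[OF p_pos]
  have p1: "1 < p" using prime_p prime_gt_1_nat by blast
  fix \<kappa>\<^sub>i s\<^sub>i \<alpha>\<^sub>i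
  assume \<kappa>\<^sub>i: "\<kappa>\<^sub>i \<in> discrete_hom (G i) (T i) ?Z" and s\<^sub>i: "section_of p (G i) \<kappa>\<^sub>i s\<^sub>i"
    and \<alpha>\<^sub>i: "\<alpha>\<^sub>i \<in> hom_radical p (G i) (T i)"
  interpret i: section_hom p "G i" "T i" \<kappa>\<^sub>i s\<^sub>i
    by unfold_locales (fact p1 top_group[OF i] \<kappa>\<^sub>i s\<^sub>i)+
  interpret \<iota>: group_hom "G i" H "\<iota> i"
    using \<iota>_hom[OF i] by (simp add: group_hom_def group_hom_axioms_def i.is_group H.is_group)
  obtain \<kappa> where kap: "\<kappa> \<in> discrete_hom H S ?Z" "\<And>g. g \<in> carrier (G i) \<Longrightarrow> \<kappa> (\<iota> i g) = \<kappa>\<^sub>i g"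
    "\<And>k g. k \<in> I \<Longrightarrow> k \<noteq> i \<Longrightarrow> g \<in> carrier (G k) \<Longrightarrow> \<kappa> (\<iota> k g) = \<one>\<^bsub>?Z\<^esub>"
    using extend_by_one[OF Zp i \<kappa>\<^sub>i] by metis
  obtain \<alpha> where \<alpha>: "\<alpha> \<in> discrete_hom H S ?Z" "\<And>g. g \<in> carrier (G i) \<Longrightarrow> \<alpha> (\<iota> i g) = \<alpha>\<^sub>i g"
    "\<And>k g. k \<in> I \<Longrightarrow> k \<noteq> i \<Longrightarrow> g \<in> carrier (G k) \<Longrightarrow> \<alpha> (\<iota> k g) = \<one>\<^bsub>?Z\<^esub>"
    using extend_by_one[OF Zp i hom_radicalD(1)[OF \<alpha>\<^sub>i]] by metis
  have "(\<lambda>g. \<alpha> (\<iota> k g)) \<in> hom_radical p (G k) (T k)" if k: "k \<in> I" for k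
  proof (cases "k = i")
    case True
    then show ?thesis using hom_radical_cong[OF \<alpha>\<^sub>i i.is_group] \<alpha>(2) by simp
  next
    case False
    then show ?thesis
      using hom_radical_cong[OF zero_in_hom_radical[OF p_pos top_group[OF k]] group_G[OF k]] \<alpha>(3)[OF k] by simp
  qed
  then have \<alpha>_rad: "\<alpha> \<in> hom_radical p H S" using hom_radical_H_iff[OF \<alpha>(1)] by blast
  \<comment> \<open>Since \<open>\<kappa>\<close> extends \<open>\<kappa>\<^sub>i\<close>, a section
    for the factor is one for the product. With this choice both transfers involve the same Schreier
    elements.\<close>
  let ?s = "\<lambda>j. \<iota> i (s\<^sub>i j)"
  have s: "section_of p H \<kappa> ?s"
    using i.section_closed i.section_val kap(2) by (simp add: section_of_def)
  interpret section_hom p H S \<kappa> ?s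
    by unfold_locales (fact p1 topological_group_H kap(1) s)+
  obtain \<phi> where \<phi>: "\<phi> \<in> hom_radical p (H\<lparr>carrier := U\<rparr>) (subtopology S U)"
    "\<forall>x\<in>carrier H. \<alpha> x = transfer p H \<kappa> ?s \<phi> x"
    using KN kap(1) s \<alpha>_rad unfolding hom_kijima_nishi_def by blast
  have \<iota>U: "\<iota> i u \<in> U" if "u \<in> i.U" for u
    using that kap(2) by (auto simp: zero_fibre_def)
  have \<iota>_homU: "\<iota> i \<in> hom (G i\<lparr>carrier := i.U\<rparr>) (H\<lparr>carrier := U\<rparr>)"
    using \<iota>U by (auto simp: hom_def zero_fibre_def)
  have tsU: "topspace (subtopology (T i) i.U) = carrier (G i\<lparr>carrier := i.U\<rparr>)"
    using topspace_T[OF i] by (auto simp: zero_fibre_def)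
  have \<iota>_contU: "continuous_map (subtopology (T i) i.U) (subtopology S U) (\<iota> i)"
    using \<iota>U \<iota>_continuous[OF i] unfolding continuous_map_in_subtopology
    by (auto intro: continuous_map_from_subtopology)
  note restr = discrete_hom_continuous_compose[OF _ \<iota>_homU \<iota>_contU tsU]
  have "(\<lambda>u. \<phi> (\<iota> i u)) \<in> hom_radical p (G i\<lparr>carrier := i.U\<rparr>) (subtopology (T i) i.U)"
  proof (rule hom_radicalI[OF restr[OF hom_radicalD(1)[OF \<phi>(1)]]])
    fix \<beta> assume \<beta>: "\<beta> \<in> discrete_hom (G i\<lparr>carrier := i.U\<rparr>) (subtopology (T i) i.U) ?Z"
    obtain B\<^sub>i where B\<^sub>i: "B\<^sub>i \<in> discrete_hom (G i) (T i) (wreath p ?Z)"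
      "\<forall>g\<in>carrier (G i). fst (B\<^sub>i g) = \<kappa>\<^sub>i g" "\<And>u. u \<in> i.U \<Longrightarrow> snd (B\<^sub>i u) 0 = \<beta> u"
      using i.induced_hom[OF \<beta>] by metis
    obtain B where B: "B \<in> discrete_hom H S (wreath p ?Z)"
      "\<And>g. g \<in> carrier (G i) \<Longrightarrow> B (\<iota> i g) = B\<^sub>i g"
      "\<And>k g. k \<in> I \<Longrightarrow> k \<noteq> i \<Longrightarrow> g \<in> carrier (G k) \<Longrightarrow> B (\<iota> k g) = \<one>\<^bsub>wreath p ?Z\<^esub>"
      using extend_by_one[OF finite_p_group_wreath[OF p_pos Zp] i B\<^sub>i(1)] by metis
    \<comment> \<open>On the factor \<open>i\<close> this is the property of
      \<open>B\<^sub>i\<close>; on every other factor both sides are trivial. So the extended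
      \<open>B\<close> still lies over \<open>\<kappa>\<close>.\<close>
    have "fst (B (\<iota> k g)) = \<kappa> (\<iota> k g)" if "k \<in> I" "g \<in> carrier (G k)" for k g
      using B(2,3) B\<^sub>i(2) kap(2,3) that by (cases "k = i") auto
    then have \<kappa>B: "\<forall>x\<in>carrier H. fst (B x) = \<kappa> x"
      using discrete_hom_eqI[OF group_integer_mod_group discrete_hom_compose[OF B(1) wreath_fst_hom] kap(1)] by blast
    obtain h where h: "h \<in> discrete_hom (H\<lparr>carrier := U\<rparr>) (subtopology S U) (heisenberg p)"
      "\<And>x. x \<in> U \<Longrightarrow> heisenberg_abel (h x) = (\<phi> x, snd (B x) 0)"
      using hom_radicalD(2)[OF \<phi>(1) wreath_restrict_component[OF B(1) \<kappa>B]] by auto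
    have "heisenberg_abel (h (\<iota> i u)) = (\<phi> (\<iota> i u), \<beta> u)" if "u \<in> i.U" for u
      using h(2)[OF \<iota>U[OF that]] B(2)[of u] B\<^sub>i(3)[OF that] that by (auto simp: zero_fibre_def)
    then show "\<exists>h\<in>discrete_hom (G i\<lparr>carrier := i.U\<rparr>) (subtopology (T i) i.U) (heisenberg p).
        \<forall>g\<in>carrier (G i\<lparr>carrier := i.U\<rparr>). heisenberg_abel (h g) = (\<phi> (\<iota> i g), \<beta> g)"
      by (intro bexI[OF _ restr[OF h(1)]]) simp
  qed
  moreover have "\<alpha>\<^sub>i g = transfer p (G i) \<kappa>\<^sub>i s\<^sub>i (\<lambda>u. \<phi> (\<iota> i u)) g" if g: "g \<in> carrier (G i)" for g
  proof -
    have "\<iota> i (s\<^sub>i j) \<otimes>\<^bsub>H\<^esub> \<iota> i g \<otimes>\<^bsub>H\<^esub> inv\<^bsub>H\<^esub> \<iota> i (s\<^sub>i ((j + \<kappa>\<^sub>i g) mod int p)) =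
        \<iota> i (s\<^sub>i j \<otimes>\<^bsub>G i\<^esub> g \<otimes>\<^bsub>G i\<^esub> inv\<^bsub>G i\<^esub> s\<^sub>i ((j + \<kappa>\<^sub>i g) mod int p))" if "j \<in> ?J" for j
      using g i.section_closed[OF that] i.section_closed[OF i.mod_mem] by simp
    then have "transfer p H \<kappa> ?s \<phi> (\<iota> i g) = transfer p (G i) \<kappa>\<^sub>i s\<^sub>i (\<lambda>u. \<phi> (\<iota> i u)) g"
      using kap(2)[OF g] by (simp add: transfer_def)
    then show ?thesis using \<phi>(2) \<alpha>(2)[OF g] \<iota>.hom_closed[OF g] by simp
  qed
  ultimately show "\<exists>\<phi>\<in>hom_radical p (G i\<lparr>carrier := i.U\<rparr>) (subtopology (T i) i.U).
      \<forall>g\<in>carrier (G i). \<alpha>\<^sub>i g = transfer p (G i) \<kappa>\<^sub>i s\<^sub>i \<phi> g" by blast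
qed

text \<open>The local solutions of \<open>induced_radical_lift\<close> extend to one homomorphism
  \<open>\<Phi>\<close> over \<open>\<kappa>\<close>. Its coordinate 0 on the kernel is the required
  class: its corestriction and its cup products are expressed through homomorphisms of the product,
  which may be examined on factors.\<close>

theorem hom_kijima_nishi_product:
  assumes KN: "\<And>i. i \<in> I \<Longrightarrow> hom_kijima_nishi p (G i) (T i)"
  shows "hom_kijima_nishi p H S"
  unfolding hom_kijima_nishi_def
proof (intro ballI allI impI)
  let ?Z = "integer_mod_group p" and ?J = "{0..<int p}" and ?W = "wreath p (integer_mod_group p)"
  note Zp = finite_p_group_integer_mod[OF p_pos]
  have gZ: "group ?Z" by simp
  have p1: "1 < p" using prime_p prime_gt_1_nat by blast
  fix \<kappa> s \<alpha>
  assume \<kappa>: "\<kappa> \<in> discrete_hom H S ?Z" and s: "section_of p H \<kappa> s" and \<alpha>: "\<alpha> \<in> hom_radical p H S"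
  interpret section_hom p H S \<kappa> s
    by unfold_locales (fact p1 topological_group_H \<kappa> s)+
  note \<alpha>d = hom_radicalD(1)[OF \<alpha>]
  have "\<forall>i\<in>I. \<exists>M. M \<in> discrete_hom (G i) (T i) ?W \<and>
    (\<forall>g\<in>carrier (G i). fst (M g) = \<kappa> (\<iota> i g)) \<and>
    (\<forall>g\<in>carrier (G i). (\<Sum>j\<in>?J. snd (M g) j) mod int p = \<alpha> (\<iota> i g)) \<and>
    ((\<forall>g\<in>carrier (G i). \<kappa> (\<iota> i g) = 0 \<and> \<alpha> (\<iota> i g) = 0) \<longrightarrow> (\<forall>g\<in>carrier (G i). M g = \<one>\<^bsub>?W\<^esub>)) \<and>
    (\<forall>B\<in>discrete_hom (G i) (T i) ?W. (\<forall>g\<in>carrier (G i). fst (B g) = \<kappa> (\<iota> i g)) \<longrightarrow>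
      (\<exists>L\<in>discrete_hom (G i) (T i) (wreath p (heisenberg p)).
        \<forall>g\<in>carrier (G i). wreath_abel p (L g) = (\<kappa> (\<iota> i g), \<lambda>j\<in>?J. (snd (M g) j, snd (B g) j))))"
  proof
    fix i assume i: "i \<in> I"
    have "(\<lambda>g. \<alpha> (\<iota> i g)) \<in> hom_radical p (G i) (T i)"
      using \<alpha> i unfolding hom_radical_H_iff[OF \<alpha>d] by blast
    from induced_radical_lift[OF prime_p top_group[OF i] KN[OF i] discrete_hom_\<iota>[OF \<kappa> i] this]
    show "\<exists>M. M \<in> discrete_hom (G i) (T i) ?W \<and>
      (\<forall>g\<in>carrier (G i). fst (M g) = \<kappa> (\<iota> i g)) \<and>
      (\<forall>g\<in>carrier (G i). (\<Sum>j\<in>?J. snd (M g) j) mod int p = \<alpha> (\<iota> i g)) \<and>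
      ((\<forall>g\<in>carrier (G i). \<kappa> (\<iota> i g) = 0 \<and> \<alpha> (\<iota> i g) = 0) \<longrightarrow> (\<forall>g\<in>carrier (G i). M g = \<one>\<^bsub>?W\<^esub>)) \<and>
      (\<forall>B\<in>discrete_hom (G i) (T i) ?W. (\<forall>g\<in>carrier (G i). fst (B g) = \<kappa> (\<iota> i g)) \<longrightarrow>
        (\<exists>L\<in>discrete_hom (G i) (T i) (wreath p (heisenberg p)).
          \<forall>g\<in>carrier (G i). wreath_abel p (L g) = (\<kappa> (\<iota> i g), \<lambda>j\<in>?J. (snd (M g) j, snd (B g) j))))"
      unfolding Bex_def .
  qed
  from bchoice[OF this] obtain M where M: "\<And>i. i \<in> I \<Longrightarrow> M i \<in> discrete_hom (G i) (T i) ?W"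
    "\<And>i g. i \<in> I \<Longrightarrow> g \<in> carrier (G i) \<Longrightarrow> fst (M i g) = \<kappa> (\<iota> i g)"
    "\<And>i g. i \<in> I \<Longrightarrow> g \<in> carrier (G i) \<Longrightarrow> (\<Sum>j\<in>?J. snd (M i g) j) mod int p = \<alpha> (\<iota> i g)"
    "\<And>i. i \<in> I \<Longrightarrow> \<forall>g\<in>carrier (G i). \<kappa> (\<iota> i g) = 0 \<and> \<alpha> (\<iota> i g) = 0 \<Longrightarrow> \<forall>g\<in>carrier (G i). M i g = \<one>\<^bsub>?W\<^esub>"
    "\<And>i B. i \<in> I \<Longrightarrow> B \<in> discrete_hom (G i) (T i) ?W \<Longrightarrow> \<forall>g\<in>carrier (G i). fst (B g) = \<kappa> (\<iota> i g) \<Longrightarrow>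
      \<exists>L\<in>discrete_hom (G i) (T i) (wreath p (heisenberg p)).
        \<forall>g\<in>carrier (G i). wreath_abel p (L g) = (\<kappa> (\<iota> i g), \<lambda>j\<in>?J. (snd (M i g) j, snd (B g) j))"
    by blast
  \<comment> \<open>Both \<open>\<kappa>\<close> and \<open>\<alpha>\<close> are trivial on almost
    all factors, and there \<open>M i\<close> was chosen trivial.\<close>
  have "{i \<in> I. \<exists>g\<in>carrier (G i). M i g \<noteq> \<one>\<^bsub>?W\<^esub>} \<subseteq>
      {i \<in> I. \<exists>g\<in>carrier (G i). \<kappa> (\<iota> i g) \<noteq> \<one>\<^bsub>?Z\<^esub>} \<union> {i \<in> I. \<exists>g\<in>carrier (G i). \<alpha> (\<iota> i g) \<noteq> \<one>\<^bsub>?Z\<^esub>}"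
    unfolding one_integer_mod_group using M(4) by blast
  then have "finite {i \<in> I. \<exists>g\<in>carrier (G i). M i g \<noteq> \<one>\<^bsub>?W\<^esub>}"
    using discrete_hom_almost_trivial[OF gZ \<kappa>] discrete_hom_almost_trivial[OF gZ \<alpha>d]
    by (meson finite_UnI finite_subset)
  then obtain \<Phi> where \<Phi>: "\<Phi> \<in> discrete_hom H S ?W" "\<forall>i\<in>I. \<forall>g\<in>carrier (G i). \<Phi> (\<iota> i g) = M i g"
    using discrete_hom_extend[OF finite_p_group_wreath[OF p_pos Zp] M(1)] by blast
  have \<kappa>\<Phi>: "\<forall>x\<in>carrier H. fst (\<Phi> x) = \<kappa> x"
  proof
    show "fst (\<Phi> x) = \<kappa> x" if "x \<in> carrier H" for x
      by (rule discrete_hom_eqI[OF gZ discrete_hom_compose[OF \<Phi>(1) wreath_fst_hom] \<kappa> _ that]) (simp add: \<Phi>(2) M(2))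
  qed
  have sum\<Phi>: "(\<Sum>j\<in>?J. snd (\<Phi> x) j) mod int p = \<alpha> x" if "x \<in> carrier H" for x
    by (rule discrete_hom_eqI[OF gZ discrete_hom_compose[OF \<Phi>(1) wreath_sum_hom[OF p_pos]] \<alpha>d _ that]) (simp add: \<Phi>(2) M(3))
  let ?\<phi> = "\<lambda>u. snd (\<Phi> u) 0"
  have "?\<phi> \<in> hom_radical p (H\<lparr>carrier := U\<rparr>) (subtopology S U)"
  proof (rule hom_radicalI[OF wreath_restrict_component[OF \<Phi>(1) \<kappa>\<Phi>]])
    fix \<beta> assume \<beta>: "\<beta> \<in> discrete_hom (H\<lparr>carrier := U\<rparr>) (subtopology S U) ?Z"
    obtain B where B: "B \<in> discrete_hom H S ?W" "\<forall>x\<in>carrier H. fst (B x) = \<kappa> x"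
      "\<And>u. u \<in> U \<Longrightarrow> snd (B u) 0 = \<beta> u"
      using induced_hom[OF \<beta>] by metis
    note W\<Phi> = wreath_hom_component[OF p_pos topological_group_H \<Phi>(1) \<kappa>\<Phi>]
    note WB = wreath_hom_component[OF p_pos topological_group_H B(1,2)]
    \<comment> \<open>The pair of \<open>\<Phi>\<close> and \<open>B\<close> as a homomorphism to
      the wreath product of C_p x C_p. A lift to the wreath product of the Heisenberg group yields,
      in coordinate 0, the lift on the kernel that kills the cup product with
      \<open>\<beta>\<close>.\<close>
    let ?x = "\<lambda>y. (\<kappa> y, \<lambda>j\<in>?J. (snd (\<Phi> y) j, snd (B y) j))"
    have opn: "openin S (carrier H)" using topspace_S openin_topspace[of S] by simp
    have x: "?x \<in> discrete_hom H S (wreath p (?Z \<times>\<times> ?Z))"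
      using W\<Phi>(1,2,3) WB(1,2,3)
      by (intro discrete_hom_wreathI[OF p_pos opn \<kappa>] openin_fibre_Pair) (simp_all add: DirProd_def)
    have "\<exists>L\<in>discrete_hom H S (wreath p (heisenberg p)). \<forall>y\<in>carrier H. wreath_abel p (L y) = ?x y"
    proof (rule lift_if_locally[OF _ _ wreath_abel_hom x])
      show "finite_p_group p (wreath p (heisenberg p))"
        by (intro finite_p_group_wreath finite_p_group_heisenberg p_pos)
      show "group (wreath p (?Z \<times>\<times> ?Z))"
        by (intro group_wreath p_pos DirProd_group) simp_all
      fix i assume i: "i \<in> I"
      have "\<forall>g\<in>carrier (G i). fst (B (\<iota> i g)) = \<kappa> (\<iota> i g)"
        using B(2) \<iota>_hom[OF i] by (auto simp: hom_def)
      \<comment> \<open>The last clause on \<open>M i\<close> holds against every class over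
        \<open>\<kappa>\<close> on the factor, in particular against the restriction of
        \<open>B\<close>.\<close>
      from M(5)[OF i discrete_hom_\<iota>[OF B(1) i] this]
      show "\<exists>L\<in>discrete_hom (G i) (T i) (wreath p (heisenberg p)).
          \<forall>g\<in>carrier (G i). wreath_abel p (L g) = ?x (\<iota> i g)"
        using \<Phi>(2) i by simp
    qed
    then obtain L where L: "L \<in> discrete_hom H S (wreath p (heisenberg p))"
      "\<And>y. y \<in> carrier H \<Longrightarrow> wreath_abel p (L y) = ?x y" by blast
    have \<kappa>L: "\<forall>y\<in>carrier H. fst (L y) = \<kappa> y" using L(2) by simp
    have "heisenberg_abel (snd (L u) 0) = (?\<phi> u, \<beta> u)" if u: "u \<in> U" for u
    proof -
      have "u \<in> carrier H" using u by (simp add: zero_fibre_def)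
      then have "snd (wreath_abel p (L u)) 0 = snd (?x u) 0" using L(2) by simp
      then show ?thesis using B(3)[OF u] p_pos by simp
    qed
    then show "\<exists>h\<in>discrete_hom (H\<lparr>carrier := U\<rparr>) (subtopology S U) (heisenberg p).
        \<forall>u\<in>carrier (H\<lparr>carrier := U\<rparr>). heisenberg_abel (h u) = (?\<phi> u, \<beta> u)"
      by (intro bexI[OF _ wreath_restrict_component[OF L(1) \<kappa>L]]) simp
  qed
  moreover have "\<alpha> x = transfer p H \<kappa> s ?\<phi> x" if "x \<in> carrier H" for x
    using transfer_component[OF \<Phi>(1) \<kappa>\<Phi> that] sum\<Phi>[OF that] by simp
  ultimately show "\<exists>\<phi>\<in>hom_radical p (H\<lparr>carrier := U\<rparr>) (subtopology S U).
      \<forall>x\<in>carrier H. \<alpha> x = transfer p H \<kappa> s \<phi> x" by blast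
qed

end

theorem proposition3p7:
  fixes p :: nat
    and I :: "'i set"
    and G :: "'i \<Rightarrow> ('a, 'b) monoid_scheme"
    and T :: "'i \<Rightarrow> 'a topology"
  assumes "prime p"
    and "\<And>i. i \<in> I \<Longrightarrow> pro_p_group p (G i) (T i)"
  shows "kijima_nishi p (free_pro_p_product p I G T) (free_pro_p_topology p I G T) \<longleftrightarrow>
    (\<forall>i\<in>I. kijima_nishi p (G i) (T i))"
proof -
  interpret free_pro_p p I G T
    using assms by unfold_locales (auto simp: pro_p_group_def profinite_group_def)
  have "kijima_nishi p (free_pro_p_product p I G T) (free_pro_p_topology p I G T) \<longleftrightarrow>
      hom_kijima_nishi p (free_pro_p_product p I G T) (free_pro_p_topology p I G T)"
    using kijima_nishi_iff[OF prime_p topological_group_H] .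
  also have "\<dots> \<longleftrightarrow> (\<forall>i\<in>I. hom_kijima_nishi p (G i) (T i))"
    using hom_kijima_nishi_factor hom_kijima_nishi_product by blast
  also have "\<dots> \<longleftrightarrow> (\<forall>i\<in>I. kijima_nishi p (G i) (T i))"
    using kijima_nishi_iff[OF prime_p top_group] by blast
  finally show ?thesis .
qed

end
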